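(* Let $H:=\sum_{k\ge 1}\frac{\varepsilon_k}{k}$, where $\varepsilon_1,\varepsilon_2,\dots$ are independent random variables with $P(\varepsilon_k=1)=P(\varepsilon_k=-1)=\frac12$ (this series converges almost surely). For $n\in\mathbb{N}$, let $P_n$ be the uniform probability measure on the set of distinct parts partitions of $n$, and for such a partition $\lambda=(\lambda_1>\dots>\lambda_\ell>0)$ with $\sum_j\lambda_j=n$ let $S(\lambda):=\sum_{j=1}^{\ell}\frac{1}{\lambda_j}$. Then for every $x\in\mathbb{R}$, $$\lim_{n\to\infty}P_n\left(2S-\log(\sqrt{3n})\le x\right)=P(H\le x).$$
   Context: A distinct parts partition of $n\in\mathbb{N}$ is a sequence of integers $\lambda_1>\lambda_2>\dots>\lambda_\ell>0$ with $\sum_{j=1}^\ell \lambda_j=n$. $S$ is regarded as a random variable on distinct parts partitions of $n$ under $P_n$. *)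

theory Defs
  imports "HOL-Probability.Probability"
begin

definition distinct_partitions :: "nat \<Rightarrow> nat list set" where
  "distinct_partitions n =
     {ps. sorted_wrt (>) ps \<and> (\<forall>p\<in>set ps. 0 < p) \<and> sum_list ps = n}"

definition recip_sum :: "nat list \<Rightarrow> real" where
  "recip_sum ps = (\<Sum>p\<leftarrow>ps. 1 / real p)"

definition partition_measure :: "nat \<Rightarrow> nat list measure" where
  "partition_measure n = uniform_count_measure (distinct_partitions n)"

text \<open>
  The series is only conditionally convergent, so it is summed in its natural order,
  with the index shifted to start at 1. On the null set of divergence the
  value is the fixed unspecified real that \<^const>\<open>suminf\<close> returns.
\<close>

definition random_harmonic :: "(nat \<Rightarrow> 'a \<Rightarrow> real) \<Rightarrow> 'a \<Rightarrow> real" where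
  "random_harmonic \<epsilon> \<omega> = (\<Sum>k. \<epsilon> (Suc k) \<omega> / real (Suc k))"

lemma finite_distinct_partitions: "finite (distinct_partitions n)"
proof -
  have "length ps \<le> sum_list ps" if "\<forall>p\<in>set ps. 0 < p" for ps :: "nat list"
    using that by (induction ps) auto
  then have "distinct_partitions n \<subseteq> {ps. set ps \<subseteq> {..n} \<and> length ps \<le> n}"
    unfolding distinct_partitions_def by (auto dest: member_le_sum_list)
  then show ?thesis
    using finite_lists_length_le[of "{..n}" n] finite_subset by blast
qed

lemma distinct_partitions_nonempty: "distinct_partitions n \<noteq> {}"
proof (cases "n = 0")
  case True
  then have "[] \<in> distinct_partitions n" by (simp add: distinct_partitions_def)
  then show ?thesis by blast
next
  case False
  then have "[n] \<in> distinct_partitions n" by (simp add: distinct_partitions_def)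
  then show ?thesis by blast
qed

lemma prob_space_partition_measure: "prob_space (partition_measure n)"
  unfolding partition_measure_def
  by (rule prob_space_uniform_count_measure
        [OF finite_distinct_partitions distinct_partitions_nonempty])

end

theory Submission
  imports Defs
begin

text \<open>
  Include each \<open>k\<close> independently with probability \<open>1 / (exp (t k) + 1)\<close>. Conditioned on total size \<open>n\<close>,
  the resulting random set is a uniform partition of \<open>n\<close> into distinct parts, so Fourier inversion in
  the size writes the characteristic function of \<open>2 S\<close> under \<open>P_n\<close> as a quotient of two integrals of
  explicit finite products. For \<open>t = pi / (2 sqrt (3 n))\<close> the expected size is \<open>n\<close> up to an error that
  is negligible against the standard deviation \<open>\<sigma>\<close> of the size, and the expectation of \<open>2 S\<close> is
  \<open>ln (sqrt (3 n)) + o(1)\<close>. After centering and rescaling the frequency by \<open>\<sigma>\<close>, the product over \<open>k\<close>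
  tends to \<open>(\<Prod>k. cos (v / k)) * exp (- u\<^sup>2 / 2)\<close>: the small parts, which are asymptotically fair coins,
  carry \<open>S\<close>, and the parts of order \<open>sqrt n\<close> carry the size. Dominated convergence and Levy's
  continuity theorem then give weak convergence, and the limit has no atoms because its
  characteristic function vanishes at infinity.
\<close>

section \<open>Random harmonic series\<close>

text \<open>The delicate quantity is the mean of \<open>2 S\<close>: it is needed up to o(1),
  constant included, because that constant must cancel the \<open>pi / 2\<close> in \<open>t\<close>
  for \<open>sqrt (3 n)\<close> to be the right centering. Expanding
  \<open>1 / (exp (t k) + 1)\<close> in powers of \<open>exp (- t k)\<close> and pairing
  neighbouring terms turns the constant into the logarithm of Wallis' product. The mean size may be
  off by O(1/t), since \<sigma> is of order t^(-3/2); a comparison of alternating sums with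
  decreasing terms is precise enough for that.

  Reciprocal sum and size decouple because the cross term
  \<open>(2 v / k) * (u k / \<sigma>)\<close> of the two phases does not depend on \<open>k\<close>:
  weighted by the variances it sums to O(1 / (t \<sigma>)) = O(sqrt t).

  The obstacle for dominated convergence is that Fourier inversion runs over the full period
  \<open>\<bar>u\<bar> \<le> pi \<sigma>\<close>, where Taylor expansion says nothing. The
  integrable bound there comes from the parts \<open>k \<le> 1 / t\<close> alone: each has variance
  at least 1/12, and a Dirichlet kernel shows that their phases cannot all be close to multiples of
  2 pi.\<close>

locale random_signs = prob_space M for M :: "'a measure" +
  fixes \<epsilon> :: "nat \<Rightarrow> 'a \<Rightarrow> real"
  assumes indep: "indep_vars (\<lambda>_. borel) \<epsilon> {1..}"
    and prob_plus: "\<And>k. k \<ge> 1 \<Longrightarrow> prob {\<omega> \<in> space M. \<epsilon> k \<omega> = 1} = 1 / 2"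
    and prob_minus: "\<And>k. k \<ge> 1 \<Longrightarrow> prob {\<omega> \<in> space M. \<epsilon> k \<omega> = -1} = 1 / 2"
begin

lemma measurable_sign: "k \<ge> 1 \<Longrightarrow> \<epsilon> k \<in> borel_measurable M"
  using indep unfolding indep_vars_def by auto

lemma AE_sign:
  assumes "k \<ge> 1"
  shows "AE \<omega> in M. \<epsilon> k \<omega> = 1 \<or> \<epsilon> k \<omega> = -1"
proof -
  note [measurable] = measurable_sign[OF assms]
  have "prob ({\<omega> \<in> space M. \<epsilon> k \<omega> = 1} \<union> {\<omega> \<in> space M. \<epsilon> k \<omega> = -1}) = 1"
    by (subst finite_measure_Union) (auto simp: prob_plus[OF assms] prob_minus[OF assms])
  then have "AE \<omega> in M. \<omega> \<in> {\<omega> \<in> space M. \<epsilon> k \<omega> = 1} \<union> {\<omega> \<in> space M. \<epsilon> k \<omega> = -1}"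
    by (rule AE_prob_1)
  then show ?thesis by (rule AE_mp) auto
qed

lemma has_bochner_integral_sign:
  fixes f :: "real \<Rightarrow> 'b::{banach, second_countable_topology}"
  assumes "k \<ge> 1" and [measurable]: "f \<in> borel_measurable borel"
  shows "has_bochner_integral M (\<lambda>\<omega>. f (\<epsilon> k \<omega>)) ((1/2) *\<^sub>R (f 1 + f (-1)))"
proof -
  note [measurable] = measurable_sign[OF assms(1)]
  have "has_bochner_integral M
      (\<lambda>\<omega>. indicat_real {\<omega> \<in> space M. \<epsilon> k \<omega> = 1} \<omega> *\<^sub>R f 1
         + indicat_real {\<omega> \<in> space M. \<epsilon> k \<omega> = -1} \<omega> *\<^sub>R f (-1))
      (prob {\<omega> \<in> space M. \<epsilon> k \<omega> = 1} *\<^sub>R f 1 + prob {\<omega> \<in> space M. \<epsilon> k \<omega> = -1} *\<^sub>R f (-1))"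
    by (intro has_bochner_integral_add has_bochner_integral_scaleR_left has_bochner_integral_real_indicator)
       (auto simp: emeasure_eq_measure)
  then have "has_bochner_integral M
      (\<lambda>\<omega>. indicat_real {\<omega> \<in> space M. \<epsilon> k \<omega> = 1} \<omega> *\<^sub>R f 1
         + indicat_real {\<omega> \<in> space M. \<epsilon> k \<omega> = -1} \<omega> *\<^sub>R f (-1)) ((1/2) *\<^sub>R (f 1 + f (-1)))"
    by (simp add: prob_plus[OF assms(1)] prob_minus[OF assms(1)] scaleR_add_right)
  then show ?thesis
  proof (rule has_bochner_integralI_AE)
    show "AE \<omega> in M. indicat_real {\<omega> \<in> space M. \<epsilon> k \<omega> = 1} \<omega> *\<^sub>R f 1
         + indicat_real {\<omega> \<in> space M. \<epsilon> k \<omega> = -1} \<omega> *\<^sub>R f (-1) = f (\<epsilon> k \<omega>)"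
      using AE_sign[OF assms(1)] by (rule AE_mp) (auto intro!: AE_I2 simp: indicator_def)
  qed simp
qed

lemma integral_sign_mult:
  assumes "i \<ge> 1" "j \<ge> 1"
  shows "has_bochner_integral M (\<lambda>\<omega>. \<epsilon> i \<omega> * \<epsilon> j \<omega>) (if i = j then 1 else 0)"
proof (cases "i = j")
  case True
  then show ?thesis
    using has_bochner_integral_sign[of i "\<lambda>x. x * x"] assms by simp
next
  case False
  have 1: "has_bochner_integral M (\<epsilon> k) 0" if "k \<ge> 1" for k
    using has_bochner_integral_sign[of k "\<lambda>x. x"] that by simp
  have "indep_var borel (\<epsilon> i) borel (\<epsilon> j)"
    using indep_vars_sum[of "{j}" i \<epsilon>] indep_vars_subset[OF indep, of "{i,j}"] False assms
    by auto
  then show ?thesis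
    using indep_var_lebesgue_integral[of "\<epsilon> i" "\<epsilon> j"] indep_var_integrable[of "\<epsilon> i" "\<epsilon> j"] 1[OF assms(1)] 1[OF assms(2)] False
    by (simp add: has_bochner_integral_iff)
qed

lemma has_bochner_integral_square_sum:
  assumes "finite A" "A \<subseteq> {1..}"
  shows "has_bochner_integral M (\<lambda>\<omega>. (\<Sum>k\<in>A. c k * \<epsilon> k \<omega>)\<^sup>2) (\<Sum>k\<in>A. (c k)\<^sup>2)"
proof -
  have "has_bochner_integral M (\<lambda>\<omega>. \<Sum>i\<in>A. \<Sum>j\<in>A. c i * c j * (\<epsilon> i \<omega> * \<epsilon> j \<omega>))
          (\<Sum>i\<in>A. \<Sum>j\<in>A. c i * c j * (if i = j then 1 else 0))"
    using assms by (intro has_bochner_integral_sum has_bochner_integral_mult_right integral_sign_mult) auto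
  also have "(\<Sum>i\<in>A. \<Sum>j\<in>A. c i * c j * (if i = j then 1 else 0)) = (\<Sum>k\<in>A. (c k)\<^sup>2)"
    using assms(1) by (intro sum.cong) (auto simp: power2_eq_square if_distrib cong: if_cong)
  also have "(\<lambda>\<omega>. \<Sum>i\<in>A. \<Sum>j\<in>A. c i * c j * (\<epsilon> i \<omega> * \<epsilon> j \<omega>)) = (\<lambda>\<omega>. (\<Sum>k\<in>A. c k * \<epsilon> k \<omega>)\<^sup>2)"
    by (auto simp: power2_eq_square sum_product algebra_simps)
  finally show ?thesis .
qed

end

section \<open>Almost sure convergence of the random harmonic series\<close>

lemma sum_inverse_square_le:
  assumes "1 \<le> a" "a \<le> b"
  shows "(\<Sum>k\<in>{a<..b}. (1 / real k)\<^sup>2) \<le> 1 / real a"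
proof -
  have "(\<Sum>k\<in>{a<..b}. (1 / real k)\<^sup>2) \<le> 1 / real a - 1 / real b"
    using assms(2)
  proof (induction b rule: dec_induct)
    case (step n)
    have "(1 / real (Suc n))\<^sup>2 \<le> 1 / real n - 1 / real (Suc n)"
    proof -
      have "(1 / real (Suc n))\<^sup>2 \<le> 1 / (real n * real (Suc n))"
        using step assms(1) by (subst power_divide, simp only: power_one power2_eq_square)
          (intro frac_le mult_right_mono mult_pos_pos, auto)
      also have "\<dots> = 1 / real n - 1 / real (Suc n)"
        using step assms(1) by (simp add: field_simps)
      finally show ?thesis .
    qed
    moreover have "{a<..Suc n} = insert (Suc n) {a<..n}" using step by auto
    ultimately show ?case using step by simp
  qed simp
  also have "\<dots> \<le> 1 / real a" by simp
  finally show ?thesis .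
qed


text \<open>Within one block the partial sums move by at most the block's sum of \<open>1 / k\<close>, which tends to \<open>0\<close>;
  this makes a maximal inequality unnecessary.\<close>

lemma summable_if_fourth_power_blocks_summable:
  fixes e :: "nat \<Rightarrow> real"
  assumes e: "\<And>k. k \<ge> 1 \<Longrightarrow> \<bar>e k\<bar> \<le> 1"
    and blocks: "summable (\<lambda>j. \<Sum>k\<in>{Suc j ^ 4<..Suc (Suc j) ^ 4}. e k / real k)"
  shows "summable (\<lambda>k. e (Suc k) / real (Suc k))"
proof -
  define S where "S n = (\<Sum>k\<in>{0<..n}. e k / real k)" for n
  define L where "L = S 1 + (\<Sum>j. \<Sum>k\<in>{Suc j ^ 4<..Suc (Suc j) ^ 4}. e k / real k)"
  have split: "S b - S a = (\<Sum>k\<in>{a<..b}. e k / real k)" if "a \<le> b" for a b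
  proof -
    have "{0<..b} = {0<..a} \<union> {a<..b}" using that by auto
    then have "S b = S a + (\<Sum>k\<in>{a<..b}. e k / real k)"
      unfolding S_def by (simp only:) (subst sum.union_disjoint, auto)
    then show ?thesis by simp
  qed
  have "S (Suc j ^ 4) = S 1 + (\<Sum>i<j. \<Sum>k\<in>{Suc i ^ 4<..Suc (Suc i) ^ 4}. e k / real k)" for j
  proof (induction j)
    case (Suc j)
    have "S (Suc (Suc j) ^ 4) = S (Suc j ^ 4) + (\<Sum>k\<in>{Suc j ^ 4<..Suc (Suc j) ^ 4}. e k / real k)"
      using split[of "Suc j ^ 4" "Suc (Suc j) ^ 4"] power_mono[of "Suc j" "Suc (Suc j)" 4] by simp
    then show ?case using Suc by simp
  qed simp
  then have lim: "(\<lambda>j. S (Suc j ^ 4)) \<longlonglongrightarrow> L"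
    unfolding L_def by (auto intro!: tendsto_add summable_LIMSEQ blocks)
  \<comment> \<open>For consecutive block ends \<open>a\<close> and \<open>b\<close> this expression
    is \<open>(b - a) / a\<close>, which bounds the sum of \<open>1 / k\<close> over the
    block.\<close>
  have lim0: "(\<lambda>j. ((2 + real j) / (1 + real j)) ^ 4 - 1) \<longlonglongrightarrow> 0"
  proof -
    have "(\<lambda>j. (1 + inverse (real (Suc j))) ^ 4 - 1) \<longlonglongrightarrow> (1 + 0) ^ 4 - 1"
      by (intro tendsto_intros LIMSEQ_inverse_real_of_nat)
    moreover have "1 + inverse (real (Suc j)) = (2 + real j) / (1 + real j)" for j
      by (simp add: field_simps)
    ultimately show ?thesis by simp
  qed
  have "S \<longlonglongrightarrow> L"
  proof (rule LIMSEQ_I)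
    fix r :: real assume "0 < r"
    then have "\<forall>\<^sub>F j in sequentially. dist (S (Suc j ^ 4)) L < r / 2"
      "\<forall>\<^sub>F j in sequentially. dist (((2 + real j) / (1 + real j)) ^ 4 - 1) 0 < r / 2"
      by (intro tendstoD[OF lim] tendstoD[OF lim0] half_gt_zero; assumption)+
    then have "\<forall>\<^sub>F j in sequentially. dist (S (Suc j ^ 4)) L < r / 2
        \<and> dist (((2 + real j) / (1 + real j)) ^ 4 - 1) 0 < r / 2"
      by (rule eventually_conj)
    then obtain j0 where "\<And>j. j \<ge> j0 \<Longrightarrow> dist (S (Suc j ^ 4)) L < r / 2
        \<and> dist (((2 + real j) / (1 + real j)) ^ 4 - 1) 0 < r / 2"
      unfolding eventually_sequentially by auto
    then have j0: "\<bar>S (Suc j ^ 4) - L\<bar> < r / 2" "((2 + real j) / (1 + real j)) ^ 4 - 1 < r / 2" if "j \<ge> j0" for j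
      using that unfolding dist_real_def by force+
    show "\<exists>no. \<forall>n\<ge>no. norm (S n - L) < r"
    proof (intro exI allI impI)
      fix n assume n: "Suc j0 ^ 4 \<le> n"
      \<comment> \<open>Chosen so that \<open>(m + 1) ^ 4 \<le> n < (m + 2) ^ 4\<close>; the partial
        sum at \<open>n\<close> is compared with the one at the left end.\<close>
      define m where "m = (LEAST m. n < (m + 2) ^ 4)"
      have "n < (n + 2) ^ 4" using self_le_power[of "n + 2" 4] by linarith
      then have m1: "n < (m + 2) ^ 4" unfolding m_def by (rule LeastI)
      have m2: "(m + 1) ^ 4 \<le> n"
      proof (cases m)
        case 0
        have "1 \<le> n" using n one_le_power[of "Suc j0" 4] by linarith
        then show ?thesis using 0 by simp
      next
        case (Suc m')
        then have "\<not> n < (m' + 2) ^ 4" unfolding m_def by (intro not_less_Least) auto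
        then show ?thesis using Suc by simp
      qed
      have m3: "j0 \<le> m"
      proof (rule ccontr)
        assume "\<not> j0 \<le> m"
        then have "(m + 2) ^ 4 \<le> Suc j0 ^ 4" by (intro power_mono) auto
        then have "(m + 2) ^ 4 \<le> n" using n by (rule order_trans)
        with m1 show False by (meson leD)
      qed
      define a where "a = Suc m ^ 4"
      define b where "b = (m + 2) ^ 4"
      have ab: "a \<le> n" "n \<le> b" "1 \<le> a"
        using m1 m2 one_le_power[of "Suc m" 4] unfolding a_def b_def by (auto simp only: less_imp_le Suc_eq_plus1)
      have "\<bar>S n - S a\<bar> \<le> (\<Sum>k\<in>{a<..n}. \<bar>e k / real k\<bar>)"
        unfolding split[OF ab(1)] by (rule sum_abs)
      also have "\<dots> \<le> (\<Sum>k\<in>{a<..n}. 1 / real a)"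
      proof (rule sum_mono)
        fix k assume k: "k \<in> {a<..n}"
        with ab have "k \<ge> 1" by simp
        with k ab e[of k] show "\<bar>e k / real k\<bar> \<le> 1 / real a"
          by (simp only: abs_divide abs_of_nat) (intro frac_le, auto)
      qed
      also have "\<dots> = (real n - real a) / real a"
        using ab by (simp add: of_nat_diff)
      also have "\<dots> \<le> (real b - real a) / real a"
        using ab by (intro divide_right_mono diff_right_mono) auto
      also have "\<dots> = ((2 + real m) / (1 + real m)) ^ 4 - 1"
      proof -
        have "real b = (2 + real m) ^ 4" "real a = (1 + real m) ^ 4"
          unfolding a_def b_def of_nat_power by (simp_all add: add.commute)
        then show ?thesis using ab(3) by (simp add: diff_divide_distrib power_divide)
      qed
      also have "\<dots> < r / 2" using j0(2)[OF m3] .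
      finally show "norm (S n - L) < r" using j0(1)[OF m3] unfolding a_def real_norm_def by linarith
    qed
  qed
  moreover have "S = (\<lambda>n. \<Sum>k<n. e (Suc k) / real (Suc k))"
    unfolding S_def by (rule ext, rule sum.reindex_bij_witness[of _ Suc "\<lambda>k. k - 1"]) auto
  ultimately have "(\<lambda>k. e (Suc k) / real (Suc k)) sums L"
    unfolding sums_def by (simp only:)
  then show ?thesis by (rule sums_summable)
qed

context random_signs
begin

lemma AE_signs: "AE \<omega> in M. \<forall>k\<ge>1. \<epsilon> k \<omega> = 1 \<or> \<epsilon> k \<omega> = -1"
  using AE_sign AE_all_countable[where P = "\<lambda>k \<omega>. k \<ge> 1 \<longrightarrow> \<epsilon> k \<omega> = 1 \<or> \<epsilon> k \<omega> = -1"] by auto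

text \<open>The signs are orthogonal, so a block has second moment at most
  \<open>1 / Suc j ^ 4\<close> and hence L1 norm at most the root of this. Fourth powers as block
  ends make that root rational and summable in \<open>j\<close>, while \<open>1 / k\<close> still
  sums to o(1) over each block.\<close>

lemma nn_integral_block_le:
  "(\<integral>\<^sup>+ \<omega>. ennreal \<bar>\<Sum>k\<in>{Suc j ^ 4<..Suc (Suc j) ^ 4}. \<epsilon> k \<omega> / real k\<bar> \<partial>M)
     \<le> ennreal (inverse (real (Suc j) ^ 2))"
proof -
  define B where "B = {Suc j ^ 4<..Suc (Suc j) ^ 4}"
  define X where "X \<omega> = (\<Sum>k\<in>B. \<epsilon> k \<omega> / real k)" for \<omega>
  define a where "a = inverse (real (Suc j) ^ 2)"
  have a: "a > 0" unfolding a_def by simp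
  have a2: "a * a = 1 / real (Suc j ^ 4)" unfolding a_def by (simp add: field_simps power4_eq_xxxx power2_eq_square)
  have B: "finite B" "B \<subseteq> {1..}" unfolding B_def by auto
  have hb: "has_bochner_integral M (\<lambda>\<omega>. (X \<omega>)\<^sup>2) (\<Sum>k\<in>B. (1 / real k)\<^sup>2)"
    using has_bochner_integral_square_sum[OF B, of "\<lambda>k. 1 / real k"] unfolding X_def by simp
  have le: "(\<Sum>k\<in>B. (1 / real k)\<^sup>2) \<le> a * a"
    unfolding B_def a2 using power_mono[of "Suc j" "Suc (Suc j)" 4] by (intro sum_inverse_square_le) auto
  \<comment> \<open>Weighted arithmetic-geometric mean; with \<open>a\<close> the bound for the
    standard deviation it takes the role of the Cauchy-Schwarz inequality.\<close>
  have pt: "\<bar>x\<bar> \<le> (a + x\<^sup>2 / a) / 2" for x :: real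
  proof -
    have "0 \<le> (\<bar>x\<bar> - a)\<^sup>2" by simp
    then show ?thesis using a by (simp add: field_simps power2_eq_square abs_mult_self_eq)
  qed
  have hb2: "has_bochner_integral M (\<lambda>\<omega>. (a + (X \<omega>)\<^sup>2 / a) / 2) ((a * prob (space M) + (\<Sum>k\<in>B. (1 / real k)\<^sup>2) / a) / 2)"
    using hb by (auto simp: has_bochner_integral_iff)
  have "(\<integral>\<^sup>+ \<omega>. ennreal \<bar>X \<omega>\<bar> \<partial>M) \<le> (\<integral>\<^sup>+ \<omega>. ennreal ((a + (X \<omega>)\<^sup>2 / a) / 2) \<partial>M)"
    using pt by (intro nn_integral_mono ennreal_leI)
  also have "\<dots> = ennreal ((a + (\<Sum>k\<in>B. (1 / real k)\<^sup>2) / a) / 2)"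
    using hb2 a by (subst nn_integral_eq_integral) (auto simp: has_bochner_integral_iff prob_space)
  also have "\<dots> \<le> ennreal a"
    using le a by (intro ennreal_leI) (simp add: field_simps)
  finally show ?thesis unfolding X_def B_def a_def .
qed

theorem AE_summable_harmonic: "AE \<omega> in M. summable (\<lambda>k. \<epsilon> (Suc k) \<omega> / real (Suc k))"
proof -
  define X where "X j \<omega> = (\<Sum>k\<in>{Suc j ^ 4<..Suc (Suc j) ^ 4}. \<epsilon> k \<omega> / real k)" for j \<omega>
  have [measurable]: "X j \<in> borel_measurable M" for j
    unfolding X_def by (intro borel_measurable_sum borel_measurable_divide measurable_sign) auto
  have "(\<integral>\<^sup>+ \<omega>. (\<Sum>j. ennreal \<bar>X j \<omega>\<bar>) \<partial>M) = (\<Sum>j. \<integral>\<^sup>+ \<omega>. ennreal \<bar>X j \<omega>\<bar> \<partial>M)"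
    by (intro nn_integral_suminf) auto
  also have "\<dots> \<le> (\<Sum>j. ennreal (inverse (real (Suc j) ^ 2)))"
    unfolding X_def by (intro suminf_le nn_integral_block_le) auto
  also have "\<dots> < \<infinity>"
  proof -
    have "summable (\<lambda>j. inverse (real (Suc j) ^ 2))"
      using summable_ignore_initial_segment[OF inverse_power_summable[of 2, where ?'a = real], of 1] by simp
    then have "(\<Sum>j. ennreal (inverse (real (Suc j) ^ 2))) \<noteq> top"
      by (rule ennreal_suminf_neq_top) simp
    then show ?thesis unfolding infinity_ennreal_def by (rule top.not_eq_extremum[THEN iffD1])
  qed
  finally have "AE \<omega> in M. (\<Sum>j. ennreal \<bar>X j \<omega>\<bar>) \<noteq> \<infinity>"
    by (intro nn_integral_PInf_AE) auto
  then show ?thesis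
  using AE_signs
  proof eventually_elim
    case (elim \<omega>)
    then have "summable (\<lambda>j. \<bar>X j \<omega>\<bar>)" by (intro summable_suminf_not_top) auto
    then have "summable (\<lambda>j. X j \<omega>)" by (rule summable_rabs_cancel)
    then show ?case
      unfolding X_def using elim by (intro summable_if_fourth_power_blocks_summable) force+
  qed
qed

section \<open>Characteristic function of the limit as an infinite product of cosines\<close>

lemma char_harmonic_partial:
  "char (distr M borel (\<lambda>\<omega>. \<Sum>k\<in>{1..n}. \<epsilon> k \<omega> / real k)) t = (\<Prod>k\<in>{1..n}. of_real (cos (t / real k)))"
proof -
  have "indep_vars (\<lambda>_. borel) (\<lambda>k \<omega>. \<epsilon> k \<omega> / real k) {1..n}"
    using indep_vars_compose2[OF indep_vars_subset[OF indep, of "{1..n}"],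
        of "\<lambda>k x. x / real k" "\<lambda>_. borel"] by auto
  then have "char (distr M borel (\<lambda>\<omega>. \<Sum>k\<in>{1..n}. \<epsilon> k \<omega> / real k)) t
      = (\<Prod>k\<in>{1..n}. char (distr M borel (\<lambda>\<omega>. \<epsilon> k \<omega> / real k)) t)"
    by (rule char_distr_sum)
  also have "\<dots> = (\<Prod>k\<in>{1..n}. of_real (cos (t / real k)))"
  proof (rule prod.cong)
    fix k assume "k \<in> {1..n}"
    then have k: "k \<ge> 1" by simp
    note [measurable] = measurable_sign[OF k]
    have "char (distr M borel (\<lambda>\<omega>. \<epsilon> k \<omega> / real k)) t = (CLINT \<omega>|M. iexp (t * (\<epsilon> k \<omega> / real k)))"
      unfolding char_def by (subst integral_distr) auto
    also have "\<dots> = (1/2) *\<^sub>R (iexp (t * (1 / real k)) + iexp (t * (-1 / real k)))"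
      using has_bochner_integral_sign[OF k, of "\<lambda>x. iexp (t * (x / real k))"]
      by (auto dest!: has_bochner_integral_integral_eq)
    also have "\<dots> = of_real (cos (t / real k))"
      by (rule complex_eqI) (auto simp: Re_exp Im_exp)
    finally show "char (distr M borel (\<lambda>\<omega>. \<epsilon> k \<omega> / real k)) t = of_real (cos (t / real k))" .
  qed simp
  finally show ?thesis .
qed

lemma measurable_random_harmonic [measurable]: "random_harmonic \<epsilon> \<in> borel_measurable M"
  unfolding random_harmonic_def by (intro borel_measurable_suminf borel_measurable_divide measurable_sign) auto

lemma real_distribution_harmonic: "real_distribution (distr M borel (random_harmonic \<epsilon>))"
  by (rule real_distribution_distr) simp

text \<open>Almost sure convergence passes to characteristic functions by dominated convergence. The
  product is kept as a limit of partial products: the partition side meets the random series only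
  through this limit, as the assumption on \<open>\<phi>\<close> in later lemmas.\<close>

lemma char_harmonic:
  "(\<lambda>n. \<Prod>k\<in>{1..n}. complex_of_real (cos (t / real k)))
     \<longlonglongrightarrow> char (distr M borel (random_harmonic \<epsilon>)) t"
proof -
  have [measurable]: "(\<lambda>\<omega>. \<Sum>k\<in>{1..n}. \<epsilon> k \<omega> / real k) \<in> borel_measurable M" for n
    by (intro borel_measurable_sum borel_measurable_divide measurable_sign) auto
  have "(\<lambda>n. CLINT \<omega>|M. iexp (t * (\<Sum>k\<in>{1..n}. \<epsilon> k \<omega> / real k)))
     \<longlonglongrightarrow> (CLINT \<omega>|M. iexp (t * random_harmonic \<epsilon> \<omega>))"
  proof (rule integral_dominated_convergence[where w = "\<lambda>_. 1"])
    show "AE \<omega> in M. (\<lambda>n. iexp (t * (\<Sum>k\<in>{1..n}. \<epsilon> k \<omega> / real k))) \<longlonglongrightarrow> iexp (t * random_harmonic \<epsilon> \<omega>)"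
      using AE_summable_harmonic
    proof eventually_elim
      case (elim \<omega>)
      then have "(\<lambda>n. \<Sum>k<n. \<epsilon> (Suc k) \<omega> / real (Suc k)) \<longlonglongrightarrow> random_harmonic \<epsilon> \<omega>"
        unfolding random_harmonic_def by (rule summable_LIMSEQ)
      moreover have "(\<Sum>k<n. \<epsilon> (Suc k) \<omega> / real (Suc k)) = (\<Sum>k\<in>{1..n}. \<epsilon> k \<omega> / real k)" for n
        by (rule sum.reindex_bij_witness[of _ "\<lambda>k. k - 1" Suc]) auto
      ultimately show ?case
        by (intro tendsto_exp tendsto_mult tendsto_of_real tendsto_const) simp
    qed
  qed (auto simp del: of_real_mult of_real_sum One_nat_def)
  moreover have "(CLINT \<omega>|M. iexp (t * (\<Sum>k\<in>{1..n}. \<epsilon> k \<omega> / real k)))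
      = (\<Prod>k\<in>{1..n}. complex_of_real (cos (t / real k)))" for n
    unfolding char_harmonic_partial[symmetric] char_def
    by (subst integral_distr) (auto simp del: One_nat_def)
  moreover have "(CLINT \<omega>|M. iexp (t * random_harmonic \<epsilon> \<omega>)) = char (distr M borel (random_harmonic \<epsilon>)) t"
    unfolding char_def by (subst integral_distr) auto
  ultimately show ?thesis by simp
qed

section \<open>Decay of the characteristic function and absence of atoms\<close>

lemma norm_char_harmonic_le:
  "norm (char (distr M borel (random_harmonic \<epsilon>)) (real j)) \<le> cos (1 / 2) ^ j"
proof (rule LIMSEQ_le_const2[OF tendsto_norm[OF char_harmonic]], intro exI allI impI)
  fix n assume n: "2 * j \<le> n"
  have "norm (\<Prod>k\<in>{1..n}. complex_of_real (cos (real j / real k))) = (\<Prod>k\<in>{1..n}. \<bar>cos (real j / real k)\<bar>)"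
    by (simp add: prod_norm[symmetric])
  \<comment> \<open>For \<open>j < k \<le> 2 * j\<close> the argument \<open>j / k\<close> lies
    between 1/2 and 1, so each of these \<open>j\<close> factors is at most
    \<open>cos (1/2)\<close>; all others are bounded by 1.\<close>
  also have "\<dots> = (\<Prod>k\<in>{j<..2*j}. \<bar>cos (real j / real k)\<bar>) * (\<Prod>k\<in>{1..n} - {j<..2*j}. \<bar>cos (real j / real k)\<bar>)"
    using n by (subst prod.subset_diff[of "{j<..2*j}"]) (auto simp: mult.commute)
  also have "\<dots> \<le> (\<Prod>k\<in>{j<..2*j}. cos (1/2)) * 1"
  proof (intro mult_mono prod_mono prod_le_1 conjI)
    fix k assume "k \<in> {j<..2*j}"
    then have k: "j < k" "k \<le> 2 * j" by auto
    then have "1/2 \<le> real j / real k" "real j / real k \<le> 1" by (auto simp: field_simps)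
    moreover have "1 \<le> pi / 2" using pi_gt3 by simp
    ultimately have "0 \<le> cos (real j / real k)" "cos (real j / real k) \<le> cos (1/2)"
      by (intro cos_ge_zero cos_monotone_0_pi_le; linarith)+
    then show "\<bar>cos (real j / real k)\<bar> \<le> cos (1/2)" by simp
  qed (use pi_gt3 in \<open>auto intro!: prod_nonneg zero_le_power cos_ge_zero\<close>)
  finally show "norm (\<Prod>k\<in>{1..n}. complex_of_real (cos (real j / real k))) \<le> cos (1 / 2) ^ j" by simp
qed

end

text \<open>An average of well separated characters \<open>y \<mapsto> exp (i d (y - x))\<close> equals \<open>1\<close> at \<open>x\<close>, while its
  second moment is small because the cross terms are values of the characteristic function.\<close>

lemma (in real_distribution) measure_singleton_eq_0_if_char_tendsto_0:
  assumes lim: "(\<lambda>j. char M (real j)) \<longlonglongrightarrow> 0"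
  shows "measure M {x} = 0"
proof -
  have "measure M {x} \<le> 2 / real (Suc m)" for m
  proof -
    define K where "K = real (Suc m)"
    have K: "K > 0" by (simp add: K_def)
    from lim have "\<forall>\<^sub>F j in sequentially. norm (char M (real j)) < 1 / K"
      using K by (auto dest: tendstoD[of _ _ _ "1 / K"])
    then obtain J where J: "\<And>j. j \<ge> J \<Longrightarrow> norm (char M (real j)) < 1 / K"
      by (auto simp: eventually_sequentially)
    \<comment> \<open>With spacing \<open>Suc J\<close>, any two distinct frequencies differ by an
      integer larger than \<open>J\<close>, where the characteristic function is below
      \<open>1 / K\<close>. Integer spacing is what makes the limit along the integers
      sufficient.\<close>
    define g where "g d y = iexp (real d * real (Suc J) * (y - x))" for d :: nat and y :: real
    define G where "G y = (\<Sum>d<Suc m. g d y) / K" for y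
    have char_J: "norm (CLINT y|M. g a y * cnj (g b y)) \<le> (if a = b then 1 else 1 / K)" for a b
    proof -
      have neg: "norm (char M (- s)) = norm (char M s)" for s
      proof -
        have "char M (- s) = cnj (char M s)"
          unfolding char_def by (simp add: exp_cnj flip: Bochner_Integration.integral_cnj)
        then show ?thesis by simp
      qed
      have ge: "norm (CLINT y|M. g a y * cnj (g b y)) = norm (char M ((real a - real b) * real (Suc J)))"
      proof -
        have "g a y * cnj (g b y) = iexp (- ((real a - real b) * real (Suc J) * x)) * iexp ((real a - real b) * real (Suc J) * y)" for y
          unfolding g_def by (simp add: exp_cnj exp_add[symmetric] algebra_simps)
        then show ?thesis unfolding char_def by (simp add: norm_mult del: of_real_mult of_real_minus of_real_diff)
      qed
      show ?thesis
      proof (cases "a = b")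
        case True
        then show ?thesis using ge cmod_char_le_1 by simp
      next
        case False
        define c where "c = (if a < b then b - a else a - b) * Suc J"
        have "norm (char M ((real a - real b) * real (Suc J))) = norm (char M (real c))"
          using neg[of "real c"] False unfolding c_def by (auto simp: of_nat_diff algebra_simps)
        moreover have "J \<le> c"
        proof -
          have "1 * Suc J \<le> c" unfolding c_def using False by (intro mult_le_mono1) auto
          then show ?thesis by simp
        qed
        ultimately show ?thesis using ge J[of c] False by simp
      qed
    qed
    have [measurable]: "g d \<in> borel_measurable M" for d
      unfolding g_def by measurable
    have [measurable]: "(\<lambda>y. cnj (g d y)) \<in> borel_measurable M" for d
      by (rule borel_measurable_continuous_on[of cnj]) (auto intro!: continuous_intros)
    have ng: "norm (g d y) = 1" for d y unfolding g_def by (simp del: of_real_mult of_real_diff)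
    have int: "integrable M (\<lambda>y. g a y * cnj (g b y))" for a b
      by (rule integrable_const_bound[of _ 1]) (auto simp: norm_mult ng)
    have Geq: "complex_of_real ((norm (G y))\<^sup>2) = (\<Sum>a<Suc m. \<Sum>b<Suc m. g a y * cnj (g b y)) / of_real (K\<^sup>2)" for y
      unfolding complex_norm_square G_def
      by (simp only: complex_cnj_divide cnj_sum times_divide_times_eq sum_product complex_cnj_complex_of_real of_real_mult power2_eq_square)
    have intG: "integrable M (\<lambda>y. complex_of_real ((norm (G y))\<^sup>2))"
      unfolding Geq using int by (intro integrable_divide integrable_sum) auto
    have nG: "(norm (G y))\<^sup>2 \<ge> 0" for y by simp
    have "norm (CLINT y|M. complex_of_real ((norm (G y))\<^sup>2)) =
        norm (\<Sum>a<Suc m. \<Sum>b<Suc m. (CLINT y|M. g a y * cnj (g b y))) / K\<^sup>2"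
      unfolding Geq using int K by (simp add: norm_divide del: sum.lessThan_Suc of_real_power)
    also have "\<dots> \<le> (\<Sum>a<Suc m. \<Sum>b<Suc m. (if a = b then 1 else 1 / K)) / K\<^sup>2"
      by (intro divide_right_mono sum_norm_le char_J) auto
    also have "\<dots> \<le> (\<Sum>a<Suc m. \<Sum>b<Suc m. ((if a = b then 1 else 0) + 1 / K)) / K\<^sup>2"
      using K by (intro divide_right_mono sum_mono) auto
    \<comment> \<open>The diagonal contributes \<open>K\<close>, and the \<open>K\<^sup>2\<close>
      entries \<open>1 / K\<close> contribute another \<open>K\<close>.\<close>
    also have "\<dots> = 2 * K / K\<^sup>2"
      unfolding sum.distrib K_def by (simp add: field_simps del: sum.lessThan_Suc)
    also have "\<dots> = 2 / K" using K by (simp add: power2_eq_square)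
    finally have 1: "(LINT y|M. (norm (G y))\<^sup>2) \<le> 2 / K"
      by (simp only: integral_complex_of_real norm_of_real)
    have "measure M {x} = (LINT y|M. indicator {x} y)" by simp
    also have "\<dots> \<le> (LINT y|M. (norm (G y))\<^sup>2)"
    proof (rule integral_mono)
      show "integrable M (indicat_real {x})"
        by (intro integrable_real_indicator) (auto simp: emeasure_eq_measure)
      show "integrable M (\<lambda>y. (norm (G y))\<^sup>2)"
        using intG by (simp only: complex_of_real_integrable_eq)
      fix y
      show "indicator {x} y \<le> (norm (G y))\<^sup>2"
        by (cases "y = x") (auto simp: G_def g_def K_def norm_divide simp del: of_nat_Suc sum.lessThan_Suc)
    qed
    finally show ?thesis using 1 unfolding K_def by simp
  qed
  moreover have "(\<lambda>m. 2 / real (Suc m)) \<longlonglongrightarrow> 0"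
    using tendsto_mult_right_zero[OF LIMSEQ_inverse_real_of_nat, of 2] by (simp add: divide_inverse)
  ultimately have "measure M {x} \<le> 0" by (intro LIMSEQ_le_const) auto
  then show ?thesis by (simp add: measure_le_0_iff)
qed

lemma (in random_signs) isCont_cdf_harmonic: "isCont (cdf (distr M borel (random_harmonic \<epsilon>))) x"
proof -
  interpret H: real_distribution "distr M borel (random_harmonic \<epsilon>)"
    by (rule real_distribution_harmonic)
  have "cos (1/2 :: real) < cos 0" using pi_gt3 by (intro cos_monotone_0_pi) auto
  moreover have "0 \<le> cos (1/2 :: real)" using pi_gt3 by (intro cos_ge_zero) auto
  ultimately have "(\<lambda>j. cos (1/2 :: real) ^ j) \<longlonglongrightarrow> 0" by (intro LIMSEQ_power_zero) auto
  then have "(\<lambda>j. char (distr M borel (random_harmonic \<epsilon>)) (real j)) \<longlonglongrightarrow> 0"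
    by (rule Lim_null_comparison[OF always_eventually[OF allI[OF norm_char_harmonic_le]]])
  then show ?thesis
    unfolding H.isCont_cdf by (rule H.measure_singleton_eq_0_if_char_tendsto_0)
qed

section \<open>Mean values in the grand canonical ensemble\<close>

text \<open>Index 0 has the value 1/2. The series over all naturals below weight it by
  \<open>real 0\<close> or by \<open>1 / real 0\<close>, both of which are 0, so they effectively
  start at 1.\<close>

definition part_prob :: "real \<Rightarrow> nat \<Rightarrow> real" where
  "part_prob t k = 1 / (exp (t * real k) + 1)"

lemma part_prob_pos: "0 < part_prob t k"
  unfolding part_prob_def by (simp add: add_pos_pos)

lemma part_prob_lt_1: "part_prob t k < 1"
  unfolding part_prob_def by (simp add: add_pos_pos field_simps)

lemma part_prob_le_exp: "part_prob t k \<le> exp (- (t * real k))"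
  unfolding part_prob_def by (simp add: exp_minus field_simps add_pos_pos)

lemma part_prob_eq: "part_prob t k = exp (- (t * real k)) / (1 + exp (- (t * real k)))"
  unfolding part_prob_def by (simp add: exp_minus field_simps add_pos_pos)

lemma alternating_geometric_sum:
  fixes x :: real
  assumes "1 + x \<noteq> 0"
  shows "(\<Sum>j<2*J. (-1) ^ j * x ^ Suc j) = x / (1 + x) * (1 - x ^ (2 * J))"
proof (induction J)
  case (Suc J)
  have "x ^ (2*J) * x - x ^ (2*J) * x * x + x / (1 + x) * (1 - x ^ (2 * J)) = x / (1 + x) * (1 - x ^ (2 * J) * x * x)"
    using assms by (simp add: divide_simps) (simp add: algebra_simps)
  with Suc show ?case by (simp add: algebra_simps)
qed simp

text \<open>With \<open>x = exp (- t k)\<close>, \<open>part_prob t k\<close> is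
  \<open>x / (1 + x)\<close>, an alternating geometric series. Cut after \<open>2 * J\<close> terms,
  its remainder lies between 0 and \<open>x ^ (2 * J + 1)\<close>, so summing over \<open>k\<close>
  leaves an error of at most \<open>G (2 * J + 1)\<close>, which decays geometrically. Even cuts fix
  the sign of the remainder and allow terms to be paired later.\<close>

lemma part_prob_series_via_alternating_sum:
  fixes c :: "nat \<Rightarrow> real"
  assumes t: "t > 0" and c: "\<And>k. c k \<ge> 0" "c 0 = 0"
    and G: "\<And>j. j \<ge> 1 \<Longrightarrow> (\<lambda>k. c k * exp (- (t * real k)) ^ j) sums G j"
  shows "summable (\<lambda>k. c k * part_prob t k)"
    and "(\<lambda>J. \<Sum>j<2*J. (-1) ^ j * G (Suc j)) \<longlonglongrightarrow> (\<Sum>k. c k * part_prob t k)"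
proof -
  define x where "x k = exp (- (t * real k))" for k :: nat
  have x: "0 < x k" "x k \<le> 1" for k using t by (auto simp: x_def)
  have x1: "x k \<le> x 1" if "k \<ge> 1" for k using t that by (simp add: x_def)
  have x1': "x 1 < 1" using t by (simp add: x_def)
  have p: "part_prob t k = x k / (1 + x k)" for k unfolding x_def by (rule part_prob_eq)
  have G': "(\<lambda>k. c k * x k ^ j) sums G j" if "j \<ge> 1" for j using G[OF that] by (simp add: x_def)
  have px: "c k * part_prob t k \<le> c k * x k" for k
    using part_prob_le_exp[of t k] c by (intro mult_left_mono) (auto simp: x_def)
  have sx: "summable (\<lambda>k. c k * x k)" using G'[of 1] by (simp add: sums_iff)
  show summ: "summable (\<lambda>k. c k * part_prob t k)"
    using px c(1) part_prob_pos[of t] by (intro summable_comparison_test'[OF sx, of 0]) (auto simp: abs_mult less_imp_le)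
  have G_le: "G (Suc j) \<le> x 1 ^ j * G 1" for j
  proof (rule sums_le[OF _ G' sums_mult[OF G']])
    fix k
    show "c k * x k ^ Suc j \<le> x 1 ^ j * (c k * x k ^ 1)"
    proof (cases "k = 0")
      case False
      then have "x k ^ j \<le> x 1 ^ j" using x1[of k] x[of k] by (intro power_mono) auto
      then have "c k * x k * x k ^ j \<le> c k * x k * x 1 ^ j" using c x[of k] by (intro mult_left_mono) auto
      then show ?thesis by (simp add: mult_ac)
    qed (simp add: c)
  qed auto
  have G_nonneg: "0 \<le> G (Suc j)" for j
  proof (rule sums_le[OF _ sums_zero G'])
    fix k show "0 \<le> c k * x k ^ Suc j" using c(1)[of k] x(1)[of k] by simp
  qed simp
  have "(\<lambda>j. x 1 ^ j * G 1) \<longlonglongrightarrow> 0"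
    using x1' x[of 1] by (intro tendsto_mult_left_zero LIMSEQ_power_zero) auto
  then have "(\<lambda>J. x 1 ^ (2 * J) * G 1) \<longlonglongrightarrow> 0"
    by (rule LIMSEQ_subseq_LIMSEQ[unfolded comp_def]) (auto simp: strict_mono_def)
  then have lim0: "(\<lambda>J. G (Suc (2 * J))) \<longlonglongrightarrow> 0"
    by (rule Lim_null_comparison[rotated]) (use G_le G_nonneg in auto)
  have eq: "(\<lambda>k. c k * part_prob t k * (1 - x k ^ (2 * J))) sums (\<Sum>j<2*J. (-1) ^ j * G (Suc j))" for J
  proof -
    have "(\<lambda>k. \<Sum>j<2*J. (-1) ^ j * (c k * x k ^ Suc j)) sums (\<Sum>j<2*J. (-1) ^ j * G (Suc j))"
      by (intro sums_sum sums_mult G') auto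
    moreover have "(\<Sum>j<2*J. (-1) ^ j * (c k * x k ^ Suc j)) = c k * part_prob t k * (1 - x k ^ (2 * J))" for k
    proof -
      have "(\<Sum>j<2*J. (-1) ^ j * (c k * x k ^ Suc j)) = c k * (\<Sum>j<2*J. (-1) ^ j * x k ^ Suc j)"
        unfolding sum_distrib_left by (simp only: mult_ac)
      then show ?thesis
        using alternating_geometric_sum[of "x k" J] x(1)[of k] by (simp add: p)
    qed
    ultimately show ?thesis by simp
  qed
  have "\<bar>(\<Sum>j<2*J. (-1) ^ j * G (Suc j)) - (\<Sum>k. c k * part_prob t k)\<bar> \<le> G (Suc (2 * J))" for J
  proof -
    have s: "(\<lambda>k. c k * part_prob t k - c k * part_prob t k * (1 - x k ^ (2 * J))) sums
        ((\<Sum>k. c k * part_prob t k) - (\<Sum>j<2*J. (-1) ^ j * G (Suc j)))"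
      by (intro sums_diff summable_sums summ eq)
    have "(\<Sum>k. c k * part_prob t k) - (\<Sum>j<2*J. (-1) ^ j * G (Suc j)) \<le> G (Suc (2 * J))"
    proof (rule sums_le[OF _ s G'])
      fix k
      have "c k * part_prob t k * x k ^ (2 * J) \<le> c k * x k * x k ^ (2 * J)"
        using px x[of k] by (intro mult_right_mono) auto
      then show "c k * part_prob t k - c k * part_prob t k * (1 - x k ^ (2 * J)) \<le> c k * x k ^ Suc (2 * J)"
        by (simp add: algebra_simps)
    qed auto
    moreover have "0 \<le> (\<Sum>k. c k * part_prob t k) - (\<Sum>j<2*J. (-1) ^ j * G (Suc j))"
    proof (rule sums_le[OF _ sums_zero s])
      fix k
      have "c k * part_prob t k * (1 - x k ^ (2 * J)) \<le> c k * part_prob t k * 1"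
        using c part_prob_pos[of t k] x[of k] by (intro mult_left_mono) (auto intro!: mult_nonneg_nonneg)
      then show "0 \<le> c k * part_prob t k - c k * part_prob t k * (1 - x k ^ (2 * J))" by simp
    qed
    ultimately show ?thesis by simp
  qed
  then have "(\<lambda>J. (\<Sum>j<2*J. (-1) ^ j * G (Suc j)) - (\<Sum>k. c k * part_prob t k)) \<longlonglongrightarrow> 0"
    by (intro Lim_null_comparison[OF _ lim0]) auto
  then show "(\<lambda>J. \<Sum>j<2*J. (-1) ^ j * G (Suc j)) \<longlonglongrightarrow> (\<Sum>k. c k * part_prob t k)"
    by (rule LIM_zero_cancel)
qed

section \<open>The mean size up to O(1/t)\<close>

lemma alternating_sum_bounds:
  fixes b :: "nat \<Rightarrow> real"
  assumes "\<And>i j. i \<le> j \<Longrightarrow> b j \<le> b i" and "\<And>i. 0 \<le> b i"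
  shows "0 \<le> (\<Sum>j<2*J. (-1) ^ j * b j)" and "(\<Sum>j<2*J. (-1) ^ j * b j) \<le> b 0"
proof -
  show "0 \<le> (\<Sum>j<2*J. (-1) ^ j * b j)"
  proof (induction J)
    case (Suc J)
    then show ?case using assms(1)[of "2*J" "Suc (2*J)"] by simp
  qed simp
  have "(\<Sum>j<2*J. (-1) ^ j * b j) \<le> b 0 - b (2 * J)"
  proof (induction J)
    case (Suc J)
    then show ?case using assms(1)[of "Suc (2*J)" "Suc (Suc (2*J))"] by simp
  qed simp
  then show "(\<Sum>j<2*J. (-1) ^ j * b j) \<le> b 0" using assms(2)[of "2*J"] by linarith
qed

text \<open>Terms with even denominator enter with the wrong sign, so they are subtracted twice;
  they form a quarter of \<open>Q J\<close>, which gives \<open>Q (2 * J) - Q J / 2\<close>.\<close>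

lemma alternating_inverse_squares:
  "(\<lambda>J. \<Sum>j<2*J. (-1) ^ j * (1 / real (Suc j) ^ 2)) \<longlonglongrightarrow> pi\<^sup>2 / 12"
proof -
  define Q where "Q n = (\<Sum>j<n. 1 / real (Suc j) ^ 2)" for n
  have Q: "Q \<longlonglongrightarrow> pi\<^sup>2 / 6"
    using inverse_squares_sums unfolding sums_def Q_def by (simp add: add.commute)
  then have "(\<lambda>J. Q (2 * J)) \<longlonglongrightarrow> pi\<^sup>2 / 6"
    by (rule LIMSEQ_subseq_LIMSEQ[unfolded comp_def]) (auto simp: strict_mono_def)
  then have "(\<lambda>J. Q (2 * J) - Q J / 2) \<longlonglongrightarrow> pi\<^sup>2 / 6 - pi\<^sup>2 / 6 / 2"
    by (intro tendsto_intros Q) auto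
  moreover have "(\<Sum>j<2*J. (-1) ^ j * (1 / real (Suc j) ^ 2)) = Q (2 * J) - Q J / 2" for J
  proof (induction J)
    case (Suc J)
    have "1 / (2 + 2 * real J) ^ 2 = 1 / (1 + real J) ^ 2 / 4"
      by (simp add: power2_eq_square field_simps)
    with Suc show ?case unfolding Q_def by (simp add: add_divide_distrib)
  qed (simp add: Q_def)
  ultimately show ?thesis by simp
qed

text \<open>Termwise comparison of power series, using \<open>4 sinh\<^sup>3 z = sinh (3 z) - 3 sinh z\<close>.\<close>

lemma cube_mult_cosh_le_sinh_cube:
  fixes z :: real
  assumes "z \<ge> 0"
  shows "z ^ 3 * cosh z \<le> sinh z ^ 3"
proof -
  have triple: "sinh (3 * z) = 3 * sinh z + 4 * sinh z ^ 3"
  proof -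
    have "sinh (3 * z) = sinh (z + 2 * z)" by simp
    also have "\<dots> = 3 * sinh z + 4 * sinh z ^ 3"
      unfolding sinh_add sinh_double cosh_double using cosh_square_eq[of z] by algebra
    finally show ?thesis .
  qed
  have s1: "(\<lambda>n. (if even n then 0 else (3 * z) ^ n /\<^sub>R fact n) - 3 * (if even n then 0 else z ^ n /\<^sub>R fact n)) sums (sinh (3 * z) - 3 * sinh z)"
    by (intro sums_diff sums_mult sinh_converges)
  have "(\<lambda>n. 4 * (z ^ 3 * (if even n then z ^ n /\<^sub>R fact n else 0))) sums (4 * (z ^ 3 * cosh z))"
    by (intro sums_mult cosh_converges)
  then have s2: "(\<lambda>n. if n < 3 then 0 else 4 * (z ^ 3 * (if even (n - 3) then z ^ (n - 3) /\<^sub>R fact (n - 3) else 0))) sums (4 * (z ^ 3 * cosh z))"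
    by (subst sums_zero_iff_shift[symmetric, of 3]) (auto cong: if_cong)
  have "4 * (z ^ 3 * cosh z) \<le> sinh (3 * z) - 3 * sinh z"
  proof (rule sums_le[OF _ s2 s1])
    fix n :: nat
    show "(if n < 3 then 0 else 4 * (z ^ 3 * (if even (n - 3) then z ^ (n - 3) /\<^sub>R fact (n - 3) else 0)))
      \<le> (if even n then 0 else (3 * z) ^ n /\<^sub>R fact n) - 3 * (if even n then 0 else z ^ n /\<^sub>R fact n)"
    proof (cases "n < 3")
      case True
      then have "n = 0 \<or> n = 1 \<or> n = 2" by auto
      then show ?thesis by auto
    next
      case False
      then obtain m where m: "n = m + 3" by (metis le_add_diff_inverse2 not_less)
      show ?thesis
      proof (cases "even m")
        case True
        then obtain i where i: "m = 2 * i" by auto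
        \<comment> \<open>The inequality between the coefficients of \<open>z ^ n\<close> for
          \<open>n = 2 * i + 3\<close>, multiplied by \<open>fact n\<close>; here
          \<open>3 ^ n = 27 * 9 ^ i\<close>. From \<open>i\<close> to \<open>i + 1\<close> the right
          side becomes nine times itself plus 24, and the cubic on the left grows by no
          more.\<close>
        have key: "4 * ((2 * real i + 3) * (2 * real i + 2) * (2 * real i + 1)) \<le> 27 * 9 ^ i - 3"
        proof (induction i)
          case (Suc i)
          have *: "4 * ((2 * real (Suc i) + 3) * (2 * real (Suc i) + 2) * (2 * real (Suc i) + 1))
              \<le> 9 * (4 * ((2 * real i + 3) * (2 * real i + 2) * (2 * real i + 1))) + 24"
          proof -
            have "9 * (4 * ((2 * real i + 3) * (2 * real i + 2) * (2 * real i + 1))) + 24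
              - 4 * ((2 * real (Suc i) + 3) * (2 * real (Suc i) + 2) * (2 * real (Suc i) + 1))
              = 256 * real i ^ 3 + 672 * real i ^ 2 + 416 * real i"
              by (simp add: algebra_simps power2_eq_square power3_eq_cube)
            moreover have "0 \<le> 256 * real i ^ 3 + 672 * real i ^ 2 + 416 * real i" by simp
            ultimately show ?thesis by linarith
          qed
          have "27 * 9 ^ Suc i - (3::real) = 9 * (27 * 9 ^ i - 3) + 24" by simp
          moreover have "9 * (4 * ((2 * real i + 3) * (2 * real i + 2) * (2 * real i + 1))) \<le> 9 * (27 * 9 ^ i - 3)"
            using Suc by (intro mult_left_mono) auto
          ultimately show ?case using * by (simp only:)
        qed simp
        have n9: "(3::real) ^ (2 * i) = 9 ^ i" by (simp add: power_mult)
        have f: "(fact n :: real) = (2 * real i + 3) * (2 * real i + 2) * (2 * real i + 1) * fact m"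
          unfolding m i by (simp add: numeral_3_eq_3 algebra_simps)
        have "4 * (z ^ 3 * (z ^ m / fact m)) = z ^ n * (4 * ((2 * real i + 3) * (2 * real i + 2) * (2 * real i + 1))) / fact n"
        proof -
          have "4 * (z ^ 3 * (z ^ m / F)) = z ^ (m + 3) * (4 * P) / (P * F)" if "P \<noteq> 0" for P F :: real
            using that by (simp add: power_add)
          moreover have "(2 * real i + 3) * (2 * real i + 2) * (2 * real i + 1) \<noteq> 0" by (simp add: add_nonneg_eq_0_iff)
          ultimately show ?thesis unfolding f unfolding m by blast
        qed
        also have "\<dots> \<le> z ^ n * (27 * 9 ^ i - 3) / fact n"
          using key assms by (intro divide_right_mono mult_left_mono) auto
        also have "\<dots> = (3 * z) ^ n / fact n - 3 * (z ^ n / fact n)"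
          using n9 unfolding m i by (simp add: power_add power_mult_distrib field_simps)
        finally show ?thesis using m True by (simp add: divide_inverse_commute)
      qed (simp add: m)
    qed
  qed
  then show ?thesis using triple by simp
qed

text \<open>The derivative is \<open>2 * cosh z / sinh z ^ 3 - 2 / z ^ 3\<close>, whose sign is
  exactly \<open>cube_mult_cosh_le_sinh_cube\<close>. Monotonicity makes the corrections in
  \<open>sum_part_prob_bounds\<close> an alternating sum with decreasing terms.\<close>

lemma inverse_square_minus_csch_square_antimono:
  fixes x y :: real
  assumes "0 < x" "x \<le> y"
  shows "1 / y\<^sup>2 - 1 / (sinh y)\<^sup>2 \<le> 1 / x\<^sup>2 - 1 / (sinh x)\<^sup>2"
proof (rule DERIV_nonpos_imp_nonincreasing[OF assms(2)])
  fix z assume z: "x \<le> z" "z \<le> y"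
  then have z0: "z > 0" using assms by simp
  then have s0: "sinh z > 0" by simp
  have "((\<lambda>z. 1 / z\<^sup>2 - 1 / (sinh z)\<^sup>2) has_real_derivative (- 2 / z ^ 3 + 2 * cosh z / sinh z ^ 3)) (at z)"
    using z0 s0 by (auto intro!: derivative_eq_intros simp: power2_eq_square power3_eq_cube field_simps)
  moreover have "- 2 / z ^ 3 + 2 * cosh z / sinh z ^ 3 \<le> 0"
  proof -
    have "cosh z / sinh z ^ 3 \<le> 1 / z ^ 3"
      using cube_mult_cosh_le_sinh_cube[of z] z0 s0 by (simp add: field_simps)
    then show ?thesis by simp
  qed
  ultimately show "\<exists>D. ((\<lambda>z. 1 / z\<^sup>2 - 1 / (sinh z)\<^sup>2) has_real_derivative D) (at z) \<and> D \<le> 0" by blast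
qed

lemma le_sinh: "x \<ge> 0 \<Longrightarrow> x \<le> sinh (x::real)"
proof -
  assume "x \<ge> 0"
  then have "sinh 0 - 0 \<le> sinh x - x"
    by (rule DERIV_nonneg_imp_nondecreasing)
       (auto intro!: exI derivative_eq_intros cosh_real_ge_1)
  then show ?thesis by simp
qed

lemma sinh_le_mult_exp: "x \<ge> 0 \<Longrightarrow> sinh x \<le> x * exp (x::real)"
proof -
  assume "x \<ge> 0"
  have "1 - exp (- (2 * x)) \<le> 2 * x" using exp_ge_add_one_self[of "- (2 * x)"] by linarith
  then have "exp x * (1 - exp (- (2 * x))) \<le> exp x * (2 * x)" by (intro mult_left_mono) auto
  moreover have "exp x * exp (- (2 * x)) = exp (- x)" by (simp add: exp_add[symmetric])
  ultimately show ?thesis unfolding sinh_field_def by (simp add: algebra_simps)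
qed

text \<open>Summation over \<open>k\<close> gives \<open>G j = x / (1 - x)\<^sup>2\<close> with
  \<open>x = exp (- t j)\<close>, that is \<open>1 / (4 sinh\<^sup>2 (t j / 2))\<close>. Replacing
  this by \<open>1 / (t j)\<^sup>2\<close> yields the main term. The corrections \<open>b\<close>
  decrease and are nonnegative, so their alternating sum lies between 0 and
  \<open>b 0 \<le> 1 / t\<close>.\<close>

lemma sum_part_prob_bounds:
  assumes t: "t > 0"
  shows "summable (\<lambda>k. real k * part_prob t k)"
    and "(\<Sum>k. real k * part_prob t k) \<le> pi\<^sup>2 / (12 * t\<^sup>2)"
    and "pi\<^sup>2 / (12 * t\<^sup>2) - 1 / t \<le> (\<Sum>k. real k * part_prob t k)"
proof -
  define G where "G j = 1 / (4 * (sinh (t * real j / 2))\<^sup>2)" for j :: nat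
  define h where "h z = 1 / z\<^sup>2 - 1 / (sinh z)\<^sup>2" for z :: real
  define b where "b j = h (t * real (Suc j) / 2) / 4" for j :: nat
  have G: "(\<lambda>k. real k * exp (- (t * real k)) ^ j) sums G j" if "j \<ge> 1" for j
  proof -
    define x where "x = exp (- (t * real j))"
    have "t * real j > 0" using t that by simp
    then have x: "0 < x" "x < 1" by (auto simp: x_def)
    have "(\<lambda>n. x * (real (Suc n) * x ^ n)) sums (x * (1 / (1 - x) ^ 2))"
      using geometric_deriv_sums[of x] x by (intro sums_mult) simp
    then have "(\<lambda>n. real (Suc n) * x ^ Suc n) sums (x / (1 - x) ^ 2)" by (simp add: mult_ac)
    then have "(\<lambda>n. real n * x ^ n) sums (x / (1 - x) ^ 2)"
      using sums_Suc_iff[of "\<lambda>n. real n * x ^ n" "x / (1 - x) ^ 2"] by simp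
    moreover have "exp (- (t * real k)) ^ j = x ^ k" for k
      unfolding x_def by (simp add: exp_of_nat_mult[symmetric] mult_ac)
    moreover have "x / (1 - x) ^ 2 = G j"
    proof -
      define y where "y = exp (- (t * real j / 2))"
      have y: "x = y * y" "y > 0" "exp (t * real j / 2) = 1 / y"
        unfolding x_def y_def by (auto simp: exp_add[symmetric] exp_minus field_simps)
      have "4 * (sinh (t * real j / 2))\<^sup>2 = (2 * sinh (t * real j / 2))\<^sup>2"
        by (simp add: power_mult_distrib)
      also have "2 * sinh (t * real j / 2) = 1 / y - y"
        unfolding sinh_field_def y_def[symmetric] y(3) by simp
      also have "(1 / y - y)\<^sup>2 = (1 - x)\<^sup>2 / x" using y(2) unfolding y(1) by (simp add: field_simps power2_eq_square)
      finally show ?thesis unfolding G_def by simp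
    qed
    ultimately show ?thesis by simp
  qed
  note S = part_prob_series_via_alternating_sum[OF t, of real G, OF _ _ G]
  show "summable (\<lambda>k. real k * part_prob t k)" by (rule S(1)) auto
  have lim: "(\<lambda>J. \<Sum>j<2*J. (-1) ^ j * G (Suc j)) \<longlonglongrightarrow> (\<Sum>k. real k * part_prob t k)"
    by (rule S(2)) auto
  have h_nonneg: "0 \<le> h z" if "z > 0" for z
  proof -
    have "z\<^sup>2 \<le> (sinh z)\<^sup>2" using le_sinh[of z] that by (intro power_mono) auto
    then show ?thesis unfolding h_def using that by (simp add: frac_le)
  qed
  \<comment> \<open>Squaring \<open>exp (- z) * sinh z \<le> z\<close> and using
    \<open>1 - 2 * z \<le> exp (- (2 * z))\<close> bounds \<open>1 / sinh\<^sup>2\<close> from below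
    by \<open>1 / z\<^sup>2 - 2 / z\<close>.\<close>
  have h_le: "h z \<le> 2 / z" if z: "z > 0" for z
  proof -
    have s0: "sinh z > 0" using that by simp
    have "exp (- z) * sinh z \<le> exp (- z) * (z * exp z)"
      using sinh_le_mult_exp[of z] z by (intro mult_left_mono) auto
    also have "\<dots> = z" by (simp add: exp_minus)
    finally have "(exp (- z) * sinh z)\<^sup>2 \<le> z\<^sup>2" using s0 by (intro power_mono) auto
    moreover have "(exp (- z))\<^sup>2 = exp (- (2 * z))" by (simp add: power2_eq_square exp_add[symmetric])
    moreover have "1 - 2 * z \<le> exp (- (2 * z))" using exp_ge_add_one_self[of "- (2 * z)"] by linarith
    ultimately have "(1 - 2 * z) * (sinh z)\<^sup>2 \<le> z\<^sup>2"
      using mult_right_mono[of "1 - 2 * z" "exp (- (2 * z))" "(sinh z)\<^sup>2"] by (simp add: power_mult_distrib)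
    then have "(1 - 2 * z) / z\<^sup>2 \<le> 1 / (sinh z)\<^sup>2" using z s0 by (simp add: divide_simps)
    then show ?thesis unfolding h_def using z by (simp add: diff_divide_distrib power2_eq_square)
  qed
  have b1: "b j \<le> b i" if "i \<le> j" for i j
    unfolding b_def h_def using that t
    by (intro divide_right_mono inverse_square_minus_csch_square_antimono) auto
  have b2: "0 \<le> b i" for i unfolding b_def using t by (intro divide_nonneg_nonneg h_nonneg) auto
  have b3: "b 0 \<le> 1 / t" using h_le[of "t / 2"] t unfolding b_def by simp
  have Gb: "G (Suc j) = (1 / real (Suc j) ^ 2) / t\<^sup>2 - b j" for j
  proof -
    have "1 / (t * real (Suc j) / 2)\<^sup>2 = 4 * (1 / real (Suc j) ^ 2 / t\<^sup>2)"
      by (simp add: power_divide power_mult_distrib)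
    then show ?thesis unfolding G_def b_def h_def by (simp add: diff_divide_distrib)
  qed
  have eq: "(\<Sum>j<2*J. (-1) ^ j * G (Suc j)) = (\<Sum>j<2*J. (-1) ^ j * (1 / real (Suc j) ^ 2)) / t\<^sup>2 - (\<Sum>j<2*J. (-1) ^ j * b j)" for J
    unfolding Gb by (simp only: sum_divide_distrib right_diff_distrib sum_subtractf times_divide_eq_right)
  have lim2: "(\<lambda>J. (\<Sum>j<2*J. (-1) ^ j * (1 / real (Suc j) ^ 2)) / t\<^sup>2) \<longlonglongrightarrow> pi\<^sup>2 / 12 / t\<^sup>2"
    using t by (intro tendsto_divide alternating_inverse_squares) auto
  show "(\<Sum>k. real k * part_prob t k) \<le> pi\<^sup>2 / (12 * t\<^sup>2)"
  proof -
    have "(\<Sum>k. real k * part_prob t k) \<le> pi\<^sup>2 / 12 / t\<^sup>2"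
    proof (rule LIMSEQ_le[OF lim lim2], intro exI allI impI)
      fix J
      show "(\<Sum>j<2*J. (-1) ^ j * G (Suc j)) \<le> (\<Sum>j<2*J. (-1) ^ j * (1 / real (Suc j) ^ 2)) / t\<^sup>2"
        using alternating_sum_bounds(1)[of b J, OF b1 b2] unfolding eq by linarith
    qed
    then show ?thesis by simp
  qed
  have "pi\<^sup>2 / 12 / t\<^sup>2 - 1 / t \<le> (\<Sum>k. real k * part_prob t k)"
  proof (rule LIMSEQ_le[OF tendsto_diff[OF lim2 tendsto_const] lim], intro exI allI impI)
    fix J
    show "(\<Sum>j<2*J. (-1) ^ j * (1 / real (Suc j) ^ 2)) / t\<^sup>2 - 1 / t \<le> (\<Sum>j<2*J. (-1) ^ j * G (Suc j))"
      using alternating_sum_bounds(2)[of b J, OF b1 b2] b3 unfolding eq by linarith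
  qed
  then show "pi\<^sup>2 / (12 * t\<^sup>2) - 1 / t \<le> (\<Sum>k. real k * part_prob t k)" by simp
qed


section \<open>The mean of the reciprocal sum and Wallis' product\<close>

lemma mult_sinh_le_sinh_mult:
  fixes d :: real
  assumes "d \<ge> 0"
  shows "real m * sinh d \<le> sinh (real m * d)"
proof (induction m)
  case (Suc m)
  have "sinh (real m * d) * 1 \<le> sinh (real m * d) * cosh d"
    using assms by (intro mult_left_mono cosh_real_ge_1) auto
  moreover have "1 * sinh d \<le> cosh (real m * d) * sinh d"
    using assms by (intro mult_right_mono cosh_real_ge_1) auto
  moreover have "sinh (real (Suc m) * d) = sinh (real m * d) * cosh d + cosh (real m * d) * sinh d"
    by (simp add: distrib_right add.commute sinh_add)
  ultimately show ?case using Suc by (simp add: distrib_right)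
qed simp

lemma sinh_over_self_tendsto_1: "((\<lambda>x::real. sinh x / x) \<longlongrightarrow> 1) (at 0)"
proof -
  have "(sinh has_real_derivative 1) (at 0)" by (auto intro!: derivative_eq_intros)
  then show ?thesis unfolding has_field_derivative_iff by simp
qed

lemma sinh_ratio_tendsto:
  assumes "m > 0"
  shows "((\<lambda>x. sinh x / sinh (m * x)) \<longlongrightarrow> 1 / m) (at_right (0::real))"
proof -
  have f0: "((\<lambda>x. sinh x / x) \<longlongrightarrow> 1) (at_right (0::real))"
    using sinh_over_self_tendsto_1 by (rule tendsto_mono[OF at_le, rotated]) auto
  have "filterlim (\<lambda>x. m * x) (at_right 0) (at_right (0::real))"
    unfolding filterlim_at using assms
    by (auto intro!: tendsto_eq_intros eventually_at_right_less[THEN eventually_mono] simp: eventually_at_filter)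
  then have "((\<lambda>x. sinh (m * x) / (m * x)) \<longlongrightarrow> 1) (at_right (0::real))"
    by (rule filterlim_compose[OF f0])
  then have "((\<lambda>x. (sinh x / x) / (sinh (m * x) / (m * x)) / m) \<longlongrightarrow> 1 / 1 / m) (at_right 0)"
    using assms by (intro tendsto_intros f0) auto
  moreover have "\<forall>\<^sub>F x in at_right 0. (sinh x / x) / (sinh (m * x) / (m * x)) / m = sinh x / sinh (m * x)"
    using eventually_at_right_less[of "0::real"] assms
    by (auto elim!: eventually_mono simp: field_simps)
  ultimately have "((\<lambda>x. sinh x / sinh (m * x)) \<longlongrightarrow> 1 / 1 / m) (at_right 0)"
    by (rule Lim_transform_eventually)
  then show ?thesis by simp
qed

text \<open>The factors \<open>4 k\<^sup>2 / (4 k\<^sup>2 - 1)\<close> of Wallis' product equal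
  \<open>1 / (1 - (1 / (2 k))\<^sup>2)\<close>, with \<open>k = i + 1\<close>.\<close>

lemma sums_ln_wallis: "(\<lambda>i. - ln (1 - (1 / real (2 * i + 2))\<^sup>2)) sums ln (pi / 2)"
proof -
  have "(\<Sum>i<n. - ln (1 - (1 / real (2 * i + 2))\<^sup>2)) = ln (\<Prod>k=1..n. (4*real k^2) / (4*real k^2 - 1))" for n
  proof -
    have pos: "(4*real k^2) / (4*real k^2 - 1) > 0" if "k \<ge> 1" for k
    proof -
      have "1 \<le> real k ^ 2" using that by simp
      then have "0 < 4 * real k ^ 2" "0 < 4 * real k ^ 2 - 1" by linarith+
      then show ?thesis by (rule divide_pos_pos)
    qed
    have "ln (\<Prod>k=1..n. (4*real k^2) / (4*real k^2 - 1)) = (\<Sum>k=1..n. ln ((4*real k^2) / (4*real k^2 - 1)))"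
      using pos by (intro ln_prod) fastforce+
    also have "\<dots> = (\<Sum>i<n. ln ((4*real (Suc i)^2) / (4*real (Suc i)^2 - 1)))"
      by (rule sum.reindex_bij_witness[of _ Suc "\<lambda>k. k - 1"]) auto
    also have "\<dots> = (\<Sum>i<n. - ln (1 - (1 / real (2 * i + 2))\<^sup>2))"
    proof (rule sum.cong)
      fix i
      have r: "real (2 * i + 2) = 2 * real (Suc i)" by simp
      have "1 - (1 / real (2 * i + 2))\<^sup>2 = inverse ((4*real (Suc i)^2) / (4*real (Suc i)^2 - 1))"
        unfolding r by (simp add: power_mult_distrib power_divide field_simps del: of_nat_Suc)
      then show "ln ((4*real (Suc i)^2) / (4*real (Suc i)^2 - 1)) = - ln (1 - (1 / real (2 * i + 2))\<^sup>2)"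
        using pos[of "Suc i"] by (simp only: ln_inverse)
    qed simp
    finally show ?thesis by simp
  qed
  moreover have "(\<lambda>n. ln (\<Prod>k=1..n. (4*real k^2) / (4*real k^2 - 1))) \<longlonglongrightarrow> ln (pi / 2)"
    by (intro tendsto_ln wallis) auto
  ultimately show ?thesis unfolding sums_def by simp
qed

lemma summable_recip_part_prob:
  assumes "t > 0"
  shows "summable (\<lambda>k. 1 / real k * part_prob t k)"
proof (rule summable_comparison_test'[OF sum_part_prob_bounds(1)[OF assms], of 0])
  fix k :: nat
  have "1 / real k \<le> real k" by (cases "k = 0") (auto simp: field_simps intro: order_trans[of _ "real k"])
  then have "1 / real k * part_prob t k \<le> real k * part_prob t k"
    using part_prob_pos[of t k] by (intro mult_right_mono) auto
  then show "norm (1 / real k * part_prob t k) \<le> real k * part_prob t k"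
    using part_prob_pos[of t k] by simp
qed

text \<open>Summing the expansion of \<^const>\<open>part_prob\<close> over \<open>k\<close> first turns the series into an alternating
  sum of \<open>ln (1 - exp (- t j))\<close>; its second differences converge to the factors of Wallis' product.\<close>

lemma recip_part_prob_series:
  assumes t: "t > 0"
  defines "r \<equiv> \<lambda>i. sinh (t / 2) / sinh (real (2 * i + 2) * (t / 2))"
  shows "(\<lambda>i. - ln (1 - (r i)\<^sup>2)) sums (2 * (\<Sum>k. 1 / real k * part_prob t k) + ln (1 - exp (- t)))"
proof -
  define a where "a j = ln (1 - exp (- (t * real j)))" for j :: nat
  have G: "(\<lambda>k. 1 / real k * exp (- (t * real k)) ^ j) sums (- a j)" if "j \<ge> 1" for j
  proof -
    define x where "x = exp (- (t * real j))"
    have "t * real j > 0" using t that by simp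
    then have x: "0 < x" "x < 1" by (auto simp: x_def)
    have "(\<lambda>n. - ((- (- x)) ^ n) / of_nat n) sums ln (1 + (- x))"
      using x by (intro ln_series') auto
    then have "(\<lambda>n. - (- (x ^ n) / real n)) sums (- ln (1 - x))" by (intro sums_minus) simp
    moreover have "exp (- (t * real k)) ^ j = x ^ k" for k
      unfolding x_def by (simp add: exp_of_nat_mult[symmetric] mult_ac)
    ultimately show ?thesis unfolding a_def x_def[symmetric] by simp
  qed
  have lim: "(\<lambda>J. \<Sum>j<2*J. (-1) ^ j * (- a (Suc j))) \<longlonglongrightarrow> (\<Sum>k. 1 / real k * part_prob t k)"
    by (rule part_prob_series_via_alternating_sum(2)[OF t _ _ G]) auto
  define D where "D i = 2 * a (Suc (Suc (2 * i))) - a (Suc (2 * i)) - a (Suc (Suc (Suc (2 * i))))" for i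
  \<comment> \<open>Writing \<open>1 - exp (- 2 u)\<close> as \<open>2 exp (- u) sinh u\<close>, the
    prefactors cancel in a second difference. What remains is governed by \<open>sinh (z - d) * sinh
    (z + d) = sinh\<^sup>2 z - sinh\<^sup>2 d\<close>.\<close>
  have D: "D i = - ln (1 - (r i)\<^sup>2)" for i
  proof -
    define m where "m = 2 * i + 2"
    define d where "d = t / 2"
    define z where "z = real m * d"
    have d: "0 < d" "d < z" using t by (auto simp: d_def z_def m_def)
    have e: "1 - exp (- (2 * u)) = 2 * exp (- u) * sinh u" for u :: real
      by (simp add: sinh_field_def algebra_simps exp_add[symmetric])
    have a_eq: "a (2 * i + 2) = ln (2 * exp (- z) * sinh z)"
      "a (2 * i + 1) = ln (2 * exp (- (z - d)) * sinh (z - d))"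
      "a (2 * i + 3) = ln (2 * exp (- (z + d)) * sinh (z + d))"
      unfolding a_def e[symmetric] by (simp_all add: z_def m_def d_def algebra_simps)
    have pos: "sinh z > 0" "sinh (z - d) > 0" "sinh (z + d) > 0" using d by auto
    have "D i = 2 * a (2 * i + 2) - a (2 * i + 1) - a (2 * i + 3)"
      by (simp add: D_def numeral_3_eq_3)
    also have "\<dots> = 2 * ln (sinh z) - ln (sinh (z - d)) - ln (sinh (z + d))"
      unfolding a_eq using pos by (simp add: ln_mult)
    also have "\<dots> = - ln (sinh (z - d) * sinh (z + d) / (sinh z)\<^sup>2)"
      using pos by (simp add: ln_mult ln_div ln_realpow)
    also have "sinh (z - d) * sinh (z + d) = (sinh z)\<^sup>2 - (sinh d)\<^sup>2"
      unfolding sinh_add sinh_diff using cosh_square_eq[of z] cosh_square_eq[of d] by algebra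
    also have "((sinh z)\<^sup>2 - (sinh d)\<^sup>2) / (sinh z)\<^sup>2 = 1 - (r i)\<^sup>2"
      using pos unfolding r_def m_def[symmetric] d_def[symmetric] z_def[symmetric]
      by (simp add: power_divide diff_divide_distrib)
    finally show ?thesis .
  qed
  \<comment> \<open>Each odd-indexed term is split evenly between the two neighbouring second
    differences. The ends \<open>a 1\<close> and \<open>a (2 * J + 1)\<close> are left over;
    \<open>a 1 = ln (1 - exp (- t))\<close> carries the logarithmic divergence as \<open>t\<close>
    tends to 0.\<close>
  have eq: "2 * (\<Sum>j<2*J. (-1) ^ j * (- a (Suc j))) = - a 1 + (\<Sum>i<J. D i) + a (Suc (2 * J))" for J
    by (induction J) (auto simp: D_def)
  have a0: "(\<lambda>J. a (Suc (2 * J))) \<longlonglongrightarrow> 0"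
  proof -
    have "(\<lambda>j. exp (- t) ^ j) \<longlonglongrightarrow> 0" using t by (intro LIMSEQ_power_zero) auto
    then have "(\<lambda>j. ln (1 - exp (- t) ^ j)) \<longlonglongrightarrow> ln (1 - 0)"
      using t by (intro tendsto_intros) auto
    then have "a \<longlonglongrightarrow> 0" unfolding a_def by (simp add: exp_of_nat_mult[symmetric] mult_ac)
    then show ?thesis
      by (rule LIMSEQ_subseq_LIMSEQ[unfolded comp_def]) (auto simp: strict_mono_def)
  qed
  have "(\<lambda>J. 2 * (\<Sum>j<2*J. (-1) ^ j * (- a (Suc j))) + a 1 - a (Suc (2 * J)))
     \<longlonglongrightarrow> 2 * (\<Sum>k. 1 / real k * part_prob t k) + a 1 - 0"
    by (intro tendsto_intros lim a0)
  then show ?thesis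
    unfolding sums_def eq D by (simp add: a_def)
qed

text \<open>In \<open>recip_part_prob_series\<close> each term tends to the logarithm of a Wallis
  factor, and \<open>ln (1 - exp (- t))\<close> differs from \<open>ln t\<close> by o(1).\<close>

lemma recip_part_prob_asymp:
  "((\<lambda>t. 2 * (\<Sum>k. 1 / real k * part_prob t k) + ln t) \<longlongrightarrow> ln (pi / 2)) (at_right 0)"
proof -
  define r where "r i t = sinh (t / 2) / sinh (real (2 * i + 2) * (t / 2))" for i :: nat and t :: real
  define L where "L i = - ln (1 - (1 / real (2 * i + 2))\<^sup>2)" for i :: nat
  have half: "filterlim (\<lambda>t. t / 2) (at_right 0) (at_right (0::real))"
    unfolding filterlim_at
    by (auto intro!: tendsto_eq_intros eventually_at_right_less[THEN eventually_mono] simp: eventually_at_filter)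
  have less1: "(1 / real (2 * i + 2))\<^sup>2 < 1" for i
    by (rule power_less_one_iff[THEN iffD2]) auto
  have lim: "((\<lambda>t. - ln (1 - (r i t)\<^sup>2)) \<longlongrightarrow> L i) (at_right 0)" for i
  proof -
    have "((\<lambda>t. r i t) \<longlongrightarrow> 1 / real (2 * i + 2)) (at_right 0)"
      unfolding r_def by (rule filterlim_compose[OF sinh_ratio_tendsto half]) auto
    then show ?thesis unfolding L_def using less1[of i] by (intro tendsto_intros) auto
  qed
  \<comment> \<open>By \<open>mult_sinh_le_sinh_mult\<close> the ratio \<open>r i t\<close> never
    exceeds its limit \<open>1 / (2 i + 2)\<close>, so the limiting series itself is the
    majorant.\<close>
  have bound: "norm (- ln (1 - (r i t)\<^sup>2)) \<le> L i" if t: "t > 0" for i t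
  proof -
    have "real (2 * i + 2) * sinh (t / 2) \<le> sinh (real (2 * i + 2) * (t / 2))"
      using t by (intro mult_sinh_le_sinh_mult) auto
    moreover have "sinh (t / 2) > 0" "sinh (real (2 * i + 2) * (t / 2)) > 0" using t by auto
    ultimately have r: "0 \<le> r i t" "r i t \<le> 1 / real (2 * i + 2)"
      unfolding r_def by (auto simp: field_simps)
    then have r2: "(r i t)\<^sup>2 \<le> (1 / real (2 * i + 2))\<^sup>2" by (intro power_mono) auto
    have "ln (1 - (1 / real (2 * i + 2))\<^sup>2) \<le> ln (1 - (r i t)\<^sup>2)"
      using r2 less1[of i] by (intro ln_mono) auto
    moreover have "ln (1 - (r i t)\<^sup>2) \<le> 0" using r2 less1[of i] by (subst ln_le_zero_iff) auto
    ultimately show ?thesis unfolding L_def by simp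
  qed
  have "((\<lambda>t. \<Sum>i. - ln (1 - (r i t)\<^sup>2)) \<longlongrightarrow> suminf L) (at_right 0)"
  proof (rule conjunct2[OF conjunct2[OF tannerys_theorem[where M = L]]])
    show "\<forall>\<^sub>F (k, n) in sequentially \<times>\<^sub>F at_right 0. norm (- ln (1 - (r k n)\<^sup>2)) \<le> L k"
      unfolding eventually_prod_filter using bound eventually_at_right_less[of "0::real"]
      by (intro exI[of _ "\<lambda>_. True"] exI[of _ "\<lambda>t. 0 < t"]) auto
    show "summable L" using sums_ln_wallis unfolding L_def by (rule sums_summable)
  qed (use lim in auto)
  moreover have "suminf L = ln (pi / 2)"
    using sums_ln_wallis unfolding L_def by (rule sums_unique[symmetric])
  ultimately have l1: "((\<lambda>t. \<Sum>i. - ln (1 - (r i t)\<^sup>2)) \<longlongrightarrow> ln (pi / 2)) (at_right 0)" by simp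
  have "((\<lambda>t. (exp t - exp 0) / (t - 0)) \<longlongrightarrow> exp 0) (at (0::real))"
    using DERIV_exp[of "0::real"] unfolding has_field_derivative_iff by simp
  then have l2: "((\<lambda>t. (exp t - 1) / t) \<longlongrightarrow> 1) (at_right (0::real))"
    using tendsto_mono[OF at_le[of "{0<..}" UNIV "0::real"], of "\<lambda>t. (exp t - 1) / t" 1] by simp
  have "((\<lambda>t. ln (exp (- t) * ((exp t - 1) / t))) \<longlongrightarrow> ln (exp (- 0) * 1)) (at_right (0::real))"
    by (intro tendsto_intros l2) auto
  then have "((\<lambda>t. (\<Sum>i. - ln (1 - (r i t)\<^sup>2)) - ln (exp (- t) * ((exp t - 1) / t))) \<longlongrightarrow> ln (pi / 2) - 0) (at_right (0::real))"
    by (intro tendsto_diff l1) simp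
  moreover have "\<forall>\<^sub>F t in at_right 0. (\<Sum>i. - ln (1 - (r i t)\<^sup>2)) - ln (exp (- t) * ((exp t - 1) / t))
      = 2 * (\<Sum>k. 1 / real k * part_prob t k) + ln t"
    using eventually_at_right_less[of "0::real"]
  proof eventually_elim
    case (elim t)
    have "exp (- t) * ((exp t - 1) / t) = (1 - exp (- t)) / t"
      by (simp add: algebra_simps diff_divide_distrib exp_minus)
    moreover have "ln ((1 - exp (- t)) / t) = ln (1 - exp (- t)) - ln t"
      using elim by (simp add: ln_div)
    moreover have "(\<Sum>i. - ln (1 - (r i t)\<^sup>2)) = 2 * (\<Sum>k. 1 / real k * part_prob t k) + ln (1 - exp (- t))"
      using recip_part_prob_series[OF elim] unfolding r_def by (rule sums_unique[symmetric])
    ultimately show ?case by (simp only:)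
  qed
  ultimately have "((\<lambda>t. 2 * (\<Sum>k. 1 / real k * part_prob t k) + ln t) \<longlongrightarrow> ln (pi / 2) - 0) (at_right 0)"
    by (rule Lim_transform_eventually)
  then show ?thesis by simp
qed

section \<open>Variance and trigonometric estimates\<close>

lemma power_le_fact_mult_exp:
  fixes x :: real
  assumes "x \<ge> 0"
  shows "x ^ a \<le> fact a * exp x"
proof -
  have "(\<Sum>i\<in>{a}. x ^ i /\<^sub>R fact i) \<le> (\<Sum>i. x ^ i /\<^sub>R fact i)"
    using assms by (intro sum_le_suminf summable_exp_generic) auto
  then have "x ^ a /\<^sub>R fact a \<le> exp x" by (simp add: exp_def)
  then show ?thesis by (simp add: field_simps)
qed

lemma sum_exp_le:
  fixes t :: real
  assumes "t > 0"
  shows "(\<Sum>k\<in>{1..n}. exp (- (t * real k))) \<le> 1 / t"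
proof -
  have "(\<Sum>k\<in>{1..n}. exp (- (t * real k))) \<le> (1 / t) * (1 - exp (- (t * real n)))"
  proof (induction n)
    case (Suc n)
    have "1 + t \<le> exp t" by simp
    then have "exp (- t) * (1 + t) \<le> exp (- t) * exp t" by (intro mult_left_mono) auto
    then have "t * exp (- t) \<le> 1 - exp (- t)" by (simp add: exp_minus algebra_simps)
    then have "exp (- t) \<le> (1 / t) * (1 - exp (- t))" using assms by (simp add: field_simps)
    then have "exp (- (t * real n)) * exp (- t) \<le> exp (- (t * real n)) * ((1 / t) * (1 - exp (- t)))"
      by (intro mult_left_mono) auto
    moreover have "exp (- (t * real (Suc n))) = exp (- (t * real n)) * exp (- t)"
      by (simp add: exp_add[symmetric] algebra_simps)
    ultimately have "exp (- (t * real (Suc n))) \<le> (1 / t) * (exp (- (t * real n)) - exp (- (t * real (Suc n))))"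
      by (simp add: algebra_simps)
    then show ?case using Suc by (simp add: algebra_simps)
  qed simp
  also have "\<dots> \<le> 1 / t" using assms by (simp add: field_simps)
  finally show ?thesis .
qed

text \<open>Half of the exponent absorbs the power; the other half is left for summing a geometric
  series.\<close>

lemma power_mult_exp_le:
  fixes t :: real
  assumes "t > 0"
  shows "real k ^ a * exp (- (t * real k)) \<le> fact a * (2 / t) ^ a * exp (- (t / 2 * real k))"
proof -
  have "(t / 2 * real k) ^ a \<le> fact a * exp (t / 2 * real k)"
    using assms by (intro power_le_fact_mult_exp) auto
  then have "(2 / t) ^ a * (t / 2 * real k) ^ a * exp (- (t * real k)) \<le> (2 / t) ^ a * (fact a * exp (t / 2 * real k)) * exp (- (t * real k))"
    using assms by (intro mult_right_mono mult_left_mono) auto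
  moreover have "(2 / t) ^ a * (t / 2 * real k) ^ a = real k ^ a"
    using assms by (simp add: power_mult_distrib[symmetric])
  moreover have "exp (t / 2 * real k) * exp (- (t * real k)) = exp (- (t / 2 * real k))"
    by (simp add: exp_add[symmetric])
  ultimately show ?thesis by (metis mult.assoc mult.commute)
qed

lemma sum_power_mult_exp_le:
  fixes t :: real
  assumes "t > 0"
  shows "(\<Sum>k\<in>{1..n}. real k ^ a * exp (- (t * real k))) \<le> fact a * (2 / t) ^ Suc a"
proof -
  have "(\<Sum>k\<in>{1..n}. real k ^ a * exp (- (t * real k))) \<le> (\<Sum>k\<in>{1..n}. fact a * (2 / t) ^ a * exp (- (t / 2 * real k)))"
    by (intro sum_mono power_mult_exp_le assms)
  also have "\<dots> = fact a * (2 / t) ^ a * (\<Sum>k\<in>{1..n}. exp (- (t / 2 * real k)))"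
    by (simp add: sum_distrib_left)
  also have "\<dots> \<le> fact a * (2 / t) ^ a * (1 / (t / 2))"
    using assms by (intro mult_left_mono sum_exp_le) auto
  finally show ?thesis by (simp add: mult_ac)
qed

definition part_var :: "real \<Rightarrow> nat \<Rightarrow> real" where
  "part_var t k = part_prob t k * (1 - part_prob t k)"

lemma part_var_pos: "0 < part_var t k"
  unfolding part_var_def using part_prob_pos part_prob_lt_1 by simp

lemma part_var_le: "part_var t k \<le> 1 / 4"
proof -
  have "0 \<le> (part_prob t k - 1 / 2)\<^sup>2" by simp
  then show ?thesis unfolding part_var_def by (simp add: power2_eq_square algebra_simps)
qed

lemma part_var_le_exp: "part_var t k \<le> exp (- (t * real k))"
proof -
  have "part_var t k \<le> part_prob t k * 1"
    unfolding part_var_def using part_prob_pos[of t k] by (intro mult_left_mono) auto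
  then show ?thesis using part_prob_le_exp[of t k] by simp
qed

text \<open>The variance is \<open>x / (1 + x)\<^sup>2\<close> with \<open>x = exp (- t k)\<close>,
  and here \<open>1 / 3 \<le> x \<le> 1\<close>, which gives \<open>(1 / 3) / 4\<close>.\<close>

lemma part_var_ge:
  assumes "t > 0" "t * real k \<le> 1"
  shows "1 / 12 \<le> part_var t k"
proof -
  define x where "x = exp (- (t * real k))"
  have x: "0 < x" "x \<le> 1" using assms by (auto simp: x_def)
  have "exp (t * real k) \<le> exp 1" using assms by simp
  also have "\<dots> \<le> 3" by (rule exp_le)
  finally have "1 / 3 \<le> x" unfolding x_def exp_minus by (simp add: field_simps)
  have "part_var t k = x / (1 + x)\<^sup>2"
    unfolding part_var_def part_prob_eq x_def[symmetric] using x by (simp add: field_simps power2_eq_square)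
  moreover have "(1 + x)\<^sup>2 \<le> 2\<^sup>2" using x by (intro power_mono) auto
  then have "(1 / 3) / 4 \<le> x / (1 + x)\<^sup>2" using x \<open>1 / 3 \<le> x\<close> by (intro frac_le) auto
  ultimately show ?thesis by simp
qed

text \<open>The ensemble is cut off at \<open>n\<close>: larger parts cannot occur in a partition of
  \<open>n\<close>, and all products and sums become finite.\<close>

definition size_var :: "real \<Rightarrow> nat \<Rightarrow> real" where
  "size_var t n = (\<Sum>k\<in>{1..n}. (real k)\<^sup>2 * part_var t k)"

lemma size_var_le:
  assumes "t > 0"
  shows "size_var t n \<le> 16 / t ^ 3"
proof -
  have "size_var t n \<le> (\<Sum>k\<in>{1..n}. real k ^ 2 * exp (- (t * real k)))"
    unfolding size_var_def by (intro sum_mono mult_left_mono part_var_le_exp) auto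
  also have "\<dots> \<le> fact 2 * (2 / t) ^ Suc 2" by (rule sum_power_mult_exp_le[OF assms])
  also have "\<dots> = 16 / t ^ 3" by (simp add: power_divide fact_numeral numeral_3_eq_3)
  finally show ?thesis .
qed

lemma sum_squares_ge: "real m ^ 3 / 3 \<le> (\<Sum>k\<in>{1..m}. (real k)\<^sup>2)"
proof (induction m)
  case (Suc m)
  have "real (Suc m) ^ 3 / 3 \<le> real m ^ 3 / 3 + (real (Suc m))\<^sup>2"
    by (simp add: power2_eq_square power3_eq_cube algebra_simps)
  then show ?case using Suc by simp
qed simp

lemma size_var_ge:
  assumes t: "t > 0" and m: "t * real m \<le> 1" "m \<le> n"
  shows "real m ^ 3 / 36 \<le> size_var t n"
proof -
  have "real m ^ 3 / 36 \<le> 1 / 12 * (\<Sum>k\<in>{1..m}. (real k)\<^sup>2)"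
    using sum_squares_ge[of m] by simp
  also have "\<dots> = (\<Sum>k\<in>{1..m}. (real k)\<^sup>2 * (1 / 12))"
    by (simp add: sum_distrib_left mult.commute)
  also have "\<dots> \<le> (\<Sum>k\<in>{1..m}. (real k)\<^sup>2 * part_var t k)"
  proof (intro sum_mono mult_left_mono part_var_ge t)
    fix k assume "k \<in> {1..m}"
    then have "t * real k \<le> t * real m" using t by (intro mult_left_mono) auto
    then show "t * real k \<le> 1" using m by simp
  qed auto
  also have "\<dots> \<le> size_var t n"
    unfolding size_var_def using m part_var_pos by (intro sum_mono2) (auto simp: less_imp_le)
  finally show ?thesis .
qed

section \<open>Bounds for sines, cosines and Bernoulli characteristic functions\<close>

lemma half_le_sin:
  assumes "0 \<le> y" "y \<le> pi / 2"
  shows "y / 2 \<le> sin y"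
\<comment> \<open>\<open>sin x - x / 2\<close> increases only while
  \<open>cos x \<ge> 1 / 2\<close>, that is up to \<open>pi / 3\<close>; beyond, the constant
  \<open>sin (pi / 3)\<close> already exceeds \<open>pi / 4\<close>.\<close>
proof (cases "y \<le> pi / 3")
  case True
  have "sin 0 - 0 / 2 \<le> sin y - y / 2"
  proof (rule DERIV_nonneg_imp_nondecreasing[OF assms(1)])
    fix x assume x: "0 \<le> x" "x \<le> y"
    then have "cos (pi / 3) \<le> cos x" using True by (intro cos_monotone_0_pi_le) auto
    then have "0 \<le> cos x - 1 / 2" by (simp add: cos_60)
    moreover have "((\<lambda>x. sin x - x / 2) has_real_derivative (cos x - 1 / 2)) (at x)"
      by (auto intro!: derivative_eq_intros)
    ultimately show "\<exists>D. ((\<lambda>x. sin x - x / 2) has_real_derivative D) (at x) \<and> 0 \<le> D" by blast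
  qed
  then show ?thesis by simp
next
  case False
  then have "sin (pi / 3) \<le> sin y" using assms by (intro sin_monotone_2pi_le) auto
  moreover have "8 / 5 \<le> sqrt 3" by (rule real_le_rsqrt) (simp add: power2_eq_square)
  moreover have "y / 2 \<le> 8 / 10" using assms(2) pi_less_4 pi_approx(2) by simp
  ultimately show ?thesis by (simp add: sin_60)
qed

lemma one_minus_cos_ge:
  fixes x :: real
  assumes "\<bar>x\<bar> \<le> pi"
  shows "x\<^sup>2 / 8 \<le> 1 - cos x"
proof -
  have "\<bar>x\<bar> / 2 / 2 \<le> sin (\<bar>x\<bar> / 2)" using assms by (intro half_le_sin) auto
  then have "(\<bar>x\<bar> / 2 / 2)\<^sup>2 \<le> (sin (\<bar>x\<bar> / 2))\<^sup>2" by (intro power_mono) auto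
  moreover have "cos x = 1 - 2 * (sin (\<bar>x\<bar> / 2))\<^sup>2"
    using cos_double_sin[of "\<bar>x\<bar> / 2"] by simp
  ultimately show ?thesis by (simp add: power_divide)
qed

lemma one_minus_cos_le:
  fixes x :: real
  shows "1 - cos x \<le> x\<^sup>2 / 2"
proof -
  have "(sin (x / 2))\<^sup>2 \<le> (x / 2)\<^sup>2"
    using abs_sin_x_le_abs_x[of "x / 2"] by (rule abs_le_square_iff[THEN iffD1])
  moreover have "cos x = 1 - 2 * (sin (x / 2))\<^sup>2" using cos_double_sin[of "x / 2"] by simp
  ultimately show ?thesis by (simp add: power_divide)
qed

lemma dirichlet_kernel:
  fixes \<theta> :: real
  shows "2 * sin (\<theta> / 2) * (\<Sum>k\<in>{1..m}. cos (real k * \<theta>)) = sin ((real m + 1 / 2) * \<theta>) - sin (\<theta> / 2)"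
proof (induction m)
  case (Suc m)
  have "2 * sin (\<theta> / 2) * cos (real (Suc m) * \<theta>) = sin ((real (Suc m) + 1 / 2) * \<theta>) - sin ((real m + 1 / 2) * \<theta>)"
  proof -
    have "(real (Suc m) + 1 / 2) * \<theta> = real (Suc m) * \<theta> + \<theta> / 2" "(real m + 1 / 2) * \<theta> = real (Suc m) * \<theta> - \<theta> / 2"
      by (auto simp: algebra_simps)
    then show ?thesis by (simp only: sin_add sin_diff) simp
  qed
  with Suc show ?case by (simp add: distrib_left)
qed simp

text \<open>While \<open>m \<bar>\<theta>\<bar> \<le> pi\<close>, every term is in the quadratic
  range of the cosine. Otherwise the Dirichlet kernel keeps the sum of cosines below
  \<open>2 m / 3\<close>.\<close>

lemma sum_one_minus_cos_ge:
  fixes \<theta> :: real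
  assumes "\<bar>\<theta>\<bar> \<le> pi"
  shows "min (real m / 3) (real m ^ 3 * \<theta>\<^sup>2 / 24) \<le> (\<Sum>k\<in>{1..m}. 1 - cos (real k * \<theta>))"
proof (cases "real m * \<bar>\<theta>\<bar> \<le> pi")
  case True
  have "real m ^ 3 * \<theta>\<^sup>2 / 24 = \<theta>\<^sup>2 / 8 * (real m ^ 3 / 3)" by simp
  also have "\<dots> \<le> \<theta>\<^sup>2 / 8 * (\<Sum>k\<in>{1..m}. (real k)\<^sup>2)"
    by (intro mult_left_mono sum_squares_ge) auto
  also have "\<dots> = (\<Sum>k\<in>{1..m}. (real k * \<theta>)\<^sup>2 / 8)"
    by (simp add: sum_distrib_left power_mult_distrib mult_ac)
  also have "\<dots> \<le> (\<Sum>k\<in>{1..m}. 1 - cos (real k * \<theta>))"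
  proof (intro sum_mono one_minus_cos_ge)
    fix k assume "k \<in> {1..m}"
    then have "real k * \<bar>\<theta>\<bar> \<le> real m * \<bar>\<theta>\<bar>" by (intro mult_right_mono) auto
    then show "\<bar>real k * \<theta>\<bar> \<le> pi" using True by (simp add: abs_mult)
  qed
  finally show ?thesis by simp
next
  case False
  define a where "a = \<bar>\<theta>\<bar>"
  have m: "real m > 0" using False by (cases "m = 0") auto
  have a: "pi < real m * a" "a \<le> pi" using False assms by (auto simp: a_def)
  have a0: "a > 0" using a m pi_gt_zero unfolding a_def by (metis abs_ge_zero less_eq_real_def mult_zero_right not_less_iff_gr_or_eq pi_gt_zero)
  have s: "a / 2 / 2 \<le> sin (a / 2)" using a a0 by (intro half_le_sin) auto
  have C: "(\<Sum>k\<in>{1..m}. cos (real k * \<theta>)) = (\<Sum>k\<in>{1..m}. cos (real k * a))"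
    unfolding a_def by (cases "\<theta> \<ge> 0") auto
  define c where "c = (\<Sum>k\<in>{1..m}. cos (real k * a))"
  have c1: "2 * sin (a / 2) * c \<le> 1 - sin (a / 2)"
    unfolding c_def dirichlet_kernel by simp
  have "c \<le> 2 / 3 * real m"
  proof (cases "c \<le> 0")
    case False
    have "a / 2 * c \<le> 2 * sin (a / 2) * c" using s False by (intro mult_right_mono) auto
    also have "\<dots> \<le> 1" using c1 s a0 by linarith
    finally have "a * c \<le> 2" by simp
    \<comment> \<open>\<open>m a > pi > 3\<close> together with the kernel bound
      \<open>a c \<le> 2\<close> gives \<open>3 c \<le> 2 m\<close>.\<close>
    have "3 * c \<le> real m * a * c" using False a pi_gt3 by (intro mult_right_mono) auto
    also have "\<dots> = real m * (a * c)" by simp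
    also have "\<dots> \<le> real m * 2" using \<open>a * c \<le> 2\<close> by (intro mult_left_mono) auto
    finally show ?thesis by simp
  qed (use m in auto)
  then have "real m / 3 \<le> real m - c" by simp
  also have "\<dots> = (\<Sum>k\<in>{1..m}. 1 - cos (real k * \<theta>))"
    by (simp only: sum_subtractf C c_def) simp
  finally show ?thesis by simp
qed

text \<open>The squared modulus is exactly \<open>1 - 2 p (1 - p) (1 - cos w)\<close>, and
  \<open>1 + y \<le> exp y\<close>.\<close>

lemma norm_bernoulli_char_le:
  assumes "0 \<le> p" "p \<le> 1"
  shows "norm (1 - complex_of_real p + of_real p * iexp w) \<le> exp (- (p * (1 - p) * (1 - cos w)))"
proof -
  have "(norm (1 - complex_of_real p + of_real p * iexp w))\<^sup>2 = (1 - p + p * cos w)\<^sup>2 + (p * sin w)\<^sup>2"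
    by (simp add: cmod_power2 Re_exp Im_exp)
  also have "\<dots> = 1 - 2 * (p * (1 - p) * (1 - cos w))"
    using sin_cos_squared_add[of w] by algebra
  also have "\<dots> \<le> exp (- (2 * (p * (1 - p) * (1 - cos w))))"
    using exp_ge_add_one_self[of "- (2 * (p * (1 - p) * (1 - cos w)))"] by linarith
  also have "\<dots> = (exp (- (p * (1 - p) * (1 - cos w))))\<^sup>2"
    by (simp add: power2_eq_square exp_add[symmetric])
  finally show ?thesis by (rule power2_le_imp_le) simp
qed

text \<open>Since \<open>2 (1 - cos x)\<close> is the squared distance from 1 to
  \<open>iexp x\<close>, this is the triangle inequality with
  \<open>(x + y)\<^sup>2 \<le> 2 x\<^sup>2 + 2 y\<^sup>2\<close>. It separates the phase of the size
  from the perturbation \<open>2 v / k\<close>.\<close>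

lemma one_minus_cos_add_ge:
  fixes a b :: real
  shows "(1 - cos a) / 2 - (1 - cos b) \<le> 1 - cos (a + b)"
proof -
  have sq: "(norm (1 - iexp x))\<^sup>2 = 2 * (1 - cos x)" for x
  proof -
    have "(norm (1 - iexp x))\<^sup>2 = (1 - cos x)\<^sup>2 + (sin x)\<^sup>2" by (simp add: cmod_power2 Re_exp Im_exp)
    also have "\<dots> = 2 * (1 - cos x)" using sin_cos_squared_add[of x] by algebra
    finally show ?thesis .
  qed
  have "norm (1 - iexp a) \<le> norm (1 - iexp (a + b)) + norm (1 - iexp b)"
  proof -
    have "1 - iexp a = (1 - iexp (a + b)) - iexp a * (1 - iexp b)"
      by (simp add: exp_add algebra_simps)
    then have "norm (1 - iexp a) \<le> norm (1 - iexp (a + b)) + norm (iexp a * (1 - iexp b))"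
      by (metis norm_triangle_ineq4)
    then show ?thesis by (simp add: norm_mult)
  qed
  then have "(norm (1 - iexp a))\<^sup>2 \<le> (norm (1 - iexp (a + b)) + norm (1 - iexp b))\<^sup>2"
    by (intro power_mono) auto
  also have "\<dots> \<le> 2 * (norm (1 - iexp (a + b)))\<^sup>2 + 2 * (norm (1 - iexp b))\<^sup>2"
    using sum_squares_bound[of "norm (1 - iexp (a + b))" "norm (1 - iexp b)"] by (simp add: power2_sum)
  finally have *: "2 * (1 - cos a) \<le> 2 * (2 * (1 - cos (a + b))) + 2 * (2 * (1 - cos b))"
    unfolding sq .
  have "x / 2 - z \<le> y" if "2 * x \<le> 2 * (2 * y) + 2 * (2 * z)" for x y z :: real
    using that by linarith
  from this[OF *] show ?thesis .
qed

section \<open>Decay and centering of the joint characteristic function\<close>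

text \<open>What part \<open>k\<close> adds to the exponent: \<open>v\<close> is the frequency dual
  to \<open>2 S\<close>, whence the 2, and \<open>u\<close> is dual to the size divided by its
  standard deviation.\<close>

definition phase :: "real \<Rightarrow> nat \<Rightarrow> real \<Rightarrow> real \<Rightarrow> nat \<Rightarrow> real" where
  "phase t n v u k = 2 * v / real k + u * real k / sqrt (size_var t n)"

text \<open>Joint characteristic function of \<open>2 S\<close> and the normalized, uncentered size
  when the parts up to \<open>n\<close> are included independently.\<close>

definition joint_char :: "real \<Rightarrow> nat \<Rightarrow> real \<Rightarrow> real \<Rightarrow> complex" where
  "joint_char t n v u =
     (\<Prod>k\<in>{1..n}. 1 - of_real (part_prob t k) + of_real (part_prob t k) * iexp (phase t n v u k))"

text \<open>\<open>m\<close> is the integer part of \<open>1 / t\<close>: comparable to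
  \<open>1 / t\<close>, yet small enough for \<open>part_var_ge\<close> to apply to all parts up to
  \<open>m\<close>.\<close>

lemma obtain_cutoff:
  assumes "0 < t" "t \<le> 1" "1 / t \<le> real n"
  obtains m where "1 \<le> m" "m \<le> n" "t * real m \<le> 1" "1 / t \<le> 2 * real m"
proof
  define m where "m = nat \<lfloor>1 / t\<rfloor>"
  have "1 \<le> 1 / t" using assms by simp
  then have "1 \<le> \<lfloor>1 / t\<rfloor>" by (simp only: one_le_floor)
  then have m: "real m = of_int \<lfloor>1 / t\<rfloor>" "1 \<le> m" unfolding m_def by linarith+
  have "real m \<le> 1 / t" "1 / t < real m + 1" unfolding m(1) by linarith+
  moreover from this have "real m \<le> real n" using assms(3) by linarith
  ultimately show "1 \<le> m" "m \<le> n" "t * real m \<le> 1" "1 / t \<le> 2 * real m"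
    using m(2) assms(1) by (simp_all add: pos_le_divide_eq mult.commute)
qed

text \<open>The two regimes of \<open>sum_one_minus_cos_ge\<close> are brought to one integrable
  majorant. If \<Omega> is at least \<open>m / 3\<close>, then
  \<open>1 + u\<^sup>2 \<le> 2049 m ^ 3\<close>, which \<open>exp (m / 72)\<close> beats; otherwise
  \<Omega> is at least a multiple of \<open>u\<^sup>2\<close>. The constant \<open>10 ^ 10\<close>
  exceeds \<open>2049 * 6 * 72 ^ 3\<close>.\<close>

lemma gaussian_or_exponential_decay:
  fixes m V u \<Omega> :: real
  assumes m: "1 \<le> m" and V: "0 < V" "V \<le> 128 * m ^ 3" and u: "u\<^sup>2 \<le> 16 * V"
    and \<Omega>: "min (m / 3) (m ^ 3 * (u\<^sup>2 / V) / 24) \<le> \<Omega>"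
  shows "exp (- (\<Omega> / 24)) \<le> 10 ^ 10 / (1 + u\<^sup>2)"
proof -
  have pos: "0 < 1 + u\<^sup>2" by (simp add: add_pos_nonneg)
  have "(1 + u\<^sup>2) \<le> 10 ^ 10 * exp (\<Omega> / 24)"
  proof (cases "m / 3 \<le> \<Omega>")
    case True
    have "(m / 72) ^ 3 \<le> fact 3 * exp (m / 72)" using m by (intro power_le_fact_mult_exp) auto
    also have "\<dots> \<le> 6 * exp (\<Omega> / 24)" using True by (simp add: fact_numeral)
    finally have 1: "m ^ 3 \<le> 2239488 * exp (\<Omega> / 24)" by (simp add: power_divide)
    have "1 ^ 3 \<le> m ^ 3" using m by (intro power_mono) auto
    then have "1 + u\<^sup>2 \<le> 2049 * m ^ 3" using u V by simp
    also have "\<dots> \<le> 2049 * (2239488 * exp (\<Omega> / 24))" using 1 by simp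
    also have "\<dots> \<le> 10 ^ 10 * exp (\<Omega> / 24)" by simp
    finally show ?thesis .
  next
    case False
    define X where "X = m ^ 3 * (u\<^sup>2 / V)"
    have "X / 24 \<le> \<Omega>" using False \<Omega> unfolding X_def by simp
    moreover have "u\<^sup>2 / 128 \<le> X"
    proof -
      have "u\<^sup>2 * V \<le> u\<^sup>2 * (128 * m ^ 3)" using V by (intro mult_left_mono) auto
      then show ?thesis unfolding X_def using V by (simp add: field_simps)
    qed
    ultimately have "u\<^sup>2 / 73728 \<le> \<Omega> / 24" by linarith
    then have "1 + u\<^sup>2 / 73728 \<le> exp (\<Omega> / 24)" using exp_ge_add_one_self[of "\<Omega> / 24"] by linarith
    then have "10 ^ 10 * (1 + u\<^sup>2 / 73728) \<le> 10 ^ 10 * exp (\<Omega> / 24)" by (rule mult_left_mono) simp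
    moreover have "1 + u\<^sup>2 \<le> 10 ^ 10 * (1 + u\<^sup>2 / 73728)"
      by (simp add: distrib_left) (use zero_le_power2[of u] in linarith)
    ultimately show ?thesis by linarith
  qed
  then show ?thesis using pos by (simp add: exp_minus field_simps)
qed

lemma size_var_pos:
  assumes "0 < t" "1 \<le> n"
  shows "0 < size_var t n"
  unfolding size_var_def using assms part_var_pos by (intro sum_pos) auto

text \<open>The range of \<open>u\<close> is a full period of the size frequency
  \<open>\<theta> = u / \<sigma>\<close>, so \<open>\<bar>\<theta>\<bar> \<le> pi\<close>. Only the
  parts up to the cutoff \<open>m\<close> are exploited; the others contribute factors of norm at
  most 1.\<close>

lemma norm_joint_char_le:
  assumes t: "0 < t" "t \<le> 1" "1 / t \<le> real n"
    and u: "\<bar>u\<bar> \<le> pi * sqrt (size_var t n)"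
  shows "norm (joint_char t n v u) \<le> 10 ^ 10 * exp (v\<^sup>2 / 3) / (1 + u\<^sup>2)"
proof -
  obtain m where m: "1 \<le> m" "m \<le> n" "t * real m \<le> 1" "1 / t \<le> 2 * real m"
    using obtain_cutoff[OF t] .
  define V where "V = size_var t n"
  define \<theta> where "\<theta> = u / sqrt V"
  define \<Omega> where "\<Omega> = (\<Sum>k\<in>{1..m}. 1 - cos (real k * \<theta>))"
  have V: "0 < V" unfolding V_def using t m by (intro size_var_pos) auto
  have "V \<le> 16 * (1 / t) ^ 3" unfolding V_def using size_var_le[OF t(1), of n] by (simp add: power_divide)
  also have "\<dots> \<le> 16 * (2 * real m) ^ 3" using m t by (intro mult_left_mono power_mono) auto
  finally have V2: "V \<le> 128 * real m ^ 3" by (simp add: power_mult_distrib)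
  have \<theta>: "\<bar>\<theta>\<bar> \<le> pi" using u V unfolding \<theta>_def V_def[symmetric] by (simp add: field_simps)
  have \<theta>2: "\<theta>\<^sup>2 = u\<^sup>2 / V" unfolding \<theta>_def using V by (simp add: power_divide)
  have u2: "u\<^sup>2 \<le> 16 * V"
  proof -
    have "\<theta>\<^sup>2 \<le> 4\<^sup>2" using \<theta> pi_less_4 by (intro power2_le_iff_abs_le[THEN iffD2]) auto
    then show ?thesis unfolding \<theta>2 using V by (simp add: field_simps)
  qed
  have ph: "phase t n v u k = real k * \<theta> + 2 * v / real k" for k
    unfolding phase_def \<theta>_def V_def by simp
  have sq2: "(\<Sum>k\<in>{1..m}. (1 / real k)\<^sup>2) \<le> 2"
  proof -
    have "{1..m} = insert 1 {1<..m}" using m by auto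
    then show ?thesis using sum_inverse_square_le[of 1 m] m by simp
  qed
  \<comment> \<open>1/24 is the variance bound 1/12 times the 1/2 lost in
    \<open>one_minus_cos_add_ge\<close>. The perturbation costs
    \<open>(1 / 12) (2 v / k)\<^sup>2 / 2 = v\<^sup>2 / (6 k\<^sup>2)\<close> per part, and the
    inverse squares sum to at most 2.\<close>
  have "\<Omega> / 24 - v\<^sup>2 / 3 \<le> \<Omega> / 24 - v\<^sup>2 / 6 * (\<Sum>k\<in>{1..m}. (1 / real k)\<^sup>2)"
    using mult_left_mono[OF sq2, of "v\<^sup>2 / 6"] by simp
  also have "\<dots> = (\<Sum>k\<in>{1..m}. (1 / 12) * ((1 - cos (real k * \<theta>)) / 2 - (2 * v / real k)\<^sup>2 / 2))"
    unfolding \<Omega>_def sum_distrib_left[symmetric] sum_subtractf sum_divide_distrib[symmetric]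
    by (simp add: sum_distrib_left power_divide power_mult_distrib sum_divide_distrib right_diff_distrib)
  also have "\<dots> \<le> (\<Sum>k\<in>{1..m}. part_var t k * (1 - cos (phase t n v u k)))"
  proof (rule sum_mono)
    fix k assume k: "k \<in> {1..m}"
    then have "t * real k \<le> t * real m" using t by (intro mult_left_mono) auto
    then have s: "1 / 12 \<le> part_var t k" using m(3) by (intro part_var_ge t) linarith
    have "(1 - cos (real k * \<theta>)) / 2 - (2 * v / real k)\<^sup>2 / 2 \<le> 1 - cos (phase t n v u k)"
      unfolding ph using one_minus_cos_add_ge[of "real k * \<theta>" "2 * v / real k"]
        one_minus_cos_le[of "2 * v / real k"] by linarith
    then have "(1 / 12) * ((1 - cos (real k * \<theta>)) / 2 - (2 * v / real k)\<^sup>2 / 2) \<le> (1 / 12) * (1 - cos (phase t n v u k))"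
      by (intro mult_left_mono) auto
    also have "\<dots> \<le> part_var t k * (1 - cos (phase t n v u k))"
      using s by (intro mult_right_mono) auto
    finally show "(1 / 12) * ((1 - cos (real k * \<theta>)) / 2 - (2 * v / real k)\<^sup>2 / 2)
        \<le> part_var t k * (1 - cos (phase t n v u k))" .
  qed
  also have "\<dots> \<le> (\<Sum>k\<in>{1..n}. part_var t k * (1 - cos (phase t n v u k)))"
    using m part_var_pos by (intro sum_mono2) (auto intro!: mult_nonneg_nonneg simp: less_imp_le)
  finally have ex: "- (\<Sum>k\<in>{1..n}. part_var t k * (1 - cos (phase t n v u k))) \<le> v\<^sup>2 / 3 - \<Omega> / 24"
    by linarith
  have "norm (joint_char t n v u) \<le> (\<Prod>k\<in>{1..n}. exp (- (part_var t k * (1 - cos (phase t n v u k)))))"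
    unfolding joint_char_def prod_norm[symmetric] part_var_def
    using part_prob_pos part_prob_lt_1
    by (intro prod_mono conjI norm_ge_zero norm_bernoulli_char_le) (auto simp: less_imp_le)
  also have "\<dots> = exp (- (\<Sum>k\<in>{1..n}. part_var t k * (1 - cos (phase t n v u k))))"
    by (simp add: exp_sum[symmetric] sum_negf)
  also have "\<dots> \<le> exp (v\<^sup>2 / 3 - \<Omega> / 24)" using ex by simp
  also have "\<dots> = exp (v\<^sup>2 / 3) * exp (- (\<Omega> / 24))" by (simp add: exp_add[symmetric])
  also have "\<dots> \<le> exp (v\<^sup>2 / 3) * (10 ^ 10 / (1 + u\<^sup>2))"
    using sum_one_minus_cos_ge[OF \<theta>, of m] m V V2 u2 unfolding \<Omega>_def[symmetric] \<theta>2
    by (intro mult_left_mono gaussian_or_exponential_decay[of "real m" V]) auto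
  finally show ?thesis by (simp add: mult_ac)
qed

section \<open>Characteristic functions of centered Bernoulli variables and their
  approximation\<close>

definition centered_factor :: "real \<Rightarrow> real \<Rightarrow> complex" where
  "centered_factor p w = of_real (1 - p) * iexp (- (w * p)) + of_real p * iexp (w * (1 - p))"

lemma norm_centered_factor_le_1:
  assumes "0 \<le> p" "p \<le> 1"
  shows "norm (centered_factor p w) \<le> 1"
proof -
  have "norm (centered_factor p w) \<le> norm (of_real (1 - p) * iexp (- (w * p))) + norm (of_real p * iexp (w * (1 - p)))"
    unfolding centered_factor_def by (rule norm_triangle_ineq)
  also have "\<dots> = 1"
    using assms by (simp only: norm_mult norm_exp_i_times norm_of_real) simp
  finally show ?thesis .
qed

lemma centered_factor_shift:
  "1 - of_real p + of_real p * iexp w = centered_factor p w * iexp (w * p)"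
  unfolding centered_factor_def by (simp add: algebra_simps exp_add[symmetric])

text \<open>Second-order Taylor expansion at both atoms: centering removes the linear term, and the
  third absolute moment is at most the variance. Keeping the factor \<open>p (1 - p)\<close> in the
  error is what makes it summable over large parts.\<close>

lemma centered_factor_approx:
  assumes p: "0 \<le> p" "p \<le> 1"
  shows "norm (centered_factor p w - of_real (1 - w\<^sup>2 * (p * (1 - p)) / 2)) \<le> \<bar>w\<bar> ^ 3 * (p * (1 - p)) / 6"
proof -
  define T where "T x = 1 + \<i> * of_real x - of_real (x\<^sup>2) / 2" for x :: real
  have T: "norm (iexp x - T x) \<le> \<bar>x\<bar> ^ 3 / 6" for x
  proof -
    have "(\<Sum>k\<le>2. (\<i> * of_real x) ^ k / fact k) = T x"
      unfolding T_def by (simp add: numeral_2_eq_2 power_mult_distrib field_simps)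
    then show ?thesis using iexp_approx1[of x 2] by (simp add: fact_numeral)
  qed
  have "of_real (1 - w\<^sup>2 * (p * (1 - p)) / 2) = of_real (1 - p) * T (- (w * p)) + of_real p * T (w * (1 - p))"
    unfolding T_def complex_eq_iff by (simp add: algebra_simps power2_eq_square) (simp add: field_simps)
  then have "centered_factor p w - of_real (1 - w\<^sup>2 * (p * (1 - p)) / 2) =
      of_real (1 - p) * (iexp (- (w * p)) - T (- (w * p))) + of_real p * (iexp (w * (1 - p)) - T (w * (1 - p)))"
    unfolding centered_factor_def by (simp only: right_diff_distrib) simp
  also have "norm \<dots> \<le> norm (of_real (1 - p) * (iexp (- (w * p)) - T (- (w * p)))) + norm (of_real p * (iexp (w * (1 - p)) - T (w * (1 - p))))"
    by (rule norm_triangle_ineq)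
  also have "\<dots> = (1 - p) * norm (iexp (- (w * p)) - T (- (w * p))) + p * norm (iexp (w * (1 - p)) - T (w * (1 - p)))"
    using p by (simp only: norm_mult norm_of_real)
  also have "\<dots> \<le> (1 - p) * (\<bar>- (w * p)\<bar> ^ 3 / 6) + p * (\<bar>w * (1 - p)\<bar> ^ 3 / 6)"
    using p by (intro add_mono mult_left_mono T) auto
  also have "\<dots> = \<bar>w\<bar> ^ 3 * (p * (1 - p)) / 6 * (p\<^sup>2 + (1 - p)\<^sup>2)"
  proof -
    have "\<bar>- (w * p)\<bar> ^ 3 = \<bar>w\<bar> ^ 3 * p ^ 3" "\<bar>w * (1 - p)\<bar> ^ 3 = \<bar>w\<bar> ^ 3 * (1 - p) ^ 3"
      using p by (simp_all add: abs_mult power_mult_distrib)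
    moreover have "(1 - p) * (W * p ^ 3 / 6) + p * (W * (1 - p) ^ 3 / 6) = W * (p * (1 - p)) / 6 * (p\<^sup>2 + (1 - p)\<^sup>2)" for W
      by (simp add: field_simps power2_eq_square power3_eq_cube)
    ultimately show ?thesis by (simp only:)
  qed
  also have "\<dots> \<le> \<bar>w\<bar> ^ 3 * (p * (1 - p)) / 6 * 1"
  proof (rule mult_left_mono)
    have "0 \<le> p * (1 - p)" using p by simp
    then show "p\<^sup>2 + (1 - p)\<^sup>2 \<le> 1" by (simp add: power2_eq_square algebra_simps)
  qed (use p in auto)
  finally show ?thesis by simp
qed

lemma abs_add_cube_le: "\<bar>a + b\<bar> ^ 3 \<le> 4 * (\<bar>a\<bar> ^ 3 + \<bar>b\<bar> ^ 3)" for a b :: real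
proof -
  have *: "(x + y) ^ 3 \<le> 4 * (x ^ 3 + y ^ 3)" if "0 \<le> x" "0 \<le> y" for x y :: real
  proof -
    have "4 * (x ^ 3 + y ^ 3) - (x + y) ^ 3 = 3 * ((x + y) * (x - y)\<^sup>2)"
      by (simp add: power3_eq_cube power2_eq_square algebra_simps)
    moreover have "0 \<le> 3 * ((x + y) * (x - y)\<^sup>2)" using that by simp
    ultimately show ?thesis by linarith
  qed
  have "\<bar>a + b\<bar> ^ 3 \<le> (\<bar>a\<bar> + \<bar>b\<bar>) ^ 3" by (intro power_mono) auto
  also have "\<dots> \<le> 4 * (\<bar>a\<bar> ^ 3 + \<bar>b\<bar> ^ 3)" by (intro *) auto
  finally show ?thesis .
qed

lemma exp_minus_approx:
  fixes y :: real
  assumes "0 \<le> y"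
  shows "\<bar>1 - y - exp (- y)\<bar> \<le> y\<^sup>2 / 2"
proof -
  have "exp (- 0) - (1 - 0 + 0\<^sup>2 / 2) \<ge> exp (- y) - (1 - y + y\<^sup>2 / 2)"
  proof (rule DERIV_nonpos_imp_nonincreasing[OF assms])
    fix x :: real assume "0 \<le> x" "x \<le> y"
    have "((\<lambda>x. exp (- x) - (1 - x + x\<^sup>2 / 2)) has_real_derivative (- exp (- x) + 1 - x)) (at x)"
      by (auto intro!: derivative_eq_intros)
    moreover have "- exp (- x) + 1 - x \<le> 0" using exp_ge_add_one_self[of "- x"] by linarith
    ultimately show "\<exists>D. ((\<lambda>x. exp (- x) - (1 - x + x\<^sup>2 / 2)) has_real_derivative D) (at x) \<and> D \<le> 0" by blast
  qed
  then show ?thesis using exp_ge_add_one_self[of "- y"] by simp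
qed

text \<open>To be used with \<alpha> the phase of \<open>2 S\<close> and \<beta> that of the size.
  The terms in \<alpha> alone do not vanish as \<open>n\<close> grows, but they are summable over
  \<open>k\<close> and serve as a majorant. Every term containing \<beta> keeps the variance
  \<open>s\<close>, so that its sum over \<open>k\<close> tends to 0.\<close>

lemma centered_factor_diff_le:
  fixes p \<alpha> \<beta> :: real
  assumes p: "0 \<le> p" "p \<le> 1"
  defines "s \<equiv> p * (1 - p)"
  shows "norm (centered_factor p (\<alpha> + \<beta>) - of_real (cos (\<alpha> / 2) * exp (- (\<beta>\<^sup>2 * s / 2))))
     \<le> \<bar>\<alpha>\<bar> ^ 3 + \<alpha>\<^sup>2 + s * (\<bar>\<beta>\<bar> ^ 3 + \<bar>\<alpha> * \<beta>\<bar> + \<beta> ^ 4)"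
proof -
  define w where "w = \<alpha> + \<beta>"
  define E where "E = exp (- (\<beta>\<^sup>2 * s / 2))"
  have s: "0 \<le> s" "s \<le> 1 / 4"
  proof -
    have "0 \<le> (p - 1 / 2)\<^sup>2" by simp
    then show "s \<le> 1 / 4" unfolding s_def by (simp add: power2_eq_square algebra_simps)
  qed (use p in \<open>simp add: s_def\<close>)
  have E: "0 \<le> E" "E \<le> 1" unfolding E_def using s by auto
  have "norm (centered_factor p w - of_real (cos (\<alpha> / 2) * E)) \<le>
      norm (centered_factor p w - of_real (1 - w\<^sup>2 * s / 2)) + norm (complex_of_real ((1 - w\<^sup>2 * s / 2) - cos (\<alpha> / 2) * E))"
    using norm_triangle_ineq[of "centered_factor p w - of_real (1 - w\<^sup>2 * s / 2)" "complex_of_real ((1 - w\<^sup>2 * s / 2) - cos (\<alpha> / 2) * E)"]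
    by simp
  also have "\<dots> \<le> \<bar>w\<bar> ^ 3 * s / 6 + \<bar>(1 - w\<^sup>2 * s / 2) - cos (\<alpha> / 2) * E\<bar>"
    using centered_factor_approx[OF p, of w] unfolding s_def norm_of_real by (rule add_right_mono)
  also have "\<bar>(1 - w\<^sup>2 * s / 2) - cos (\<alpha> / 2) * E\<bar> \<le>
      \<bar>w\<^sup>2 * s / 2 - \<beta>\<^sup>2 * s / 2\<bar> + \<bar>1 - \<beta>\<^sup>2 * s / 2 - E\<bar> + \<bar>(1 - cos (\<alpha> / 2)) * E\<bar>"
    by (simp add: algebra_simps)
  also have "\<bar>w\<^sup>2 * s / 2 - \<beta>\<^sup>2 * s / 2\<bar> \<le> \<alpha>\<^sup>2 / 8 + s * \<bar>\<alpha> * \<beta>\<bar>"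
  proof -
    have "w\<^sup>2 * s / 2 - \<beta>\<^sup>2 * s / 2 = s * (\<alpha>\<^sup>2 / 2) + s * (\<alpha> * \<beta>)"
      unfolding w_def by (simp add: power2_eq_square algebra_simps)
    then have "\<bar>w\<^sup>2 * s / 2 - \<beta>\<^sup>2 * s / 2\<bar> \<le> \<bar>s * (\<alpha>\<^sup>2 / 2)\<bar> + \<bar>s * (\<alpha> * \<beta>)\<bar>" by linarith
    also have "\<dots> = s * (\<alpha>\<^sup>2 / 2) + s * \<bar>\<alpha> * \<beta>\<bar>" using s by (simp add: abs_mult)
    also have "s * (\<alpha>\<^sup>2 / 2) \<le> 1 / 4 * (\<alpha>\<^sup>2 / 2)" using s by (intro mult_right_mono) auto
    finally show ?thesis by simp
  qed
  also have "\<bar>1 - \<beta>\<^sup>2 * s / 2 - E\<bar> \<le> s * \<beta> ^ 4"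
  proof -
    have "\<bar>1 - \<beta>\<^sup>2 * s / 2 - E\<bar> \<le> (\<beta>\<^sup>2 * s / 2)\<^sup>2 / 2" unfolding E_def using s by (intro exp_minus_approx) auto
    also have "\<dots> = s * (s * \<beta> ^ 4) / 8" by (simp add: power2_eq_square power4_eq_xxxx)
    also have "\<dots> \<le> 1 * (s * \<beta> ^ 4) / 8" using s by (intro divide_right_mono mult_right_mono) auto
    also have "\<dots> \<le> s * \<beta> ^ 4" using s by simp
    finally show ?thesis .
  qed
  also have "\<bar>(1 - cos (\<alpha> / 2)) * E\<bar> \<le> \<alpha>\<^sup>2 / 8"
  proof -
    have "\<bar>(1 - cos (\<alpha> / 2)) * E\<bar> \<le> (1 - cos (\<alpha> / 2)) * 1"
      using E by (simp add: abs_mult mult_left_le)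
    also have "\<dots> \<le> (\<alpha> / 2)\<^sup>2 / 2" using one_minus_cos_le[of "\<alpha> / 2"] by simp
    finally show ?thesis by (simp add: power_divide)
  qed
  also have "\<bar>w\<bar> ^ 3 * s / 6 \<le> \<bar>\<alpha>\<bar> ^ 3 + s * \<bar>\<beta>\<bar> ^ 3"
  proof -
    have "\<bar>w\<bar> ^ 3 * s / 6 \<le> 4 * (\<bar>\<alpha>\<bar> ^ 3 + \<bar>\<beta>\<bar> ^ 3) * s / 6"
      unfolding w_def using s by (intro divide_right_mono mult_right_mono abs_add_cube_le) auto
    also have "\<dots> = (2 / 3) * (s * \<bar>\<alpha>\<bar> ^ 3) + (2 / 3) * (s * \<bar>\<beta>\<bar> ^ 3)" by (simp add: algebra_simps)
    also have "\<dots> \<le> 1 * (1 * \<bar>\<alpha>\<bar> ^ 3) + 1 * (s * \<bar>\<beta>\<bar> ^ 3)"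
      using s by (intro add_mono mult_mono) auto
    finally show ?thesis by simp
  qed
  finally have "norm (centered_factor p w - of_real (cos (\<alpha> / 2) * E)) \<le>
     \<bar>\<alpha>\<bar> ^ 3 + s * \<bar>\<beta>\<bar> ^ 3 + (\<alpha>\<^sup>2 / 8 + s * \<bar>\<alpha> * \<beta>\<bar> + s * \<beta> ^ 4 + \<alpha>\<^sup>2 / 8)" by simp
  also have "\<dots> \<le> \<bar>\<alpha>\<bar> ^ 3 + \<alpha>\<^sup>2 + s * (\<bar>\<beta>\<bar> ^ 3 + \<bar>\<alpha> * \<beta>\<bar> + \<beta> ^ 4)"
    by (simp add: distrib_left)
  finally show ?thesis unfolding w_def E_def .
qed

section \<open>The saddle point\<close>

text \<open>Tannery's theorem applies to \<open>min (d n k) (b k)\<close>, and \<open>d\<close>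
  exceeds this minimum by at most \<open>e\<close>, whose total vanishes.\<close>

lemma sum_tendsto_0_if_dominated:
  fixes d e :: "nat \<Rightarrow> nat \<Rightarrow> real" and b :: "nat \<Rightarrow> real"
  assumes d: "\<And>n k. 0 \<le> d n k" "\<And>k. k \<ge> 1 \<Longrightarrow> (\<lambda>n. d n k) \<longlonglongrightarrow> 0"
    and le: "\<And>n k. k \<ge> 1 \<Longrightarrow> d n k \<le> b k + e n k" and e: "\<And>n k. 0 \<le> e n k"
    and b: "summable b" "\<And>k. 0 \<le> b k"
    and lim: "(\<lambda>n. \<Sum>k\<in>{1..n}. e n k) \<longlonglongrightarrow> 0"
  shows "(\<lambda>n. \<Sum>k\<in>{1..n}. d n k) \<longlonglongrightarrow> 0"
proof -
  define a where "a k n = (if k \<in> {1..n} then min (d n k) (b k) else 0)" for k n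
  have a: "0 \<le> a k n" "a k n \<le> b k" for k n unfolding a_def using d(1) b(2) by auto
  have "(\<lambda>n. \<Sum>k. a k n) \<longlonglongrightarrow> (\<Sum>k. 0)"
  proof (rule conjunct2[OF conjunct2[OF tannerys_theorem[where M = b]]])
    fix k
    show "(\<lambda>n. a k n) \<longlonglongrightarrow> 0"
    proof (cases "k \<ge> 1")
      case True
      show ?thesis
        by (rule tendsto_sandwich[OF _ _ tendsto_const d(2)[OF True]])
           (use a(1) d(1) in \<open>auto simp: a_def\<close>)
    qed (simp add: a_def)
    show "\<forall>\<^sub>F (k, n) in sequentially \<times>\<^sub>F sequentially. norm (a k n) \<le> b k"
      using a by (intro always_eventually) auto
  qed (use b in auto)
  then have l: "(\<lambda>n. \<Sum>k. a k n) \<longlonglongrightarrow> 0" by simp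
  have eq: "(\<Sum>k. a k n) = (\<Sum>k\<in>{1..n}. a k n)" for n
    by (rule suminf_finite) (auto simp: a_def)
  have up: "(\<Sum>k\<in>{1..n}. d n k) \<le> (\<Sum>k. a k n) + (\<Sum>k\<in>{1..n}. e n k)" for n
    unfolding eq sum.distrib[symmetric]
  proof (rule sum_mono)
    fix k assume "k \<in> {1..n}"
    then show "d n k \<le> a k n + e n k" using le[of k n] e[of n k] by (auto simp: a_def min_def)
  qed
  have "(\<lambda>n. (\<Sum>k. a k n) + (\<Sum>k\<in>{1..n}. e n k)) \<longlonglongrightarrow> 0 + 0"
    by (intro tendsto_add l lim)
  then have l2: "(\<lambda>n. (\<Sum>k. a k n) + (\<Sum>k\<in>{1..n}. e n k)) \<longlonglongrightarrow> 0" by simp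
  show ?thesis
    by (rule tendsto_sandwich[OF _ _ tendsto_const l2]) (use up d(1) in \<open>auto intro!: always_eventually sum_nonneg\<close>)
qed

text \<open>The majorant is assumed only beyond \<open>n\<close> but summed over all
  \<open>k\<close>; the smallness of the tail has to sit in \<open>B\<close>. Applications gain it
  from \<open>1 \<le> (k / n)\<^sup>2\<close> for \<open>k > n\<close>.\<close>

lemma suminf_tail_bounds:
  fixes f :: "nat \<Rightarrow> real"
  assumes t: "t > 0" and f: "summable f" "\<And>k. 0 \<le> f k" "f 0 = 0" and B: "0 \<le> B"
    and le: "\<And>k. k > n \<Longrightarrow> f k \<le> B * (real k ^ a * exp (- (t * real k)))"
  shows "(\<Sum>k\<in>{1..n}. f k) \<le> suminf f"
    and "suminf f \<le> (\<Sum>k\<in>{1..n}. f k) + B * (fact a * (2 / t) ^ Suc a)"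
proof -
  show "(\<Sum>k\<in>{1..n}. f k) \<le> suminf f" using f by (intro sum_le_suminf) auto
  show "suminf f \<le> (\<Sum>k\<in>{1..n}. f k) + B * (fact a * (2 / t) ^ Suc a)"
  proof (rule suminf_le_const[OF f(1)])
    fix N
    have "(\<Sum>k<N. f k) \<le> (\<Sum>k\<in>insert 0 ({1..n} \<union> {n<..n+N}). f k)"
      using f by (intro sum_mono2) auto
    also have "\<dots> = (\<Sum>k\<in>{1..n}. f k) + (\<Sum>k\<in>{n<..n+N}. f k)"
      using f(3) by (subst sum.insert) (auto intro!: sum.union_disjoint)
    also have "(\<Sum>k\<in>{n<..n+N}. f k) \<le> (\<Sum>k\<in>{n<..n+N}. B * (real k ^ a * exp (- (t * real k))))"
      by (intro sum_mono le) auto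
    also have "\<dots> \<le> (\<Sum>k\<in>{1..n+N}. B * (real k ^ a * exp (- (t * real k))))"
      using B by (intro sum_mono2) auto
    also have "\<dots> = B * (\<Sum>k\<in>{1..n+N}. real k ^ a * exp (- (t * real k)))" by (simp add: sum_distrib_left)
    also have "\<dots> \<le> B * (fact a * (2 / t) ^ Suc a)"
      using B by (intro mult_left_mono sum_power_mult_exp_le t)
    finally show "(\<Sum>k<N. f k) \<le> (\<Sum>k\<in>{1..n}. f k) + B * (fact a * (2 / t) ^ Suc a)" by simp
  qed
qed

section \<open>The solution of \<open>pi\<^sup>2 / (12 t\<^sup>2) = n\<close>, and both means at
  this parameter\<close>

definition saddle :: "nat \<Rightarrow> real" where
  "saddle n = pi / (2 * sqrt (3 * real n))"

lemma saddle_pos: "n \<ge> 1 \<Longrightarrow> 0 < saddle n"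
  unfolding saddle_def by simp

lemma saddle_eq: "n \<ge> 1 \<Longrightarrow> real n * (12 * (saddle n)\<^sup>2) = pi\<^sup>2"
  unfolding saddle_def by (simp add: power_divide power_mult_distrib)

lemma saddle_tendsto_0: "saddle \<longlonglongrightarrow> 0"
proof -
  have "(\<lambda>n. pi / (2 * sqrt 3) * (1 / sqrt (real n))) \<longlonglongrightarrow> pi / (2 * sqrt 3) * 0"
    by (intro tendsto_mult tendsto_const) (rule tendsto_divide_0[OF tendsto_const filterlim_at_top_imp_at_infinity[OF filterlim_compose[OF sqrt_at_top filterlim_real_sequentially]]])
  then show ?thesis unfolding saddle_def by (simp add: real_sqrt_mult mult.assoc)
qed

lemma saddle_at_right: "filterlim saddle (at_right 0) sequentially"
  unfolding filterlim_at
proof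
  show "\<forall>\<^sub>F n in sequentially. saddle n \<in> {0<..} \<and> saddle n \<noteq> 0"
    using eventually_ge_at_top[of 1] by eventually_elim (use saddle_pos in force)
qed (rule saddle_tendsto_0)

lemma eventually_saddle_small:
  "\<forall>\<^sub>F n in sequentially. n \<ge> 1 \<and> 0 < saddle n \<and> saddle n \<le> 1 \<and> 1 / saddle n \<le> real n"
proof -
  \<comment> \<open>With \<open>9 \<le> pi\<^sup>2 = 12 n t\<^sup>2\<close>, the bound
    \<open>t < 3 / 4\<close> yields \<open>9 \<le> 9 n t\<close>, that is
    \<open>1 / t \<le> n\<close>.\<close>
  have "\<forall>\<^sub>F n in sequentially. saddle n < 3 / 4"
    using order_tendstoD(2)[OF saddle_tendsto_0, of "3 / 4"] by simp
  then show ?thesis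
    using eventually_ge_at_top[of 1]
  proof eventually_elim
    case (elim n)
    have t: "0 < saddle n" using saddle_pos elim by simp
    have "3 * 3 \<le> pi * pi" using pi_gt3 by (intro mult_mono) auto
    then have "9 \<le> real n * (12 * (saddle n)\<^sup>2)"
      using saddle_eq[of n] elim by (simp add: power2_eq_square)
    also have "\<dots> = 12 * (real n * saddle n) * saddle n" by (simp add: power2_eq_square)
    also have "\<dots> \<le> 12 * (real n * saddle n) * (3 / 4)"
      using elim t by (intro mult_left_mono) auto
    finally have "1 \<le> real n * saddle n" by simp
    then show ?case using elim t by (simp add: pos_divide_le_eq)
  qed
qed

lemma inverse_sqrt_size_var_le:
  assumes t: "0 < t" "t \<le> 1" "1 / t \<le> real n"
  shows "1 / sqrt (size_var t n) \<le> 17 * sqrt t ^ 3"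
proof -
  obtain m where m: "1 \<le> m" "m \<le> n" "t * real m \<le> 1" "1 / t \<le> 2 * real m"
    using obtain_cutoff[OF t] .
  have "(1 / t) ^ 3 / 288 \<le> (2 * real m) ^ 3 / 288" using m t by (intro divide_right_mono power_mono) auto
  also have "\<dots> \<le> size_var t n" using size_var_ge[OF t(1) m(3,2)] by (simp add: power_mult_distrib)
  finally have V: "1 \<le> 288 * t ^ 3 * size_var t n" using t by (simp add: power_divide field_simps)
  have V0: "0 < size_var t n" using t m by (intro size_var_pos) auto
  \<comment> \<open>288 is \<open>36 * 2 ^ 3\<close>; it is rounded up to 289 because that is the
    square of 17.\<close>
  have "1 \<le> sqrt (289 * t ^ 3 * size_var t n)"
    using V V0 t by (intro real_le_rsqrt) (auto intro: order_trans)
  also have "\<dots> = 17 * sqrt t ^ 3 * sqrt (size_var t n)"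
  proof -
    have "sqrt 289 = 17" by (rule real_sqrt_unique) auto
    then show ?thesis by (simp add: real_sqrt_mult real_sqrt_power)
  qed
  finally show ?thesis using V0 by (simp add: field_simps)
qed

lemma inverse_sigma_tendsto_0: "(\<lambda>n. 1 / sqrt (size_var (saddle n) n)) \<longlonglongrightarrow> 0"
proof -
  have "(\<lambda>n. 17 * sqrt (saddle n) ^ 3) \<longlonglongrightarrow> 17 * sqrt 0 ^ 3"
    by (intro tendsto_intros saddle_tendsto_0)
  then have "(\<lambda>n. 17 * sqrt (saddle n) ^ 3) \<longlonglongrightarrow> 0" by simp
  moreover have "\<forall>\<^sub>F n in sequentially. norm (1 / sqrt (size_var (saddle n) n)) \<le> 17 * sqrt (saddle n) ^ 3"
    using eventually_saddle_small
  proof eventually_elim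
    case (elim n)
    then have "0 < size_var (saddle n) n" by (intro size_var_pos) auto
    then show ?case using inverse_sqrt_size_var_le[of "saddle n" n] elim by simp
  qed
  ultimately show ?thesis by (rule Lim_null_comparison[rotated])
qed

text \<open>The absolute error is at most \<open>1 / t\<close> plus a constant, and
  \<open>1 / \<sigma>\<close> is O(t^(3/2)).\<close>

lemma mean_size_tendsto:
  "(\<lambda>n. ((\<Sum>k\<in>{1..n}. real k * part_prob (saddle n) k) - real n) / sqrt (size_var (saddle n) n)) \<longlonglongrightarrow> 0"
proof -
  have bound: "\<bar>(\<Sum>k\<in>{1..n}. real k * part_prob t k) - real n\<bar> \<le> 1 / t + 96 * 256"
    if t: "t = saddle n" and n: "n \<ge> 1" and t1: "0 < t" for n t
  proof -
    have nt: "real n = pi\<^sup>2 / (12 * t\<^sup>2)" using saddle_eq[OF n] t t1 by (simp add: field_simps)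
    have nt2: "1 \<le> 2 * (real n * t\<^sup>2)"
    proof -
      have "3 * 3 \<le> pi * pi" using pi_gt3 by (intro mult_mono) auto
      then show ?thesis using saddle_eq[OF n] t by (simp add: power2_eq_square)
    qed
    note M = sum_part_prob_bounds[OF t1]
    have tail: "(\<Sum>k\<in>{1..n}. real k * part_prob t k) \<le> (\<Sum>k. real k * part_prob t k)"
      "(\<Sum>k. real k * part_prob t k) \<le> (\<Sum>k\<in>{1..n}. real k * part_prob t k) + (1 / (real n)\<^sup>2) * (fact 3 * (2 / t) ^ Suc 3)"
    proof -
      \<comment> \<open>Two extra factors \<open>k / n\<close> turn the tail bound into
        \<open>96 / (n t\<^sup>2)\<^sup>2\<close>, which is bounded because
        \<open>n t\<^sup>2 = pi\<^sup>2 / 12\<close>.\<close>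
      have le: "real k * part_prob t k \<le> 1 / (real n)\<^sup>2 * (real k ^ 3 * exp (- (t * real k)))" if k: "k > n" for k
      proof -
        have "real k * part_prob t k \<le> real k * exp (- (t * real k))"
          by (intro mult_left_mono part_prob_le_exp) auto
        also have "\<dots> \<le> real k ^ 3 / (real n)\<^sup>2 * exp (- (t * real k))"
        proof (rule mult_right_mono)
          have "(real n)\<^sup>2 \<le> (real k)\<^sup>2" using k by (intro power_mono) auto
          then have "real k * (real n)\<^sup>2 \<le> real k * (real k)\<^sup>2" by (intro mult_left_mono) auto
          then show "real k \<le> real k ^ 3 / (real n)\<^sup>2"
            using n by (simp add: field_simps power3_eq_cube power2_eq_square)
        qed simp
        finally show ?thesis by simp
      qed
      show "(\<Sum>k\<in>{1..n}. real k * part_prob t k) \<le> (\<Sum>k. real k * part_prob t k)"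
        "(\<Sum>k. real k * part_prob t k) \<le> (\<Sum>k\<in>{1..n}. real k * part_prob t k) + (1 / (real n)\<^sup>2) * (fact 3 * (2 / t) ^ Suc 3)"
        using suminf_tail_bounds[OF t1 M(1), of "1 / (real n)\<^sup>2" n 3] le part_prob_pos
        by (auto simp: less_imp_le)
    qed
    have "(1 / (real n)\<^sup>2) * (fact 3 * (2 / t) ^ Suc 3) = 96 / (real n * t\<^sup>2)\<^sup>2"
      using t1 n by (simp add: fact_numeral power_divide field_simps power2_eq_square numeral_eq_Suc)
    also have "\<dots> \<le> 96 / (1 / 16)\<^sup>2"
      using nt2 n t1 by (intro divide_left_mono power_mono mult_pos_pos zero_less_power) auto
    finally have "(1 / (real n)\<^sup>2) * (fact 3 * (2 / t) ^ Suc 3) \<le> 96 * 256" by (simp add: power2_eq_square)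
    moreover have "0 \<le> 1 / t" using t1 by simp
    ultimately show ?thesis using tail M(2,3) nt by linarith
  qed
  have "(\<lambda>n. 17 * sqrt (saddle n) + (96 * 256) * (1 / sqrt (size_var (saddle n) n))) \<longlonglongrightarrow> 17 * sqrt 0 + (96 * 256) * 0"
    by (intro tendsto_intros saddle_tendsto_0 inverse_sigma_tendsto_0)
  then have l: "(\<lambda>n. 17 * sqrt (saddle n) + (96 * 256) * (1 / sqrt (size_var (saddle n) n))) \<longlonglongrightarrow> 0" by simp
  show ?thesis
  proof (rule Lim_null_comparison[OF _ l])
    show "\<forall>\<^sub>F n in sequentially. norm (((\<Sum>k\<in>{1..n}. real k * part_prob (saddle n) k) - real n) / sqrt (size_var (saddle n) n))
       \<le> 17 * sqrt (saddle n) + (96 * 256) * (1 / sqrt (size_var (saddle n) n))"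
      using eventually_saddle_small
    proof eventually_elim
      case (elim n)
      define t where "t = saddle n"
      define \<sigma> where "\<sigma> = sqrt (size_var t n)"
      have t: "0 < t" "t \<le> 1" "1 / t \<le> real n" using elim by (auto simp: t_def)
      have \<sigma>: "0 < \<sigma>" unfolding \<sigma>_def using size_var_pos[OF t(1), of n] elim by simp
      have "norm (((\<Sum>k\<in>{1..n}. real k * part_prob t k) - real n) / \<sigma>)
         = \<bar>(\<Sum>k\<in>{1..n}. real k * part_prob t k) - real n\<bar> * (1 / \<sigma>)" using \<sigma> by simp
      also have "\<dots> \<le> (1 / t + 96 * 256) * (1 / \<sigma>)"
        using bound[OF t_def] elim t \<sigma> by (intro mult_right_mono) auto
      also have "\<dots> = 1 / t * (1 / \<sigma>) + 96 * 256 * (1 / \<sigma>)" by (rule distrib_right)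
      also have "1 / t * (1 / \<sigma>) \<le> 1 / t * (17 * sqrt t ^ 3)"
        using inverse_sqrt_size_var_le[OF t] t unfolding \<sigma>_def by (intro mult_left_mono) auto
      also have "1 / t * (17 * sqrt t ^ 3) = 17 * sqrt t"
        using t by (simp add: power3_eq_cube)
      finally show ?case unfolding t_def \<sigma>_def by simp
    qed
  qed
qed

text \<open>The mean is \<open>ln (pi / 2) - ln t + o(1)\<close>, and \<open>t\<close> is
  \<open>pi / 2\<close> divided by \<open>sqrt (3 n)\<close>: this is where the centering in the
  theorem comes from.\<close>

lemma mean_recip_tendsto:
  "(\<lambda>n. 2 * (\<Sum>k\<in>{1..n}. part_prob (saddle n) k / real k) - ln (sqrt (3 * real n))) \<longlonglongrightarrow> 0"
proof -
  define F where "F t = (\<Sum>k. 1 / real k * part_prob t k)" for t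
  have "(\<lambda>n. 2 * F (saddle n) + ln (saddle n)) \<longlonglongrightarrow> ln (pi / 2)"
    unfolding F_def by (rule filterlim_compose[OF recip_part_prob_asymp saddle_at_right])
  moreover have "(\<lambda>n. 2 * (12 / pi\<^sup>2 * 4 * (12 / pi\<^sup>2) * (saddle n)\<^sup>2)) \<longlonglongrightarrow> 2 * (12 / pi\<^sup>2 * 4 * (12 / pi\<^sup>2) * 0\<^sup>2)"
    by (intro tendsto_intros saddle_tendsto_0)
  then have l0: "(\<lambda>n. 2 * (12 / pi\<^sup>2 * 4 * (12 / pi\<^sup>2) * (saddle n)\<^sup>2)) \<longlonglongrightarrow> 0" by simp
  have "(\<lambda>n. 2 * (\<Sum>k\<in>{1..n}. part_prob (saddle n) k / real k) - 2 * F (saddle n)) \<longlonglongrightarrow> 0"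
  proof (rule Lim_null_comparison[OF _ l0])
    show "\<forall>\<^sub>F n in sequentially. norm (2 * (\<Sum>k\<in>{1..n}. part_prob (saddle n) k / real k) - 2 * F (saddle n))
        \<le> 2 * (12 / pi\<^sup>2 * 4 * (12 / pi\<^sup>2) * (saddle n)\<^sup>2)"
      using eventually_saddle_small
    proof eventually_elim
      case (elim n)
      define t where "t = saddle n"
      have t: "0 < t" and n: "n \<ge> 1" using elim by (auto simp: t_def)
      have nt: "1 / real n = 12 / pi\<^sup>2 * t\<^sup>2"
        using saddle_eq[OF n] n unfolding t_def[symmetric] by (simp add: field_simps)
      have le: "1 / real k * part_prob t k \<le> 1 / (real n)\<^sup>2 * (real k ^ 1 * exp (- (t * real k)))" if k: "k > n" for k
      proof -
        have "1 / real k * part_prob t k \<le> 1 / real k * exp (- (t * real k))"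
          by (intro mult_left_mono part_prob_le_exp) auto
        also have "\<dots> \<le> real k / (real n)\<^sup>2 * exp (- (t * real k))"
        proof (rule mult_right_mono)
          have "(real n)\<^sup>2 \<le> (real k)\<^sup>2" using k by (intro power_mono) auto
          then show "1 / real k \<le> real k / (real n)\<^sup>2"
            using n k by (simp add: field_simps power2_eq_square)
        qed simp
        finally show ?thesis by simp
      qed
      have "(\<Sum>k\<in>{1..n}. 1 / real k * part_prob t k) \<le> F t"
        "F t \<le> (\<Sum>k\<in>{1..n}. 1 / real k * part_prob t k) + 1 / (real n)\<^sup>2 * (fact 1 * (2 / t) ^ Suc 1)"
        unfolding F_def using suminf_tail_bounds[OF t summable_recip_part_prob[OF t], of "1 / (real n)\<^sup>2" n 1] le part_prob_pos
        by (auto simp: less_imp_le)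
      moreover have "1 / (real n)\<^sup>2 * (fact 1 * (2 / t) ^ Suc 1) = 12 / pi\<^sup>2 * 4 * (12 / pi\<^sup>2) * t\<^sup>2"
      proof -
        have "1 / (real n)\<^sup>2 = (12 / pi\<^sup>2 * t\<^sup>2) * (12 / pi\<^sup>2 * t\<^sup>2)" unfolding nt[symmetric] by (simp add: power2_eq_square)
        then show ?thesis using t by (simp add: power_divide power2_eq_square)
      qed
      ultimately show ?case unfolding t_def[symmetric] by simp
    qed
  qed
  ultimately have "(\<lambda>n. (2 * F (saddle n) + ln (saddle n)) + (2 * (\<Sum>k\<in>{1..n}. part_prob (saddle n) k / real k) - 2 * F (saddle n)) - ln (pi / 2)) \<longlonglongrightarrow> ln (pi / 2) + 0 - ln (pi / 2)"
    by (intro tendsto_intros)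
  then have "(\<lambda>n. (2 * F (saddle n) + ln (saddle n)) + (2 * (\<Sum>k\<in>{1..n}. part_prob (saddle n) k / real k) - 2 * F (saddle n)) - ln (pi / 2)) \<longlonglongrightarrow> 0" by simp
  moreover have "\<forall>\<^sub>F n in sequentially. (2 * F (saddle n) + ln (saddle n)) + (2 * (\<Sum>k\<in>{1..n}. part_prob (saddle n) k / real k) - 2 * F (saddle n)) - ln (pi / 2)
     = 2 * (\<Sum>k\<in>{1..n}. part_prob (saddle n) k / real k) - ln (sqrt (3 * real n))"
    using eventually_ge_at_top[of 1]
  proof eventually_elim
    case (elim n)
    have "saddle n = (pi / 2) / sqrt (3 * real n)" unfolding saddle_def by simp
    then have "ln (saddle n) = ln (pi / 2) - ln (sqrt (3 * real n))" using elim by (simp add: ln_div ln_mult)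
    then show ?case by simp
  qed
  ultimately show ?thesis by (rule Lim_transform_eventually)
qed

section \<open>The limit of the product of centered factors\<close>

lemma summable_recip_powers: "summable (\<lambda>k. \<bar>2 * v / real k\<bar> ^ 3 + (2 * v / real k)\<^sup>2)"
proof -
  have "summable (\<lambda>k. \<bar>2 * v\<bar> ^ 3 * inverse (real k ^ 3) + (2 * v)\<^sup>2 * inverse (real k ^ 2))"
    using inverse_power_summable[of 3, where ?'a = real] inverse_power_summable[of 2, where ?'a = real]
    by (intro summable_add summable_mult) simp_all
  then show ?thesis by (simp add: power_divide divide_inverse power_mult_distrib power_inverse abs_mult)
qed

text \<open>The constants are \<open>17 ^ 3 * 3! * 2 ^ 4\<close>, \<open>17 * 2\<close> and \<open>17 ^ 4 * 4! * 2 ^ 5\<close>.\<close>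

lemma size_fluctuation_error_le:
  assumes t: "0 < t" "t \<le> 1" "1 / t \<le> real n"
  defines "\<sigma> \<equiv> sqrt (size_var t n)"
  shows "(\<Sum>k\<in>{1..n}. part_var t k *
        (\<bar>u * real k / \<sigma>\<bar> ^ 3 + \<bar>(2 * v / real k) * (u * real k / \<sigma>)\<bar> + (u * real k / \<sigma>) ^ 4))
     \<le> \<bar>u\<bar> ^ 3 * (471648 * sqrt t) + \<bar>2 * v * u\<bar> * (34 * sqrt t) + u ^ 4 * (64144128 * (sqrt t)\<^sup>2)"
proof -
  define q where "q = sqrt t"
  have q: "0 < q" "t = q\<^sup>2" using t by (auto simp: q_def)
  have "n \<ge> 1" using t by (cases n) (auto simp: field_simps)
  then have \<sigma>: "0 < \<sigma>" unfolding \<sigma>_def using size_var_pos[OF t(1), of n] by simp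
  have i\<sigma>: "1 / \<sigma> \<le> 17 * q ^ 3" using inverse_sqrt_size_var_le[OF t] unfolding \<sigma>_def q_def .
  have pw: "(\<Sum>k\<in>{1..n}. real k ^ a * part_var t k) \<le> fact a * (2 / q\<^sup>2) ^ Suc a" for a
  proof -
    have "(\<Sum>k\<in>{1..n}. real k ^ a * part_var t k) \<le> (\<Sum>k\<in>{1..n}. real k ^ a * exp (- (t * real k)))"
      by (intro sum_mono mult_left_mono part_var_le_exp) auto
    also have "\<dots> \<le> fact a * (2 / t) ^ Suc a" by (rule sum_power_mult_exp_le[OF t(1)])
    finally show ?thesis unfolding q(2) .
  qed
  have c: "(1 / \<sigma>) ^ a * (\<Sum>k\<in>{1..n}. real k ^ b * part_var t k) \<le> (17 * q ^ 3) ^ a * (fact b * (2 / q\<^sup>2) ^ Suc b)" for a b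
    using \<sigma> i\<sigma> q(1) part_var_pos by (intro mult_mono power_mono pw) (auto intro!: sum_nonneg simp: less_imp_le)
  have 3: "(1 / \<sigma>) ^ 3 * (\<Sum>k\<in>{1..n}. real k ^ 3 * part_var t k) \<le> 471648 * q"
    using c[of 3 3] q(1) by (simp add: fact_numeral power_divide power_mult_distrib power_mult[symmetric]) (simp add: field_simps eval_nat_numeral)
  have 1: "(1 / \<sigma>) ^ 1 * (\<Sum>k\<in>{1..n}. real k ^ 0 * part_var t k) \<le> 34 * q"
    using c[of 1 0] q(1) by (simp add: power2_eq_square power3_eq_cube)
  have 4: "(1 / \<sigma>) ^ 4 * (\<Sum>k\<in>{1..n}. real k ^ 4 * part_var t k) \<le> 64144128 * q\<^sup>2"
    using c[of 4 4] q(1) by (simp add: fact_numeral power_divide power_mult_distrib power_mult[symmetric]) (simp add: field_simps eval_nat_numeral)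
  have "(\<Sum>k\<in>{1..n}. part_var t k *
        (\<bar>u * real k / \<sigma>\<bar> ^ 3 + \<bar>(2 * v / real k) * (u * real k / \<sigma>)\<bar> + (u * real k / \<sigma>) ^ 4))
    = (\<Sum>k\<in>{1..n}. \<bar>u\<bar> ^ 3 * ((1 / \<sigma>) ^ 3 * (real k ^ 3 * part_var t k))
        + \<bar>2 * v * u\<bar> * ((1 / \<sigma>) ^ 1 * (real k ^ 0 * part_var t k))
        + u ^ 4 * ((1 / \<sigma>) ^ 4 * (real k ^ 4 * part_var t k)))"
  proof (rule sum.cong)
    fix k assume "k \<in> {1..n}"
    then have k: "real k > 0" by simp
    have "\<bar>u * real k / \<sigma>\<bar> ^ 3 = \<bar>u\<bar> ^ 3 * ((1 / \<sigma>) ^ 3 * real k ^ 3)"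
      using k \<sigma> by (simp add: abs_mult power_divide power_mult_distrib)
    moreover have "\<bar>(2 * v / real k) * (u * real k / \<sigma>)\<bar> = \<bar>2 * v * u\<bar> * (1 / \<sigma>)"
      using k \<sigma> by (simp add: abs_mult)
    moreover have "(u * real k / \<sigma>) ^ 4 = u ^ 4 * ((1 / \<sigma>) ^ 4 * real k ^ 4)"
      by (simp add: power_divide power_mult_distrib)
    ultimately show "part_var t k *
        (\<bar>u * real k / \<sigma>\<bar> ^ 3 + \<bar>(2 * v / real k) * (u * real k / \<sigma>)\<bar> + (u * real k / \<sigma>) ^ 4)
      = \<bar>u\<bar> ^ 3 * ((1 / \<sigma>) ^ 3 * (real k ^ 3 * part_var t k))
        + \<bar>2 * v * u\<bar> * ((1 / \<sigma>) ^ 1 * (real k ^ 0 * part_var t k))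
        + u ^ 4 * ((1 / \<sigma>) ^ 4 * (real k ^ 4 * part_var t k))"
      by (simp only: distrib_left) (simp add: mult_ac)
  qed simp
  also have "\<dots> = \<bar>u\<bar> ^ 3 * ((1 / \<sigma>) ^ 3 * (\<Sum>k\<in>{1..n}. real k ^ 3 * part_var t k))
        + \<bar>2 * v * u\<bar> * ((1 / \<sigma>) ^ 1 * (\<Sum>k\<in>{1..n}. real k ^ 0 * part_var t k))
        + u ^ 4 * ((1 / \<sigma>) ^ 4 * (\<Sum>k\<in>{1..n}. real k ^ 4 * part_var t k))"
    by (simp only: sum.distrib sum_distrib_left)
  also have "\<dots> \<le> \<bar>u\<bar> ^ 3 * (471648 * q) + \<bar>2 * v * u\<bar> * (34 * q) + u ^ 4 * (64144128 * q\<^sup>2)"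
    by (intro add_mono mult_left_mono 3 1 4) auto
  finally show ?thesis unfolding q_def .
qed

lemma part_prob_saddle_tendsto: "(\<lambda>n. part_prob (saddle n) k) \<longlonglongrightarrow> 1 / 2"
proof -
  have "(\<lambda>n. 1 / (exp (saddle n * real k) + 1)) \<longlonglongrightarrow> 1 / (exp (0 * real k) + 1)"
    by (intro tendsto_intros saddle_tendsto_0) simp
  then show ?thesis unfolding part_prob_def by simp
qed

text \<open>All factors have norm at most 1, so two products differ by at most the sum of the
  factorwise differences. That sum vanishes by domination: the pointwise limit handles each fixed
  part, and \<open>size_fluctuation_error_le\<close> handles the remainder uniformly.\<close>

lemma centered_prod_tendsto:
  assumes \<phi>: "(\<lambda>n. \<Prod>k\<in>{1..n}. complex_of_real (cos (v / real k))) \<longlonglongrightarrow> \<phi>"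
  shows "(\<lambda>n. \<Prod>k\<in>{1..n}. centered_factor (part_prob (saddle n) k) (phase (saddle n) n v u k))
     \<longlonglongrightarrow> \<phi> * of_real (exp (- (u\<^sup>2 / 2)))"
proof -
  define \<sigma> where "\<sigma> n = sqrt (size_var (saddle n) n)" for n
  define \<alpha> where "\<alpha> k = 2 * v / real k" for k :: nat
  define \<beta> where "\<beta> n k = u * real k / \<sigma> n" for n k :: nat
  define s where "s n k = part_var (saddle n) k" for n k
  define C where "C n k = centered_factor (part_prob (saddle n) k) (phase (saddle n) n v u k)" for n k
  define T where "T n k = complex_of_real (cos (\<alpha> k / 2) * exp (- ((\<beta> n k)\<^sup>2 * s n k / 2)))" for n k
  define e where "e n k = s n k * (\<bar>\<beta> n k\<bar> ^ 3 + \<bar>\<alpha> k * \<beta> n k\<bar> + \<beta> n k ^ 4)" for n k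
  have C: "C n k = centered_factor (part_prob (saddle n) k) (\<alpha> k + \<beta> n k)" for n k
    unfolding C_def phase_def \<alpha>_def \<beta>_def \<sigma>_def ..
  have p: "0 \<le> part_prob (saddle n) k" "part_prob (saddle n) k \<le> 1" for n k
    using part_prob_pos[of "saddle n" k] part_prob_lt_1[of "saddle n" k] by auto
  have s: "0 \<le> s n k" "s n k \<le> 1 / 4" for n k
    unfolding s_def using part_var_pos[of "saddle n" k] part_var_le[of "saddle n" k] by auto
  have \<beta>0: "(\<lambda>n. \<beta> n k) \<longlonglongrightarrow> 0" for k
  proof -
    have "(\<lambda>n. u * real k * (1 / \<sigma> n)) \<longlonglongrightarrow> u * real k * 0"
      unfolding \<sigma>_def by (intro tendsto_intros inverse_sigma_tendsto_0)
    then show ?thesis unfolding \<beta>_def by simp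
  qed
  have lim_diff: "(\<lambda>n. \<Sum>k\<in>{1..n}. norm (C n k - T n k)) \<longlonglongrightarrow> 0"
  proof (rule sum_tendsto_0_if_dominated[where b = "\<lambda>k. \<bar>\<alpha> k\<bar> ^ 3 + (\<alpha> k)\<^sup>2" and e = e])
    show "summable (\<lambda>k. \<bar>\<alpha> k\<bar> ^ 3 + (\<alpha> k)\<^sup>2)"
      unfolding \<alpha>_def by (rule summable_recip_powers)
    fix n k
    show "norm (C n k - T n k) \<le> \<bar>\<alpha> k\<bar> ^ 3 + (\<alpha> k)\<^sup>2 + e n k"
      unfolding C T_def e_def s_def part_var_def by (rule centered_factor_diff_le[OF p])
    show "0 \<le> e n k" unfolding e_def using s by (intro mult_nonneg_nonneg add_nonneg_nonneg) auto
  next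
    fix k :: nat
    \<comment> \<open>For fixed \<open>k\<close> the probability tends to 1/2 and the size phase to
      0. The centered fair coin with phase \<alpha> has characteristic function
      \<open>cos (\<alpha> / 2)\<close>, which is also the limit of \<open>T\<close>.\<close>
    have C1: "(\<lambda>n. C n k) \<longlonglongrightarrow> complex_of_real (1 - 1 / 2) * iexp (- ((\<alpha> k + 0) * (1 / 2))) + complex_of_real (1 / 2) * iexp ((\<alpha> k + 0) * (1 - 1 / 2))"
      unfolding C centered_factor_def by (intro tendsto_intros \<beta>0 part_prob_saddle_tendsto)
    have C2: "complex_of_real (1 - 1 / 2) * iexp (- ((\<alpha> k + 0) * (1 / 2))) + complex_of_real (1 / 2) * iexp ((\<alpha> k + 0) * (1 - 1 / 2)) = of_real (cos (\<alpha> k / 2))"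
      by (rule complex_eqI) (auto simp: Re_exp Im_exp)
    have "(\<lambda>n. (\<beta> n k)\<^sup>2 * s n k) \<longlonglongrightarrow> 0"
    proof (rule Lim_null_comparison)
      show "(\<lambda>n. (\<beta> n k)\<^sup>2) \<longlonglongrightarrow> 0" using tendsto_power[OF \<beta>0, of k 2] by simp
      have "(\<beta> n k)\<^sup>2 * s n k \<le> (\<beta> n k)\<^sup>2 * 1" for n using s[of n k] by (intro mult_left_mono) auto
      then show "\<forall>\<^sub>F n in sequentially. norm ((\<beta> n k)\<^sup>2 * s n k) \<le> (\<beta> n k)\<^sup>2"
        using s by (intro always_eventually) auto
    qed
    then have "(\<lambda>n. T n k) \<longlonglongrightarrow> complex_of_real (cos (\<alpha> k / 2) * exp (- (0 / 2)))"
      unfolding T_def by (intro tendsto_intros) auto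
    then have "(\<lambda>n. norm (C n k - T n k)) \<longlonglongrightarrow> norm (complex_of_real (cos (\<alpha> k / 2)) - complex_of_real (cos (\<alpha> k / 2) * exp (- (0 / 2))))"
      using C1 unfolding C2 by (intro tendsto_intros)
    then show "(\<lambda>n. norm (C n k - T n k)) \<longlonglongrightarrow> 0" by simp
  next
    have "(\<lambda>n. \<bar>u\<bar> ^ 3 * (471648 * sqrt (saddle n)) + \<bar>2 * v * u\<bar> * (34 * sqrt (saddle n)) + u ^ 4 * (64144128 * (sqrt (saddle n))\<^sup>2))
       \<longlonglongrightarrow> \<bar>u\<bar> ^ 3 * (471648 * sqrt 0) + \<bar>2 * v * u\<bar> * (34 * sqrt 0) + u ^ 4 * (64144128 * (sqrt 0)\<^sup>2)"
      by (intro tendsto_intros saddle_tendsto_0)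
    then have l: "(\<lambda>n. \<bar>u\<bar> ^ 3 * (471648 * sqrt (saddle n)) + \<bar>2 * v * u\<bar> * (34 * sqrt (saddle n)) + u ^ 4 * (64144128 * (sqrt (saddle n))\<^sup>2)) \<longlonglongrightarrow> 0"
      by simp
    show "(\<lambda>n. \<Sum>k\<in>{1..n}. e n k) \<longlonglongrightarrow> 0"
    proof (rule Lim_null_comparison[OF _ l])
      show "\<forall>\<^sub>F n in sequentially. norm (\<Sum>k\<in>{1..n}. e n k) \<le> \<bar>u\<bar> ^ 3 * (471648 * sqrt (saddle n)) + \<bar>2 * v * u\<bar> * (34 * sqrt (saddle n)) + u ^ 4 * (64144128 * (sqrt (saddle n))\<^sup>2)"
        using eventually_saddle_small
      proof eventually_elim
        case (elim n)
        have "0 \<le> (\<Sum>k\<in>{1..n}. e n k)"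
          unfolding e_def using s by (intro sum_nonneg mult_nonneg_nonneg add_nonneg_nonneg) auto
        moreover have "(\<Sum>k\<in>{1..n}. e n k) \<le> \<bar>u\<bar> ^ 3 * (471648 * sqrt (saddle n)) + \<bar>2 * v * u\<bar> * (34 * sqrt (saddle n)) + u ^ 4 * (64144128 * (sqrt (saddle n))\<^sup>2)"
          unfolding e_def s_def \<alpha>_def \<beta>_def \<sigma>_def using elim by (intro size_fluctuation_error_le) auto
        ultimately show ?case by simp
      qed
    qed
  qed auto
  have diff_le: "norm ((\<Prod>k\<in>{1..n}. C n k) - (\<Prod>k\<in>{1..n}. T n k)) \<le> (\<Sum>k\<in>{1..n}. norm (C n k - T n k))" for n
  proof (rule norm_prod_diff)
    fix k
    show "norm (C n k) \<le> 1" unfolding C by (rule norm_centered_factor_le_1[OF p])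
    have "\<bar>cos (\<alpha> k / 2)\<bar> * exp (- ((\<beta> n k)\<^sup>2 * s n k / 2)) \<le> 1 * 1"
      using s by (intro mult_mono) auto
    then show "norm (T n k) \<le> 1" unfolding T_def norm_of_real by (simp add: abs_mult)
  qed
  have "(\<lambda>n. (\<Prod>k\<in>{1..n}. C n k) - (\<Prod>k\<in>{1..n}. T n k)) \<longlonglongrightarrow> 0"
    by (rule Lim_null_comparison[OF always_eventually[OF allI[OF diff_le]] lim_diff])
  moreover have "(\<lambda>n. \<Prod>k\<in>{1..n}. T n k) \<longlonglongrightarrow> \<phi> * of_real (exp (- (u\<^sup>2 / 2)))"
  proof -
    have "(\<lambda>n. (\<Prod>k\<in>{1..n}. complex_of_real (cos (v / real k))) * of_real (exp (- (u\<^sup>2 / 2)))) \<longlonglongrightarrow> \<phi> * of_real (exp (- (u\<^sup>2 / 2)))"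
      by (intro tendsto_intros \<phi>)
    moreover have "\<forall>\<^sub>F n in sequentially. (\<Prod>k\<in>{1..n}. complex_of_real (cos (v / real k))) * of_real (exp (- (u\<^sup>2 / 2))) = (\<Prod>k\<in>{1..n}. T n k)"
      using eventually_saddle_small
    proof eventually_elim
      case (elim n)
      have V: "0 < size_var (saddle n) n" using elim by (intro size_var_pos) auto
      \<comment> \<open>Since \<beta> is normalized by the standard deviation, the Gaussian
        exponents add up to \<open>u\<^sup>2 / 2\<close> exactly, not only in the limit.\<close>
      have "(\<Sum>k\<in>{1..n}. (\<beta> n k)\<^sup>2 * s n k / 2) = (\<Sum>k\<in>{1..n}. u\<^sup>2 / 2 / size_var (saddle n) n * ((real k)\<^sup>2 * part_var (saddle n) k))"
        unfolding \<beta>_def s_def \<sigma>_def using V by (intro sum.cong) (auto simp: power_divide power_mult_distrib)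
      also have "\<dots> = u\<^sup>2 / 2 / size_var (saddle n) n * size_var (saddle n) n"
        unfolding size_var_def by (simp only: sum_distrib_left)
      also have "\<dots> = u\<^sup>2 / 2" using V by simp
      finally have "exp (- (u\<^sup>2 / 2)) = (\<Prod>k\<in>{1..n}. exp (- ((\<beta> n k)\<^sup>2 * s n k / 2)))"
        by (subst exp_sum[symmetric]) (simp_all add: sum_negf)
      then show ?case unfolding T_def \<alpha>_def by (simp add: prod.distrib)
    qed
    ultimately show ?thesis by (rule Lim_transform_eventually)
  qed
  ultimately have "(\<lambda>n. ((\<Prod>k\<in>{1..n}. C n k) - (\<Prod>k\<in>{1..n}. T n k)) + (\<Prod>k\<in>{1..n}. T n k)) \<longlonglongrightarrow> 0 + \<phi> * of_real (exp (- (u\<^sup>2 / 2)))"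
    by (rule tendsto_add)
  then show ?thesis unfolding C_def by simp
qed

section \<open>Fourier inversion over partitions of fixed size\<close>

text \<open>Orthogonality of characters on one period, stretched by \<sigma>; it extracts the sets
  of size exactly \<open>n\<close>.\<close>

lemma has_bochner_integral_iexp_period:
  fixes \<sigma> :: real and j :: int
  assumes "\<sigma> > 0"
  shows "has_bochner_integral lborel (\<lambda>u. indicator {- (pi * \<sigma>)..pi * \<sigma>} u *\<^sub>R iexp (u * (of_int j / \<sigma>)))
     (if j = 0 then of_real (2 * pi * \<sigma>) else 0)"
proof (cases "j = 0")
  case True
  have "has_bochner_integral lborel (\<lambda>u. indicat_real {- (pi * \<sigma>)..pi * \<sigma>} u *\<^sub>R (1::complex))
      (measure lborel {- (pi * \<sigma>)..pi * \<sigma>} *\<^sub>R 1)"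
    using assms by (intro has_bochner_integral_scaleR_left has_bochner_integral_real_indicator) (auto simp: emeasure_lborel_Icc_eq)
  then show ?thesis using True assms by (simp add: scaleR_conv_of_real mult.assoc)
next
  case False
  define c where "c = of_int j / \<sigma>"
  have c: "c \<noteq> 0" using False assms by (simp add: c_def)
  have "has_bochner_integral lborel (\<lambda>u. indicator {- (pi * \<sigma>)..pi * \<sigma>} u *\<^sub>R iexp (u * c))
      (- \<i> / of_real c * iexp (pi * \<sigma> * c) - (- \<i> / of_real c * iexp (- (pi * \<sigma>) * c)))"
  proof (rule has_bochner_integral_FTC_Icc)
    show "- (pi * \<sigma>) \<le> pi * \<sigma>" using assms by simp
    show "continuous_on {- (pi * \<sigma>)..pi * \<sigma>} (\<lambda>u. iexp (u * c))" by (intro continuous_intros)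
    fix x
    show "((\<lambda>u. - \<i> / of_real c * iexp (u * c)) has_vector_derivative iexp (x * c)) (at x within {- (pi * \<sigma>)..pi * \<sigma>})"
    proof -
      have "((\<lambda>u. - \<i> / of_real c * exp (\<i> * (u * of_real c))) has_field_derivative exp (\<i> * (of_real x * of_real c))) (at (of_real x))"
        using c by (auto intro!: derivative_eq_intros)
      from has_vector_derivative_real_field[OF this] show ?thesis by simp
    qed
  qed
  moreover have "iexp (pi * \<sigma> * c) = iexp (- (pi * \<sigma>) * c)"
  proof -
    have "pi * \<sigma> * c = of_int j * pi" using assms by (simp add: c_def)
    then have "sin (pi * \<sigma> * c) = 0" by (auto simp: sin_zero_iff_int2)
    then show ?thesis by (simp add: complex_eq_iff Re_exp Im_exp)
  qed
  ultimately show ?thesis using False by (simp add: c_def)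
qed

text \<open>From \<open>p = (1 - p) exp (- t k)\<close>, each factor is \<open>1 - p\<close> times
  \<open>1 + exp (- t k + i w)\<close>. Expanding the product gives a set \<open>A\<close> a weight
  that depends only on its sum, which is why conditioning on the size yields the uniform
  measure.\<close>

lemma joint_char_expand:
  fixes t :: real and n :: nat
  defines "\<sigma> \<equiv> sqrt (size_var t n)"
  shows "joint_char t n v u * iexp (- (u * real n / \<sigma>)) =
    of_real (\<Prod>k\<in>{1..n}. 1 - part_prob t k) *
    (\<Sum>A\<in>Pow {1..n}. of_real (exp (- (t * real (\<Sum>A)))) * iexp (2 * v * (\<Sum>k\<in>A. 1 / real k))
        * iexp (u * (of_int (int (\<Sum>A) - int n) / \<sigma>)))"
proof -
  have fac: "1 - of_real (part_prob t k) + of_real (part_prob t k) * iexp w =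
     of_real (1 - part_prob t k) * (exp (of_real (- (t * real k)) + \<i> * of_real w) + 1)" for k w
  proof -
    have "part_prob t k = (1 - part_prob t k) * exp (- (t * real k))"
    proof -
      have "x / (1 + x) = (1 - x / (1 + x)) * x" if "0 < x" for x :: real
        using that by (simp add: field_simps)
      from this[OF exp_gt_zero] show ?thesis unfolding part_prob_eq .
    qed
    then have "complex_of_real (part_prob t k) = complex_of_real ((1 - part_prob t k) * exp (- (t * real k)))" by (rule arg_cong)
    then have "complex_of_real (part_prob t k) = (1 - complex_of_real (part_prob t k)) * of_real (exp (- (t * real k)))"
      by (simp only: of_real_mult of_real_diff of_real_1)
    moreover have "exp (of_real (- (t * real k)) + \<i> * of_real w) = of_real (exp (- (t * real k))) * iexp w"
      by (simp only: exp_add exp_of_real)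
    ultimately show ?thesis by (simp only: of_real_diff of_real_1) algebra
  qed
  have "joint_char t n v u = of_real (\<Prod>k\<in>{1..n}. 1 - part_prob t k) *
     (\<Prod>k\<in>{1..n}. exp (of_real (- (t * real k)) + \<i> * of_real (phase t n v u k)) + 1)"
    unfolding joint_char_def fac by (simp add: prod.distrib)
  also have "(\<Prod>k\<in>{1..n}. exp (of_real (- (t * real k)) + \<i> * of_real (phase t n v u k)) + 1)
     = (\<Sum>A\<in>Pow {1..n}. \<Prod>k\<in>A. exp (of_real (- (t * real k)) + \<i> * of_real (phase t n v u k)))"
    by (subst prod_add) auto
  also have "\<dots> = (\<Sum>A\<in>Pow {1..n}. exp (of_real (- (t * real (\<Sum>A))) + \<i> * of_real (2 * v * (\<Sum>k\<in>A. 1 / real k) + u * real (\<Sum>A) / \<sigma>)))"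
  proof (rule sum.cong)
    fix A assume "A \<in> Pow {1..n}"
    then have fin: "finite A" using finite_subset by auto
    have ph: "(\<Sum>k\<in>A. phase t n v u k) = 2 * v * (\<Sum>k\<in>A. 1 / real k) + u * real (\<Sum>A) / \<sigma>"
      unfolding phase_def \<sigma>_def[symmetric] by (simp add: sum.distrib sum_distrib_left sum_divide_distrib)
    have ts: "(\<Sum>k\<in>A. - (t * real k)) = - (t * real (\<Sum>A))"
      by (simp add: sum_negf sum_distrib_left)
    have "(\<Prod>k\<in>A. exp (of_real (- (t * real k)) + \<i> * of_real (phase t n v u k)))
      = exp (\<Sum>k\<in>A. of_real (- (t * real k)) + \<i> * of_real (phase t n v u k))"
      using fin by (rule exp_sum[symmetric])
    also have "(\<Sum>k\<in>A. of_real (- (t * real k)) + \<i> * of_real (phase t n v u k))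
      = of_real (\<Sum>k\<in>A. - (t * real k)) + \<i> * of_real (\<Sum>k\<in>A. phase t n v u k)"
      by (simp only: sum.distrib of_real_sum sum_distrib_left)
    finally show "(\<Prod>k\<in>A. exp (of_real (- (t * real k)) + \<i> * of_real (phase t n v u k)))
      = exp (of_real (- (t * real (\<Sum>A))) + \<i> * of_real (2 * v * (\<Sum>k\<in>A. 1 / real k) + u * real (\<Sum>A) / \<sigma>))"
      unfolding ph ts .
  qed simp
  finally have expand: "joint_char t n v u * iexp (- (u * real n / \<sigma>)) = of_real (\<Prod>k\<in>{1..n}. 1 - part_prob t k) *
     (\<Sum>A\<in>Pow {1..n}. exp (of_real (- (t * real (\<Sum>A))) + \<i> * of_real (2 * v * (\<Sum>k\<in>A. 1 / real k) + u * real (\<Sum>A) / \<sigma>)) * iexp (- (u * real n / \<sigma>)))"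
    by (simp only: mult.assoc sum_distrib_right)
  have summand: "exp (of_real (- (t * real (\<Sum>A))) + \<i> * of_real (2 * v * (\<Sum>k\<in>A. 1 / real k) + u * real (\<Sum>A) / \<sigma>)) * iexp (- (u * real n / \<sigma>))
     = of_real (exp (- (t * real (\<Sum>A)))) * iexp (2 * v * (\<Sum>k\<in>A. 1 / real k)) * iexp (u * (of_int (int (\<Sum>A) - int n) / \<sigma>))" for A
  proof -
    have "of_real (2 * v * (\<Sum>k\<in>A. 1 / real k) + u * real (\<Sum>A) / \<sigma>) + of_real (- (u * real n / \<sigma>))
       = complex_of_real (2 * v * (\<Sum>k\<in>A. 1 / real k)) + of_real (u * (of_int (int (\<Sum>A) - int n) / \<sigma>))"
      unfolding of_real_add[symmetric] by (simp add: right_diff_distrib diff_divide_distrib)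
    then show ?thesis
      by (simp only: exp_of_real[symmetric] exp_add[symmetric] distrib_left[symmetric] add.assoc)
  qed
  show ?thesis unfolding expand summand ..
qed

definition distinct_part_sets :: "nat \<Rightarrow> nat set set" where
  "distinct_part_sets n = {A \<in> Pow {1..n}. \<Sum>A = n}"

text \<open>Integration over \<open>u\<close> annihilates every set whose sum is not
  \<open>n\<close>. The prefactor contains neither \<open>v\<close> nor \<open>L\<close>, so it
  cancels in the quotient of two such integrals.\<close>

lemma has_bochner_integral_joint_char:
  fixes t L :: real and n :: nat
  assumes "0 < t" "n \<ge> 1"
  defines "\<sigma> \<equiv> sqrt (size_var t n)"
  shows "has_bochner_integral lborel
    (\<lambda>u. indicator {- (pi * \<sigma>)..pi * \<sigma>} u *\<^sub>R (joint_char t n v u * iexp (- (u * real n / \<sigma>)) * iexp (- (v * L))))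
    (of_real ((\<Prod>k\<in>{1..n}. 1 - part_prob t k) * exp (- (t * real n)) * (2 * pi * \<sigma>))
      * (\<Sum>A\<in>distinct_part_sets n. iexp (v * (2 * (\<Sum>k\<in>A. 1 / real k) - L))))"
proof -
  define Q where "Q = complex_of_real (\<Prod>k\<in>{1..n}. 1 - part_prob t k)"
  define I where "I u = indicat_real {- (pi * \<sigma>)..pi * \<sigma>} u" for u
  define g where "g A = of_real (exp (- (t * real (\<Sum>A)))) * iexp (2 * v * (\<Sum>k\<in>A. 1 / real k)) * iexp (- (v * L))" for A :: "nat set"
  have \<sigma>: "\<sigma> > 0" unfolding \<sigma>_def using size_var_pos[OF assms(1,2)] by simp
  have "has_bochner_integral lborel (\<lambda>u. Q * (\<Sum>A\<in>Pow {1..n}. g A * (I u *\<^sub>R iexp (u * (of_int (int (\<Sum>A) - int n) / \<sigma>)))))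
     (Q * (\<Sum>A\<in>Pow {1..n}. g A * (if int (\<Sum>A) - int n = 0 then of_real (2 * pi * \<sigma>) else 0)))"
    unfolding I_def by (intro has_bochner_integral_mult_right has_bochner_integral_sum has_bochner_integral_iexp_period \<sigma>)
  moreover have "(\<lambda>u. Q * (\<Sum>A\<in>Pow {1..n}. g A * (I u *\<^sub>R iexp (u * (of_int (int (\<Sum>A) - int n) / \<sigma>)))))
     = (\<lambda>u. I u *\<^sub>R (joint_char t n v u * iexp (- (u * real n / \<sigma>)) * iexp (- (v * L))))"
  proof
    fix u
    show "Q * (\<Sum>A\<in>Pow {1..n}. g A * (I u *\<^sub>R iexp (u * (of_int (int (\<Sum>A) - int n) / \<sigma>))))
      = I u *\<^sub>R (joint_char t n v u * iexp (- (u * real n / \<sigma>)) * iexp (- (v * L)))"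
      unfolding \<sigma>_def joint_char_expand unfolding \<sigma>_def[symmetric] Q_def[symmetric] g_def scaleR_conv_of_real
      by (simp only: sum_distrib_left sum_distrib_right mult_ac)
  qed
  moreover have "Q * (\<Sum>A\<in>Pow {1..n}. g A * (if int (\<Sum>A) - int n = 0 then of_real (2 * pi * \<sigma>) else 0))
    = of_real ((\<Prod>k\<in>{1..n}. 1 - part_prob t k) * exp (- (t * real n)) * (2 * pi * \<sigma>))
      * (\<Sum>A\<in>distinct_part_sets n. iexp (v * (2 * (\<Sum>k\<in>A. 1 / real k) - L)))"
  proof -
    have "(\<Sum>A\<in>Pow {1..n}. g A * (if int (\<Sum>A) - int n = 0 then of_real (2 * pi * \<sigma>) else 0))
      = (\<Sum>A\<in>distinct_part_sets n. g A * of_real (2 * pi * \<sigma>))"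
      unfolding distinct_part_sets_def by (rule sum.mono_neutral_cong_right) (auto simp del: of_nat_sum)
    also have "\<dots> = (\<Sum>A\<in>distinct_part_sets n. of_real (exp (- (t * real n)) * (2 * pi * \<sigma>)) * iexp (v * (2 * (\<Sum>k\<in>A. 1 / real k) - L)))"
    proof (rule sum.cong)
      fix A assume "A \<in> distinct_part_sets n"
      then have A: "\<Sum>A = n" unfolding distinct_part_sets_def by auto
      have "iexp (2 * v * (\<Sum>k\<in>A. 1 / real k)) * iexp (- (v * L)) = iexp (v * (2 * (\<Sum>k\<in>A. 1 / real k) - L))"
        unfolding exp_add[symmetric] distrib_left[symmetric] of_real_add[symmetric] by (simp add: algebra_simps)
      then show "g A * of_real (2 * pi * \<sigma>) = of_real (exp (- (t * real n)) * (2 * pi * \<sigma>)) * iexp (v * (2 * (\<Sum>k\<in>A. 1 / real k) - L))"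
        unfolding g_def A mult.assoc by (simp only: of_real_mult mult_ac)
    qed simp
    finally show ?thesis unfolding Q_def by (simp only: sum_distrib_left of_real_mult mult_ac)
  qed
  ultimately show ?thesis unfolding I_def by (simp only:)
qed

section \<open>From sets of parts back to decreasing lists\<close>

lemma bij_betw_distinct_partitions:
  "bij_betw set (distinct_partitions n) (distinct_part_sets n)"
proof (rule bij_betw_imageI)
  have strict: "sorted_wrt (<) (rev ps)" if "ps \<in> distinct_partitions n" for ps
    using that unfolding distinct_partitions_def by (simp add: sorted_wrt_rev)
  show "inj_on set (distinct_partitions n)"
  proof (rule inj_onI)
    fix xs ys assume "xs \<in> distinct_partitions n" "ys \<in> distinct_partitions n" "set xs = set ys"
    then have "rev xs = rev ys" by (intro strict_sorted_equal strict) auto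
    then show "xs = ys" by simp
  qed
  show "set ` distinct_partitions n = distinct_part_sets n"
  proof (intro equalityI subsetI)
    fix A assume "A \<in> set ` distinct_partitions n"
    then obtain ps where ps: "ps \<in> distinct_partitions n" "A = set ps" by auto
    have d: "distinct ps" using strict[OF ps(1)] strict_sorted_iff[of "rev ps"] by simp
    have s: "\<Sum>(set ps) = sum_list ps" using d by (simp add: sum_list_distinct_conv_sum_set[of ps "\<lambda>x. x", simplified])
    show "A \<in> distinct_part_sets n"
      using ps s member_le_sum_list[of _ ps] unfolding distinct_part_sets_def distinct_partitions_def by (auto simp: Suc_le_eq)
  next
    fix A assume A: "A \<in> distinct_part_sets n"
    then have fin: "finite A" unfolding distinct_part_sets_def using finite_subset by auto
    define ps where "ps = rev (sorted_list_of_set A)"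
    have set: "set ps = A" using fin by (simp add: ps_def)
    have d: "distinct ps" by (simp add: ps_def)
    have s: "\<Sum>(set ps) = sum_list ps" using d by (simp add: sum_list_distinct_conv_sum_set[of ps "\<lambda>x. x", simplified])
    have "sorted_wrt (>) ps" unfolding ps_def by (simp add: sorted_wrt_rev)
    then have "ps \<in> distinct_partitions n"
      using A s set unfolding distinct_partitions_def distinct_part_sets_def by auto
    then show "A \<in> set ` distinct_partitions n" using set by blast
  qed
qed

lemma recip_sum_eq:
  assumes "ps \<in> distinct_partitions n"
  shows "recip_sum ps = (\<Sum>k\<in>set ps. 1 / real k)"
proof -
  have "sorted_wrt (<) (rev ps)" using assms unfolding distinct_partitions_def by (simp add: sorted_wrt_rev)
  then have "distinct ps" using strict_sorted_iff[of "rev ps"] by simp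
  then show ?thesis unfolding recip_sum_def by (rule sum_list_distinct_conv_sum_set)
qed

lemma char_partition:
  fixes L :: real
  shows "char (distr (partition_measure n) borel (\<lambda>ps. 2 * recip_sum ps - L)) v =
    (\<Sum>A\<in>distinct_part_sets n. iexp (v * (2 * (\<Sum>k\<in>A. 1 / real k) - L))) / of_nat (card (distinct_part_sets n))"
proof -
  have "char (distr (partition_measure n) borel (\<lambda>ps. 2 * recip_sum ps - L)) v
     = (CLINT ps|partition_measure n. iexp (v * (2 * recip_sum ps - L)))"
    unfolding char_def by (subst integral_distr) (auto simp: partition_measure_def)
  also have "\<dots> = (\<Sum>ps\<in>distinct_partitions n. iexp (v * (2 * recip_sum ps - L))) / of_nat (card (distinct_partitions n))"
    unfolding partition_measure_def uniform_count_measure_def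
    by (subst lebesgue_integral_point_measure_finite[OF finite_distinct_partitions])
       (auto simp: scaleR_conv_of_real sum_divide_distrib)
  also have "(\<Sum>ps\<in>distinct_partitions n. iexp (v * (2 * recip_sum ps - L)))
     = (\<Sum>ps\<in>distinct_partitions n. iexp (v * (2 * (\<Sum>k\<in>set ps. 1 / real k) - L)))"
    by (intro sum.cong) (auto simp: recip_sum_eq)
  also have "\<dots> = (\<Sum>A\<in>distinct_part_sets n. iexp (v * (2 * (\<Sum>k\<in>A. 1 / real k) - L)))"
    by (rule sum.reindex_bij_betw[OF bij_betw_distinct_partitions])
  also have "card (distinct_partitions n) = card (distinct_part_sets n)"
    by (rule bij_betw_same_card[OF bij_betw_distinct_partitions])
  finally show ?thesis .
qed

text \<open>The inversion integrand, already centered by \<open>ln (sqrt (3 n))\<close>. The growing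
  period enters as an indicator, so that all integrals run over the same line and dominated
  convergence applies.\<close>

definition fourier_kernel :: "real \<Rightarrow> nat \<Rightarrow> real \<Rightarrow> complex" where
  "fourier_kernel v n u = (let t = saddle n; \<sigma> = sqrt (size_var t n) in
     indicator {- (pi * \<sigma>)..pi * \<sigma>} u *\<^sub>R
       (joint_char t n v u * iexp (- (u * real n / \<sigma>)) * iexp (- (v * ln (sqrt (3 * real n))))))"

text \<open>Splitting off the means leaves a single phase. After the centering in
  \<open>fourier_kernel\<close> it becomes \<open>v\<close> and \<open>u\<close> times the two
  quantities shown to vanish in \<open>mean_recip_tendsto\<close> and
  \<open>mean_size_tendsto\<close>.\<close>

lemma joint_char_eq_centered:
  "joint_char t n v u = (\<Prod>k\<in>{1..n}. centered_factor (part_prob t k) (phase t n v u k)) *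
     iexp (v * (2 * (\<Sum>k\<in>{1..n}. part_prob t k / real k))
        + u * (\<Sum>k\<in>{1..n}. real k * part_prob t k) / sqrt (size_var t n))"
proof -
  have "(\<Sum>k\<in>{1..n}. phase t n v u k * part_prob t k) =
     v * (2 * (\<Sum>k\<in>{1..n}. part_prob t k / real k)) + u * (\<Sum>k\<in>{1..n}. real k * part_prob t k) / sqrt (size_var t n)"
  proof -
    have "phase t n v u k * part_prob t k = v * (2 * (part_prob t k / real k)) + u * (real k * part_prob t k) / sqrt (size_var t n)" for k
      by (simp only: phase_def distrib_right) (simp add: mult_ac)
    then show ?thesis by (simp only: sum.distrib sum_distrib_left sum_divide_distrib)
  qed
  moreover have "(\<Prod>k\<in>{1..n}. iexp (phase t n v u k * part_prob t k)) = iexp (\<Sum>k\<in>{1..n}. phase t n v u k * part_prob t k)"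
    by (subst exp_sum[symmetric]) (simp_all add: sum_distrib_left)
  ultimately show ?thesis
    unfolding joint_char_def centered_factor_shift prod.distrib by simp
qed

lemma fourier_kernel_tendsto:
  assumes \<phi>: "(\<lambda>n. \<Prod>k\<in>{1..n}. complex_of_real (cos (v / real k))) \<longlonglongrightarrow> \<phi>"
  shows "(\<lambda>n. fourier_kernel v n u) \<longlonglongrightarrow> \<phi> * of_real (exp (- (u\<^sup>2 / 2)))"
proof -
  define \<sigma> where "\<sigma> n = sqrt (size_var (saddle n) n)" for n
  define L where "L n = ln (sqrt (3 * real n))" for n :: nat
  define P where "P n = (\<Prod>k\<in>{1..n}. centered_factor (part_prob (saddle n) k) (phase (saddle n) n v u k))" for n
  define S where "S n = 2 * (\<Sum>k\<in>{1..n}. part_prob (saddle n) k / real k)" for n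
  define N where "N n = (\<Sum>k\<in>{1..n}. real k * part_prob (saddle n) k)" for n
  have "(\<lambda>n. P n * iexp (v * (S n - L n) + u * ((N n - real n) / \<sigma> n)))
     \<longlonglongrightarrow> (\<phi> * of_real (exp (- (u\<^sup>2 / 2)))) * iexp (v * 0 + u * 0)"
    unfolding P_def S_def L_def N_def \<sigma>_def
    by (intro tendsto_intros centered_prod_tendsto[OF \<phi>] mean_recip_tendsto mean_size_tendsto)
  then have "(\<lambda>n. P n * iexp (v * (S n - L n) + u * ((N n - real n) / \<sigma> n)))
     \<longlonglongrightarrow> \<phi> * of_real (exp (- (u\<^sup>2 / 2)))" by simp
  moreover have "\<forall>\<^sub>F n in sequentially. P n * iexp (v * (S n - L n) + u * ((N n - real n) / \<sigma> n)) = fourier_kernel v n u"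
  proof -
    \<comment> \<open>As \<sigma> tends to infinity, each fixed \<open>u\<close> eventually lies
      inside the period and the indicator is 1.\<close>
    have "(\<lambda>n. \<bar>u\<bar> * (1 / \<sigma> n)) \<longlonglongrightarrow> \<bar>u\<bar> * 0"
      unfolding \<sigma>_def by (intro tendsto_intros inverse_sigma_tendsto_0)
    then have "\<forall>\<^sub>F n in sequentially. \<bar>u\<bar> * (1 / \<sigma> n) < pi"
      by (intro order_tendstoD(2)) auto
    then show ?thesis using eventually_saddle_small
    proof eventually_elim
      case (elim n)
      have \<sigma>: "0 < \<sigma> n" unfolding \<sigma>_def using elim size_var_pos[of "saddle n" n] by simp
      have "\<bar>u\<bar> < pi * \<sigma> n" using elim(1) \<sigma> by (simp add: field_simps)
      then have ind: "indicator {- (pi * \<sigma> n)..pi * \<sigma> n} u = (1::real)" by (auto simp: indicator_def)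
      have "fourier_kernel v n u = joint_char (saddle n) n v u * iexp (- (u * real n / \<sigma> n)) * iexp (- (v * L n))"
        unfolding fourier_kernel_def Let_def \<sigma>_def[symmetric] L_def[symmetric] ind by simp
      also have "joint_char (saddle n) n v u = P n * iexp (v * S n + u * N n / \<sigma> n)"
        unfolding joint_char_eq_centered P_def S_def N_def \<sigma>_def ..
      also have "P n * iexp (v * S n + u * N n / \<sigma> n) * iexp (- (u * real n / \<sigma> n)) * iexp (- (v * L n))
        = P n * iexp ((v * S n + u * N n / \<sigma> n) + (- (u * real n / \<sigma> n)) + (- (v * L n)))"
        by (simp only: exp_add of_real_add distrib_left mult.assoc)
      also have "(v * S n + u * N n / \<sigma> n) + (- (u * real n / \<sigma> n)) + (- (v * L n)) = v * (S n - L n) + u * ((N n - real n) / \<sigma> n)"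
        by (simp add: algebra_simps diff_divide_distrib)
      finally show ?case by simp
    qed
  qed
  ultimately show ?thesis by (rule Lim_transform_eventually)
qed

lemma has_bochner_integral_fourier_kernel:
  assumes "n \<ge> 1"
  defines "t \<equiv> saddle n"
  shows "has_bochner_integral lborel (fourier_kernel v n)
    (of_real ((\<Prod>k\<in>{1..n}. 1 - part_prob t k) * exp (- (t * real n)) * (2 * pi * sqrt (size_var t n)))
      * (\<Sum>A\<in>distinct_part_sets n. iexp (v * (2 * (\<Sum>k\<in>A. 1 / real k) - ln (sqrt (3 * real n))))))"
  unfolding t_def fourier_kernel_def[abs_def] Let_def
  by (rule has_bochner_integral_joint_char[OF saddle_pos[OF assms(1)] assms(1)])

lemma norm_fourier_kernel_le:
  assumes "0 < saddle n" "saddle n \<le> 1" "1 / saddle n \<le> real n"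
  shows "norm (fourier_kernel v n u) \<le> 10 ^ 10 * exp (v\<^sup>2 / 3) * inverse (1 + u\<^sup>2)"
proof (cases "u \<in> {- (pi * sqrt (size_var (saddle n) n))..pi * sqrt (size_var (saddle n) n)}")
  case True
  then have "norm (joint_char (saddle n) n v u) \<le> 10 ^ 10 * exp (v\<^sup>2 / 3) / (1 + u\<^sup>2)"
    by (intro norm_joint_char_le assms) auto
  moreover have "norm (fourier_kernel v n u) = norm (joint_char (saddle n) n v u)"
    unfolding fourier_kernel_def Let_def using True by (simp add: norm_mult del: of_real_mult of_real_minus of_real_divide)
  ultimately show ?thesis by (simp only: divide_inverse)
qed (simp add: fourier_kernel_def Let_def)

lemma integral_fourier_kernel_tendsto:
  assumes \<phi>: "(\<lambda>n. \<Prod>k\<in>{1..n}. complex_of_real (cos (v / real k))) \<longlonglongrightarrow> \<phi>"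
  shows "(\<lambda>n. CLINT u|lborel. fourier_kernel v n u) \<longlonglongrightarrow> \<phi> * of_real (sqrt (2 * pi))"
proof -
  obtain N where N: "\<And>n. n \<ge> N \<Longrightarrow> n \<ge> 1 \<and> 0 < saddle n \<and> saddle n \<le> 1 \<and> 1 / saddle n \<le> real n"
    using eventually_saddle_small unfolding eventually_sequentially by blast
  \<comment> \<open>The majorant holds only from \<open>N\<close> on, hence the shifted
    sequence.\<close>
  have "(\<lambda>n. CLINT u|lborel. fourier_kernel v (n + N) u) \<longlonglongrightarrow> (CLINT u|lborel. \<phi> * of_real (exp (- (u\<^sup>2 / 2))))"
  proof (rule integral_dominated_convergence[where w = "\<lambda>u. 10 ^ 10 * exp (v\<^sup>2 / 3) * inverse (1 + u\<^sup>2)"])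
    show "fourier_kernel v (n + N) \<in> borel_measurable lborel" for n
      using has_bochner_integral_fourier_kernel[of "n + N" v] N[of "n + N"]
      by (auto simp: has_bochner_integral_iff)
    show "integrable lborel (\<lambda>u::real. 10 ^ 10 * exp (v\<^sup>2 / 3) * inverse (1 + u\<^sup>2))"
      using integrable_inverse_1_plus_square unfolding set_integrable_def
      by (intro integrable_mult_right) (simp add: einterval_eq_UNIV)
    show "AE u in lborel. (\<lambda>n. fourier_kernel v (n + N) u) \<longlonglongrightarrow> \<phi> * of_real (exp (- (u\<^sup>2 / 2)))"
      by (intro AE_I2 LIMSEQ_ignore_initial_segment fourier_kernel_tendsto \<phi>)
    show "AE u in lborel. norm (fourier_kernel v (n + N) u) \<le> 10 ^ 10 * exp (v\<^sup>2 / 3) * inverse (1 + u\<^sup>2)" for n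
      using N[of "n + N"] by (intro AE_I2 norm_fourier_kernel_le) auto
  qed simp
  then have lim: "(\<lambda>n. CLINT u|lborel. fourier_kernel v n u) \<longlonglongrightarrow> (CLINT u|lborel. \<phi> * of_real (exp (- (u\<^sup>2 / 2))))"
    by (rule LIMSEQ_offset)
  have "exp (- (u\<^sup>2 / 2)) = sqrt (2 * pi) * std_normal_density u" for u :: real
    by (simp add: std_normal_density_def)
  then have "(LINT u|lborel. exp (- (u\<^sup>2 / 2))) = sqrt (2 * pi)" by simp
  then have "(CLINT u|lborel. \<phi> * of_real (exp (- (u\<^sup>2 / 2)))) = \<phi> * of_real (sqrt (2 * pi))"
    by (simp only: integral_mult_right_zero integral_complex_of_real)
  with lim show ?thesis by (simp only:)
qed

lemma char_partition_tendsto: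
  assumes \<phi>: "(\<lambda>n. \<Prod>k\<in>{1..n}. complex_of_real (cos (v / real k))) \<longlonglongrightarrow> \<phi>"
  shows "(\<lambda>n. char (distr (partition_measure n) borel (\<lambda>ps. 2 * recip_sum ps - ln (sqrt (3 * real n)))) v) \<longlonglongrightarrow> \<phi>"
proof -
  \<comment> \<open>At \<open>v = 0\<close> every cosine is 1, so the limit product is 1. This
    integral is the number of partitions times the common prefactor and normalizes the
    quotient.\<close>
  have "(\<lambda>n. CLINT u|lborel. fourier_kernel 0 n u) \<longlonglongrightarrow> 1 * of_real (sqrt (2 * pi))"
    by (rule integral_fourier_kernel_tendsto) simp
  then have "(\<lambda>n. (CLINT u|lborel. fourier_kernel v n u) / (CLINT u|lborel. fourier_kernel 0 n u))
     \<longlonglongrightarrow> (\<phi> * of_real (sqrt (2 * pi))) / (1 * of_real (sqrt (2 * pi)))"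
    by (intro tendsto_divide integral_fourier_kernel_tendsto[OF \<phi>]) auto
  then have "(\<lambda>n. (CLINT u|lborel. fourier_kernel v n u) / (CLINT u|lborel. fourier_kernel 0 n u)) \<longlonglongrightarrow> \<phi>"
    by simp
  moreover have "\<forall>\<^sub>F n in sequentially. (CLINT u|lborel. fourier_kernel v n u) / (CLINT u|lborel. fourier_kernel 0 n u)
     = char (distr (partition_measure n) borel (\<lambda>ps. 2 * recip_sum ps - ln (sqrt (3 * real n)))) v"
    using eventually_ge_at_top[of 1]
  proof eventually_elim
    case (elim n)
    define c where "c = (\<Prod>k\<in>{1..n}. 1 - part_prob (saddle n) k) * exp (- (saddle n * real n)) * (2 * pi * sqrt (size_var (saddle n) n))"
    have "0 < (\<Prod>k\<in>{1..n}. 1 - part_prob (saddle n) k)" by (intro prod_pos) (auto simp: part_prob_lt_1)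
    then have c: "c > 0" unfolding c_def using size_var_pos[OF saddle_pos[OF elim] elim] by simp
    have I: "(CLINT u|lborel. fourier_kernel w n u)
       = of_real c * (\<Sum>A\<in>distinct_part_sets n. iexp (w * (2 * (\<Sum>k\<in>A. 1 / real k) - ln (sqrt (3 * real n)))))" for w
      using has_bochner_integral_fourier_kernel[OF elim, of w] unfolding c_def by (rule has_bochner_integral_integral_eq)
    show ?case unfolding char_partition I using c by simp
  qed
  ultimately show ?thesis by (rule Lim_transform_eventually)
qed

theorem theorem1p1:
  fixes M :: "'a measure" and \<epsilon> :: "nat \<Rightarrow> 'a \<Rightarrow> real"
  assumes "prob_space M"
    and "prob_space.indep_vars M (\<lambda>_. borel) \<epsilon> {1..}"
    and "\<And>k. k \<ge> 1 \<Longrightarrow> measure M {\<omega> \<in> space M. \<epsilon> k \<omega> = 1} = 1 / 2"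
    and "\<And>k. k \<ge> 1 \<Longrightarrow> measure M {\<omega> \<in> space M. \<epsilon> k \<omega> = -1} = 1 / 2"
  shows "(AE \<omega> in M. summable (\<lambda>k. \<epsilon> (Suc k) \<omega> / real (Suc k))) \<and>
    (\<forall>x::real.
      (\<lambda>n. measure (partition_measure n)
             {ps \<in> space (partition_measure n). 2 * recip_sum ps - ln (sqrt (3 * real n)) \<le> x})
        \<longlonglongrightarrow> measure M {\<omega> \<in> space M. random_harmonic \<epsilon> \<omega> \<le> x})"
proof -
  interpret prob_space M by fact
  interpret random_signs M \<epsilon>
    by unfold_locales (use assms in auto)
  define X where "X n = (\<lambda>ps. 2 * recip_sum ps - ln (sqrt (3 * real n)))" for n :: nat
  define D where "D n = distr (partition_measure n) borel (X n)" for n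
  have X [measurable]: "X n \<in> borel_measurable (partition_measure n)" for n
    by (simp add: partition_measure_def)
  have "weak_conv_m D (distr M borel (random_harmonic \<epsilon>))"
  proof (rule levy_continuity)
    show "real_distribution (D n)" for n
      unfolding D_def by (rule prob_space.real_distribution_distr[OF prob_space_partition_measure]) simp
    show "(\<lambda>n. char (D n) v) \<longlonglongrightarrow> char (distr M borel (random_harmonic \<epsilon>)) v" for v
      unfolding D_def X_def by (rule char_partition_tendsto[OF char_harmonic])
  qed (rule real_distribution_harmonic)
  then have "(\<lambda>n. cdf (D n) x) \<longlonglongrightarrow> cdf (distr M borel (random_harmonic \<epsilon>)) x" for x
    using isCont_cdf_harmonic unfolding weak_conv_m_def weak_conv_def by blast
  moreover have "cdf (D n) x = measure (partition_measure n) {ps \<in> space (partition_measure n). X n ps \<le> x}" for n x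
    unfolding cdf_def D_def by (subst measure_distr) (auto intro!: arg_cong[where f = "measure _"])
  moreover have "cdf (distr M borel (random_harmonic \<epsilon>)) x = measure M {\<omega> \<in> space M. random_harmonic \<epsilon> \<omega> \<le> x}" for x
    unfolding cdf_def by (subst measure_distr) (auto intro!: arg_cong[where f = "measure _"])
  ultimately show ?thesis using AE_summable_harmonic unfolding X_def by simp
qed

end
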